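(* Let $k$ be a field, let $\mathscr C$ be a skeletal finite free EI category, and let $E:\mathscr C\to k\text{-mod}$ be the functor defined in the context. Assume that $\mathscr C$ is projective over $k$. Then $E$, viewed as a left module over the category algebra $k\mathscr C$, is Gorenstein-projective.
   Context: Finite EI categories. A category is finite if it has only finitely many morphisms (hence finitely many objects). It is skeletal if any two distinct objects are non-isomorphic. A finite EI category is a finite category in which every endomorphism is an isomorphism; so $\mathrm{Hom}_{\mathscr C}(x,x)=\mathrm{Aut}_{\mathscr C}(x)$ is a finite group for each object $x$. Freeness. A morphism $\alpha:x\to y$ is unfactorizable if it is a non-isomorphism and whenever $\alpha=\gamma\circ\beta$, either $\beta$ or $\gamma$ is an isomorphism. A (skeletal) finite EI category $\mathscr C$ is free if it satisfies the Unique Factorization Property: whenever a non-isomorphism $\alpha:x\to y$ has two decompositions into unfactorizable morphisms $x=x_0\xrightarrow{\alpha_1}x_1\to\cdots\xrightarrow{\alpha_m}x_m=y$ and $x=y_0\xrightarrow{\beta_1}y_1\to\cdots\xrightarrow{\beta_n}y_n=y$, then $m=n$, $x_i=y_i$ for all $i$, and there are $h_i\in\mathrm{Aut}_{\mathscr C}(x_i)$, $1\le i\le n-1$, with $\beta_1=h_1\circ\alpha_1$, $\beta_i=h_i\circ\alpha_i\circ h_{i-1}^{-1}$ for $2\le i\le n-1$, and $\beta_n=\alpha_n\circ h_{n-1}^{-1}$. Projectivity. $\mathscr C$ is projective over $k$ if for all objects $x,y$ the $k\mathrm{Aut}_{\mathscr C}(y)$-$k\mathrm{Aut}_{\mathscr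 C}(x)$-bimodule $k\mathrm{Hom}_{\mathscr C}(x,y)$ is projective as a left module and projective as a right module. Modules. The category algebra $k\mathscr C$ has as $k$-basis the morphisms of $\mathscr C$, with product $\alpha*\beta=\alpha\circ\beta$ if composable and $0$ otherwise. $k$-mod is the category of finite dimensional $k$-vector spaces; covariant functors $\mathscr C\to k$-mod are identified with finite dimensional left $k\mathscr C$-modules via the standard equivalence $F\mapsto\bigoplus_x F(x)$. The functor $E$. Let $\mathscr C$ be a skeletal finite free EI category. For $\alpha:x\to y$ let $V(\alpha)$ be the set of objects $w$ for which there is a factorization $\alpha=\alpha''\circ\alpha'$ with $\alpha':x\to w$ and $\alpha'':w\to y$ a non-isomorphism. For $w\in V(\alpha)$ put $t_w(\alpha)=\alpha''\circ\bigl(\sum_{g\in\mathrm{Aut}_{\mathscr C}(w)}g\bigr)\in k\mathrm{Hom}_{\mathscr C}(w,y)$; by freeness this is independent of the choice of $\alpha''$. For an object $x$, $E(x)$ is the $k$-vector space with basis $\bigsqcup_{w\ne x}\mathrm{Hom}_{\mathscr C}(w,x)\cup\{e_x\}$ ($e_x$ a formal symbol). For $\alpha:x\to y$, the $k$-linear map $E(\alpha):E(x)\to E(y)$ is given by $E(\alpha)(e_x)=e_y+\sum_{w\in V(\alpha)}t_w(\alpha)$ and $E(\alpha)(\gamma)=\alpha\circ\gamma$ for $\gamma\in\mathrm{Hom}_{\mathscr C}(w,x)$, $w\ne x$. Gorenstein-projective modules. For a finite dimensional $k$-algebra $A$, write $(-)^*$ for $\mathrm{Hom}_A(-,A)$ or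 $\mathrm{Hom}_{A^{\mathrm{op}}}(-,A)$. A finite dimensional left $A$-module $G$ is Gorenstein-projective if $\mathrm{Ext}^i_A(G,A)=0=\mathrm{Ext}^i_{A^{\mathrm{op}}}(G^*,A)$ for all $i\ge1$ and the evaluation map $G\to G^{**}$ is bijective. *)

theory Defs
  imports "HOL-Algebra.Module" "HOL-Algebra.Elementary_Groups"
begin

section \<open>Finite free EI categories\<close>

record ('o, 'm) precategory =
  Obj :: "'o set"
  Mor :: "'m set"
  Dom :: "'m \<Rightarrow> 'o"
  Cod :: "'m \<Rightarrow> 'o"
  Idt :: "'o \<Rightarrow> 'm"
  Cmp :: "'m \<Rightarrow> 'm \<Rightarrow> 'm"
    \<comment> \<open>\<open>Cmp C g f\<close> is \<open>g \<circ> f\<close>; it is meaningful only if \<open>Dom C g = Cod C f\<close>\<close>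

definition Hom :: "('o, 'm) precategory \<Rightarrow> 'o \<Rightarrow> 'o \<Rightarrow> 'm set" where
  "Hom C x y = {f \<in> Mor C. Dom C f = x \<and> Cod C f = y}"

locale category =
  fixes C :: "('o, 'm) precategory"
  assumes dom_in: "f \<in> Mor C \<Longrightarrow> Dom C f \<in> Obj C"
    and cod_in: "f \<in> Mor C \<Longrightarrow> Cod C f \<in> Obj C"
    and id_in: "x \<in> Obj C \<Longrightarrow> Idt C x \<in> Hom C x x"
    and comp_in: "\<lbrakk>f \<in> Hom C x y; g \<in> Hom C y z\<rbrakk> \<Longrightarrow> Cmp C g f \<in> Hom C x z"
    and comp_id_right: "f \<in> Hom C x y \<Longrightarrow> Cmp C f (Idt C x) = f"
    and comp_id_left: "f \<in> Hom C x y \<Longrightarrow> Cmp C (Idt C y) f = f"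
    and comp_assoc: "\<lbrakk>f \<in> Hom C w x; g \<in> Hom C x y; h \<in> Hom C y z\<rbrakk>
      \<Longrightarrow> Cmp C h (Cmp C g f) = Cmp C (Cmp C h g) f"

definition inverse_mors :: "('o, 'm) precategory \<Rightarrow> 'm \<Rightarrow> 'm \<Rightarrow> bool" where
  "inverse_mors C f g \<longleftrightarrow> f \<in> Mor C \<and> g \<in> Hom C (Cod C f) (Dom C f)
     \<and> Cmp C g f = Idt C (Dom C f) \<and> Cmp C f g = Idt C (Cod C f)"

definition iso_mor :: "('o, 'm) precategory \<Rightarrow> 'm \<Rightarrow> bool" where
  "iso_mor C f \<longleftrightarrow> (\<exists>g. inverse_mors C f g)"

definition inv_mor :: "('o, 'm) precategory \<Rightarrow> 'm \<Rightarrow> 'm" where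
  "inv_mor C f = (THE g. inverse_mors C f g)"

definition Aut :: "('o, 'm) precategory \<Rightarrow> 'o \<Rightarrow> 'm set" where
  "Aut C x = {f \<in> Hom C x x. iso_mor C f}"

definition finite_category :: "('o, 'm) precategory \<Rightarrow> bool" where
  "finite_category C \<longleftrightarrow> category C \<and> finite (Mor C)"

definition skeletal :: "('o, 'm) precategory \<Rightarrow> bool" where
  "skeletal C \<longleftrightarrow> (\<forall>x\<in>Obj C. \<forall>y\<in>Obj C. x \<noteq> y \<longrightarrow> \<not> (\<exists>f\<in>Hom C x y. iso_mor C f))"

definition finite_EI_category :: "('o, 'm) precategory \<Rightarrow> bool" where
  "finite_EI_category C \<longleftrightarrow> finite_category C
     \<and> (\<forall>x\<in>Obj C. \<forall>f\<in>Hom C x x. iso_mor C f)"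

definition unfactorizable :: "('o, 'm) precategory \<Rightarrow> 'm \<Rightarrow> bool" where
  "unfactorizable C a \<longleftrightarrow> a \<in> Mor C \<and> \<not> iso_mor C a
     \<and> (\<forall>b\<in>Mor C. \<forall>c\<in>Mor C. Cod C b = Dom C c \<longrightarrow> a = Cmp C c b
          \<longrightarrow> iso_mor C b \<or> iso_mor C c)"

text \<open>A path is listed in the order of application: \<open>[a\<^sub>1, \<dots>, a\<^sub>m]\<close> has the composite
  \<open>a\<^sub>m \<circ> \<dots> \<circ> a\<^sub>1\<close>.\<close>

fun path_comp :: "('o, 'm) precategory \<Rightarrow> 'm list \<Rightarrow> 'm" where
  "path_comp C [] = undefined"
| "path_comp C [a] = a"
| "path_comp C (a # b # as) = Cmp C (path_comp C (b # as)) a"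

definition decomposition :: "('o, 'm) precategory \<Rightarrow> 'm \<Rightarrow> 'm list \<Rightarrow> bool" where
  "decomposition C a as \<longleftrightarrow> as \<noteq> [] \<and> (\<forall>b\<in>set as. unfactorizable C b)
     \<and> (\<forall>i. Suc i < length as \<longrightarrow> Cod C (as ! i) = Dom C (as ! Suc i))
     \<and> a = path_comp C as"

text \<open>Lists are indexed from \<open>0\<close>, so \<open>as ! i\<close> is \<open>\<alpha>\<^bsub>i+1\<^esub> : x\<^bsub>i\<^esub> \<rightarrow> x\<^bsub>i+1\<^esub>\<close>.  The conditions on \<open>\<beta>\<^sub>1\<close> and
  \<open>\<beta>\<^sub>n\<close> are instances of \<open>\<beta>\<^sub>i = h\<^sub>i \<circ> \<alpha>\<^sub>i \<circ> h\<^bsub>i-1\<^esub>\<^sup>-\<^sup>1\<close> under the convention that \<open>h\<^bsub>0\<^esub>\<close> and \<open>h\<^bsub>n\<^esub>\<close> are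
  identities.\<close>

definition unique_factorization :: "('o, 'm) precategory \<Rightarrow> bool" where
  "unique_factorization C \<longleftrightarrow>
     (\<forall>a\<in>Mor C. \<forall>as bs. \<not> iso_mor C a \<longrightarrow> decomposition C a as \<longrightarrow> decomposition C a bs \<longrightarrow>
        length as = length bs
        \<and> (\<forall>i<length as. Cod C (as ! i) = Cod C (bs ! i))
        \<and> (\<exists>h :: nat \<Rightarrow> 'm. h 0 = Idt C (Dom C a) \<and> h (length as) = Idt C (Cod C a)
             \<and> (\<forall>i. Suc i < length as \<longrightarrow> h (Suc i) \<in> Aut C (Cod C (as ! i)))
             \<and> (\<forall>i<length as. bs ! i = Cmp C (h (Suc i)) (Cmp C (as ! i) (inv_mor C (h i))))))"

definition skeletal_finite_free_EI :: "('o, 'm) precategory \<Rightarrow> bool" where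
  "skeletal_finite_free_EI C \<longleftrightarrow>
     finite_EI_category C \<and> skeletal C \<and> unique_factorization C"


section \<open>Modules over rings that need not be commutative\<close>

text \<open>The library locale \<open>module\<close> requires a commutative ring of scalars.  Right modules are left
  modules over the opposite ring.\<close>

locale left_module = R?: ring R + M?: abelian_group M
  for R :: "('a, 'r) ring_scheme" (structure) and M :: "('a, 'g, 's) module_scheme" (structure) +
  assumes smult_closed [simp, intro]:
      "\<lbrakk>a \<in> carrier R; x \<in> carrier M\<rbrakk> \<Longrightarrow> a \<odot>\<^bsub>M\<^esub> x \<in> carrier M"
    and smult_l_distr:
      "\<lbrakk>a \<in> carrier R; b \<in> carrier R; x \<in> carrier M\<rbrakk>
       \<Longrightarrow> (a \<oplus> b) \<odot>\<^bsub>M\<^esub> x = a \<odot>\<^bsub>M\<^esub> x \<oplus>\<^bsub>M\<^esub> b \<odot>\<^bsub>M\<^esub> x"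
    and smult_r_distr:
      "\<lbrakk>a \<in> carrier R; x \<in> carrier M; y \<in> carrier M\<rbrakk>
       \<Longrightarrow> a \<odot>\<^bsub>M\<^esub> (x \<oplus>\<^bsub>M\<^esub> y) = a \<odot>\<^bsub>M\<^esub> x \<oplus>\<^bsub>M\<^esub> a \<odot>\<^bsub>M\<^esub> y"
    and smult_assoc1:
      "\<lbrakk>a \<in> carrier R; b \<in> carrier R; x \<in> carrier M\<rbrakk>
       \<Longrightarrow> (a \<otimes> b) \<odot>\<^bsub>M\<^esub> x = a \<odot>\<^bsub>M\<^esub> (b \<odot>\<^bsub>M\<^esub> x)"
    and smult_one [simp]: "x \<in> carrier M \<Longrightarrow> \<one> \<odot>\<^bsub>M\<^esub> x = x"

definition op_ring :: "('a, 'r) ring_scheme \<Rightarrow> ('a, 'r) ring_scheme" where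
  "op_ring A = A\<lparr>monoid.mult := \<lambda>a b. b \<otimes>\<^bsub>A\<^esub> a\<rparr>"

definition regular_module :: "('a, 'r) ring_scheme \<Rightarrow> ('a, 'a) module" where
  "regular_module A = \<lparr>carrier = carrier A, monoid.mult = monoid.mult A, one = one A, zero = zero A,
     add = add A, smult = monoid.mult A\<rparr>"

definition module_hom ::
  "('a, 'r) ring_scheme \<Rightarrow> ('a, 'g) module \<Rightarrow> ('a, 'h) module \<Rightarrow> ('g \<Rightarrow> 'h) set" where
  "module_hom A M N = {f \<in> carrier M \<rightarrow>\<^sub>E carrier N.
     (\<forall>x\<in>carrier M. \<forall>y\<in>carrier M. f (x \<oplus>\<^bsub>M\<^esub> y) = f x \<oplus>\<^bsub>N\<^esub> f y)
     \<and> (\<forall>a\<in>carrier A. \<forall>x\<in>carrier M. f (a \<odot>\<^bsub>M\<^esub> x) = a \<odot>\<^bsub>N\<^esub> f x)}"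

text \<open>Projectivity is the lifting property.  A definition can only quantify over modules on types
  that occur in it; nothing is lost by the types chosen here, since the canonical surjection onto
  \<open>P\<close> from the free module on the set \<open>carrier P\<close> (finitely supported functions \<open>'p \<Rightarrow> 'a\<close>) is among
  the test maps, and \<open>P\<close> is projective in the absolute sense as soon as this one splits.\<close>

definition projective_module :: "('a, 'r) ring_scheme \<Rightarrow> ('a, 'p) module \<Rightarrow> bool" where
  "projective_module A P \<longleftrightarrow> left_module A P \<and>
     (\<forall>(M :: ('a, 'p \<Rightarrow> 'a) module) (N :: ('a, 'p) module) g f.
        left_module A M \<and> left_module A N \<and> g \<in> module_hom A M N \<and> g ` carrier M = carrier N
        \<and> f \<in> module_hom A P N
        \<longrightarrow> (\<exists>h\<in>module_hom A P M. \<forall>p\<in>carrier P. g (h p) = f p))"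

definition hom_group ::
  "('a, 'r) ring_scheme \<Rightarrow> ('a, 'g) module \<Rightarrow> ('a, 'h) module \<Rightarrow> ('g \<Rightarrow> 'h) monoid" where
  "hom_group A M N = \<lparr>carrier = module_hom A M N,
     monoid.mult = (\<lambda>f g. \<lambda>x\<in>carrier M. f x \<oplus>\<^bsub>N\<^esub> g x),
     one = (\<lambda>x\<in>carrier M. \<zero>\<^bsub>N\<^esub>)\<rparr>"

text \<open>\<open>M\<^sup>* = Hom\<^sub>A(M, A)\<close> as a left module over \<open>op_ring A\<close>, with \<open>(f \<cdot> a)(x) = f(x) a\<close>.  Since
  \<open>op_ring (op_ring A) = A\<close>, the bidual \<open>dual_module (op_ring A) (dual_module A M)\<close> is a left
  \<open>A\<close>-module.\<close>

definition dual_module :: "('a, 'r) ring_scheme \<Rightarrow> ('a, 'g) module \<Rightarrow> ('a, 'g \<Rightarrow> 'a) module" where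
  "dual_module A M = \<lparr>carrier = module_hom A M (regular_module A),
     monoid.mult = undefined, one = undefined,
     zero = (\<lambda>x\<in>carrier M. \<zero>\<^bsub>A\<^esub>),
     add = (\<lambda>f g. \<lambda>x\<in>carrier M. f x \<oplus>\<^bsub>A\<^esub> g x),
     smult = (\<lambda>a f. \<lambda>x\<in>carrier M. f x \<otimes>\<^bsub>A\<^esub> a)\<rparr>"

definition bidual_eval :: "('a, 'r) ring_scheme \<Rightarrow> ('a, 'g) module \<Rightarrow> 'g \<Rightarrow> (('g \<Rightarrow> 'a) \<Rightarrow> 'a)" where
  "bidual_eval A M x = (\<lambda>f\<in>carrier (dual_module A M). f x)"


section \<open>Ext groups\<close>

definition free_module :: "('a, 'r) ring_scheme \<Rightarrow> nat \<Rightarrow> ('a, nat \<Rightarrow> 'a) module" where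
  "free_module A n = \<lparr>carrier = {..<n} \<rightarrow>\<^sub>E carrier A,
     monoid.mult = undefined, one = undefined,
     zero = (\<lambda>i\<in>{..<n}. \<zero>\<^bsub>A\<^esub>),
     add = (\<lambda>v w. \<lambda>i\<in>{..<n}. v i \<oplus>\<^bsub>A\<^esub> w i),
     smult = (\<lambda>a v. \<lambda>i\<in>{..<n}. a \<otimes>\<^bsub>A\<^esub> v i)\<rparr>"

text \<open>Resolutions \<open>\<dots> \<rightarrow> A\<^bsup>n 1\<^esup> \<rightarrow> A\<^bsup>n 0\<^esup> \<rightarrow> M \<rightarrow> 0\<close> by free modules of finite rank, where
  \<open>d i : A\<^bsup>n (i+1)\<^esup> \<rightarrow> A\<^bsup>n i\<^esup>\<close>.  Every finite dimensional module over a finite dimensional algebra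
  has one.\<close>

definition free_resolution ::
  "('a, 'r) ring_scheme \<Rightarrow> ('a, 'g) module \<Rightarrow> (nat \<Rightarrow> nat) \<Rightarrow> (nat \<Rightarrow> (nat \<Rightarrow> 'a) \<Rightarrow> (nat \<Rightarrow> 'a))
     \<Rightarrow> ((nat \<Rightarrow> 'a) \<Rightarrow> 'g) \<Rightarrow> bool" where
  "free_resolution A M n d e \<longleftrightarrow>
     e \<in> module_hom A (free_module A (n 0)) M
     \<and> e ` carrier (free_module A (n 0)) = carrier M
     \<and> (\<forall>i. d i \<in> module_hom A (free_module A (n (Suc i))) (free_module A (n i)))
     \<and> d 0 ` carrier (free_module A (n 1))
         = {v \<in> carrier (free_module A (n 0)). e v = \<zero>\<^bsub>M\<^esub>}
     \<and> (\<forall>i. d (Suc i) ` carrier (free_module A (n (Suc (Suc i))))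
         = {v \<in> carrier (free_module A (n (Suc i))). d i v = \<zero>\<^bsub>free_module A (n i)\<^esub>})"

definition cocycles ::
  "('a, 'r) ring_scheme \<Rightarrow> (nat \<Rightarrow> nat) \<Rightarrow> (nat \<Rightarrow> (nat \<Rightarrow> 'a) \<Rightarrow> (nat \<Rightarrow> 'a)) \<Rightarrow> ('a, 'h) module
     \<Rightarrow> nat \<Rightarrow> ((nat \<Rightarrow> 'a) \<Rightarrow> 'h) set" where
  "cocycles A n d N i = {f \<in> module_hom A (free_module A (n i)) N.
     \<forall>v\<in>carrier (free_module A (n (Suc i))). f (d i v) = \<zero>\<^bsub>N\<^esub>}"

definition coboundaries ::
  "('a, 'r) ring_scheme \<Rightarrow> (nat \<Rightarrow> nat) \<Rightarrow> (nat \<Rightarrow> (nat \<Rightarrow> 'a) \<Rightarrow> (nat \<Rightarrow> 'a)) \<Rightarrow> ('a, 'h) module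
     \<Rightarrow> nat \<Rightarrow> ((nat \<Rightarrow> 'a) \<Rightarrow> 'h) set" where
  "coboundaries A n d N i = (case i of
       0 \<Rightarrow> {\<lambda>v\<in>carrier (free_module A (n 0)). \<zero>\<^bsub>N\<^esub>}
     | Suc j \<Rightarrow> (\<lambda>f. compose (carrier (free_module A (n (Suc j)))) f (d j))
         ` module_hom A (free_module A (n j)) N)"

definition resolution_cohomology ::
  "('a, 'r) ring_scheme \<Rightarrow> (nat \<Rightarrow> nat) \<Rightarrow> (nat \<Rightarrow> (nat \<Rightarrow> 'a) \<Rightarrow> (nat \<Rightarrow> 'a)) \<Rightarrow> ('a, 'h) module
     \<Rightarrow> nat \<Rightarrow> ((nat \<Rightarrow> 'a) \<Rightarrow> 'h) set monoid" where
  "resolution_cohomology A n d N i =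
     (hom_group A (free_module A (n i)) N)\<lparr>carrier := cocycles A n d N i\<rparr>
       Mod coboundaries A n d N i"

text \<open>\<open>Ext\<^sub>A\<^sup>i(M, N)\<close>, computed from some chosen resolution of \<open>M\<close>; up to isomorphism the choice is
  irrelevant.\<close>

definition Ext ::
  "('a, 'r) ring_scheme \<Rightarrow> ('a, 'g) module \<Rightarrow> ('a, 'h) module \<Rightarrow> nat
     \<Rightarrow> ((nat \<Rightarrow> 'a) \<Rightarrow> 'h) set monoid" where
  "Ext A M N i =
     (let (n, d, e) = (SOME (n, d, e). free_resolution A M n d e)
      in resolution_cohomology A n d N i)"


section \<open>Finite dimensional algebras and Gorenstein-projective modules\<close>

definition field_ring :: "'k::field ring" where
  "field_ring = \<lparr>carrier = UNIV, monoid.mult = (*), one = 1, zero = 0, add = (+)\<rparr>"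

text \<open>A \<open>k\<close>-algebra is a ring record together with a scalar multiplication by \<open>k\<close>.  The library
  locale \<open>algebra\<close> is not applicable since it requires the algebra to be commutative.\<close>

definition fd_algebra :: "('k::field, 'a) module \<Rightarrow> bool" where
  "fd_algebra A \<longleftrightarrow> ring A \<and> module field_ring A
     \<and> (\<forall>c. \<forall>a\<in>carrier A. \<forall>b\<in>carrier A.
          (c \<odot>\<^bsub>A\<^esub> a) \<otimes>\<^bsub>A\<^esub> b = c \<odot>\<^bsub>A\<^esub> (a \<otimes>\<^bsub>A\<^esub> b)
          \<and> a \<otimes>\<^bsub>A\<^esub> (c \<odot>\<^bsub>A\<^esub> b) = c \<odot>\<^bsub>A\<^esub> (a \<otimes>\<^bsub>A\<^esub> b))
     \<and> (\<exists>B. finite B \<and> B \<subseteq> carrier A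
          \<and> (\<forall>a\<in>carrier A. \<exists>c :: 'a \<Rightarrow> 'k. a = (\<Oplus>\<^bsub>A\<^esub>b\<in>B. c b \<odot>\<^bsub>A\<^esub> b)))"

text \<open>The field acts on an \<open>A\<close>-module through \<open>c \<mapsto> c \<cdot> 1\<^sub>A\<close>.\<close>

definition fd_left_module :: "('k::field, 'a) module \<Rightarrow> ('a, 'g) module \<Rightarrow> bool" where
  "fd_left_module A M \<longleftrightarrow> left_module A M
     \<and> (\<exists>B. finite B \<and> B \<subseteq> carrier M
          \<and> (\<forall>x\<in>carrier M. \<exists>c :: 'g \<Rightarrow> 'k. x = (\<Oplus>\<^bsub>M\<^esub>b\<in>B. (c b \<odot>\<^bsub>A\<^esub> \<one>\<^bsub>A\<^esub>) \<odot>\<^bsub>M\<^esub> b)))"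

definition gorenstein_projective :: "('k::field, 'a) module \<Rightarrow> ('a, 'g) module \<Rightarrow> bool" where
  "gorenstein_projective A G \<longleftrightarrow> fd_algebra A \<and> fd_left_module A G
     \<and> (\<forall>i\<ge>1. trivial_group (Ext A G (regular_module A) i))
     \<and> (\<forall>i\<ge>1. trivial_group
          (Ext (op_ring A) (dual_module A G) (regular_module (op_ring A)) i))
     \<and> bij_betw (bidual_eval A G) (carrier G)
          (carrier (dual_module (op_ring A) (dual_module A G)))"


section \<open>Linearizations\<close>

text \<open>The \<open>k\<close>-vector space with finite basis \<open>B\<close>; the element \<open>\<Sum>\<^bsub>b\<in>B\<^esub> v b \<cdot> b\<close> is the function
  \<open>v\<close>, extended by \<open>0\<close> outside \<open>B\<close>.\<close>

definition lin_carrier :: "'b set \<Rightarrow> ('b \<Rightarrow> 'k::field) set" where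
  "lin_carrier B = {v. \<forall>b. b \<notin> B \<longrightarrow> v b = 0}"

definition basis_vec :: "'b \<Rightarrow> 'b \<Rightarrow> 'k::field" where
  "basis_vec b = (\<lambda>b'. if b' = b then 1 else 0)"

definition lin_space :: "'b set \<Rightarrow> ('k::field, 'b \<Rightarrow> 'k) module" where
  "lin_space B = \<lparr>carrier = lin_carrier B, monoid.mult = undefined, one = undefined,
     zero = (\<lambda>b. 0), add = (\<lambda>v w b. v b + w b), smult = (\<lambda>c v b. c * v b)\<rparr>"

text \<open>The bilinear extension of a partial operation \<open>p\<close>, defined on the pairs in \<open>D\<close>; products of
  basis elements not in \<open>D\<close> are \<open>0\<close>.\<close>

definition bilin_ext ::
  "('s \<times> 't) set \<Rightarrow> ('s \<Rightarrow> 't \<Rightarrow> 'u) \<Rightarrow> ('s \<Rightarrow> 'k::field) \<Rightarrow> ('t \<Rightarrow> 'k) \<Rightarrow> 'u \<Rightarrow> 'k" where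
  "bilin_ext D p a b = (\<lambda>u. \<Sum>(s, t)\<in>{(s, t)\<in>D. p s t = u}. a s * b t)"

definition category_algebra :: "('o, 'm) precategory \<Rightarrow> ('k::field, 'm \<Rightarrow> 'k) module" where
  "category_algebra C = \<lparr>carrier = lin_carrier (Mor C),
     monoid.mult = bilin_ext {(g, f). g \<in> Mor C \<and> f \<in> Mor C \<and> Dom C g = Cod C f} (Cmp C),
     one = (\<lambda>f. if f \<in> Idt C ` Obj C then 1 else 0),
     zero = (\<lambda>f. 0), add = (\<lambda>a b f. a f + b f), smult = (\<lambda>c a f. c * a f)\<rparr>"

definition aut_group :: "('o, 'm) precategory \<Rightarrow> 'o \<Rightarrow> 'm monoid" where
  "aut_group C x = \<lparr>carrier = Aut C x, monoid.mult = Cmp C, one = Idt C x\<rparr>"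

definition group_algebra :: "'m monoid \<Rightarrow> ('k::field, 'm \<Rightarrow> 'k) module" where
  "group_algebra G = \<lparr>carrier = lin_carrier (carrier G),
     monoid.mult = bilin_ext (carrier G \<times> carrier G) (monoid.mult G),
     one = basis_vec (one G),
     zero = (\<lambda>f. 0), add = (\<lambda>a b f. a f + b f), smult = (\<lambda>c a f. c * a f)\<rparr>"

definition hom_left_module ::
  "('o, 'm) precategory \<Rightarrow> 'o \<Rightarrow> 'o \<Rightarrow> ('m \<Rightarrow> 'k::field, 'm \<Rightarrow> 'k) module" where
  "hom_left_module C x y = \<lparr>carrier = lin_carrier (Hom C x y), monoid.mult = undefined, one = undefined,
     zero = (\<lambda>f. 0), add = (\<lambda>v w f. v f + w f),
     smult = (\<lambda>a v. bilin_ext (Aut C y \<times> Hom C x y) (Cmp C) a v)\<rparr>"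

definition hom_right_module ::
  "('o, 'm) precategory \<Rightarrow> 'o \<Rightarrow> 'o \<Rightarrow> ('m \<Rightarrow> 'k::field, 'm \<Rightarrow> 'k) module" where
  "hom_right_module C x y = \<lparr>carrier = lin_carrier (Hom C x y), monoid.mult = undefined, one = undefined,
     zero = (\<lambda>f. 0), add = (\<lambda>v w f. v f + w f),
     smult = (\<lambda>a v. bilin_ext (Hom C x y \<times> Aut C x) (Cmp C) v a)\<rparr>"

definition projective_over :: "'k::field itself \<Rightarrow> ('o, 'm) precategory \<Rightarrow> bool" where
  "projective_over k C \<longleftrightarrow> (\<forall>x\<in>Obj C. \<forall>y\<in>Obj C.
     projective_module (group_algebra (aut_group C y) :: ('k, 'm \<Rightarrow> 'k) module)
       (hom_left_module C x y)
     \<and> projective_module (op_ring (group_algebra (aut_group C x) :: ('k, 'm \<Rightarrow> 'k) module))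
       (hom_right_module C x y))"


section \<open>Functors as modules, and the functor \<open>E\<close>\<close>

text \<open>The module \<open>\<Oplus>\<^sub>x F(x)\<close> of a functor given by the vector spaces \<open>Fo x\<close> and the maps \<open>Fm a\<close>:
  a morphism \<open>a : x \<rightarrow> y\<close> sends the \<open>x\<close>-component to the \<open>y\<close>-component by \<open>Fm a\<close> and annihilates the
  other components.\<close>

definition functor_module ::
  "('o, 'm) precategory \<Rightarrow> ('o \<Rightarrow> ('k::field, 'v) module) \<Rightarrow> ('m \<Rightarrow> 'v \<Rightarrow> 'v)
     \<Rightarrow> ('m \<Rightarrow> 'k, 'o \<Rightarrow> 'v) module" where
  "functor_module C Fo Fm = \<lparr>carrier = (\<Pi>\<^sub>E x\<in>Obj C. carrier (Fo x)),
     monoid.mult = undefined, one = undefined,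
     zero = (\<lambda>x\<in>Obj C. \<zero>\<^bsub>Fo x\<^esub>),
     add = (\<lambda>v w. \<lambda>x\<in>Obj C. v x \<oplus>\<^bsub>Fo x\<^esub> w x),
     smult = (\<lambda>a v. \<lambda>y\<in>Obj C.
       \<Oplus>\<^bsub>Fo y\<^esub>f\<in>{f \<in> Mor C. Cod C f = y}. a f \<odot>\<^bsub>Fo y\<^esub> Fm f (v (Dom C f)))\<rparr>"

text \<open>\<open>V_set C a\<close> and \<open>t_elem C a w\<close> are \<open>V(a)\<close> and \<open>t\<^sub>w(a)\<close>; the second factor \<open>a''\<close> is chosen
  arbitrarily, which for free categories does not affect \<open>t\<^sub>w(a)\<close>.\<close>

definition second_factor :: "('o, 'm) precategory \<Rightarrow> 'm \<Rightarrow> 'o \<Rightarrow> 'm \<Rightarrow> bool" where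
  "second_factor C a w a'' \<longleftrightarrow> a'' \<in> Hom C w (Cod C a) \<and> \<not> iso_mor C a''
     \<and> (\<exists>a'\<in>Hom C (Dom C a) w. a = Cmp C a'' a')"

definition V_set :: "('o, 'm) precategory \<Rightarrow> 'm \<Rightarrow> 'o set" where
  "V_set C a = {w \<in> Obj C. \<exists>a''. second_factor C a w a''}"

definition t_elem :: "('o, 'm) precategory \<Rightarrow> 'm \<Rightarrow> 'o \<Rightarrow> 'm \<Rightarrow> 'k::field" where
  "t_elem C a w = (let a'' = (SOME a''. second_factor C a w a'')
     in (\<lambda>f. \<Sum>g\<in>Aut C w. basis_vec (Cmp C a'' g) f))"

datatype ('o, 'm) E_basis = Formal 'o | Arrow 'm

definition E_basis_at :: "('o, 'm) precategory \<Rightarrow> 'o \<Rightarrow> ('o, 'm) E_basis set" where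
  "E_basis_at C x = insert (Formal x) (Arrow ` {f \<in> Mor C. Cod C f = x \<and> Dom C f \<noteq> x})"

definition E_obj :: "('o, 'm) precategory \<Rightarrow> 'o \<Rightarrow> ('k::field, ('o, 'm) E_basis \<Rightarrow> 'k) module" where
  "E_obj C x = lin_space (E_basis_at C x)"

definition arrow_part :: "('m \<Rightarrow> 'k::field) \<Rightarrow> ('o, 'm) E_basis \<Rightarrow> 'k" where
  "arrow_part v b = (case b of Formal _ \<Rightarrow> 0 | Arrow f \<Rightarrow> v f)"

fun E_on_basis ::
  "('o, 'm) precategory \<Rightarrow> 'm \<Rightarrow> ('o, 'm) E_basis \<Rightarrow> ('o, 'm) E_basis \<Rightarrow> 'k::field" where
  "E_on_basis C a (Formal x) =
     (\<lambda>b. basis_vec (Formal (Cod C a)) b + (\<Sum>w\<in>V_set C a. arrow_part (t_elem C a w) b))"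
| "E_on_basis C a (Arrow f) = basis_vec (Arrow (Cmp C a f))"

definition E_mor ::
  "('o, 'm) precategory \<Rightarrow> 'm
     \<Rightarrow> (('o, 'm) E_basis \<Rightarrow> 'k::field) \<Rightarrow> (('o, 'm) E_basis \<Rightarrow> 'k)" where
  "E_mor C a v = (\<lambda>b'. \<Sum>b\<in>E_basis_at C (Dom C a). v b * E_on_basis C a b b')"

definition E_module ::
  "('o, 'm) precategory \<Rightarrow> ('m \<Rightarrow> 'k::field, 'o \<Rightarrow> ('o, 'm) E_basis \<Rightarrow> 'k) module" where
  "E_module C = functor_module C (E_obj C) (E_mor C)"

end

theory Submission
  imports "HOL.Vector_Spaces" "HOL-Library.Function_Algebras" Defs
begin

text \<open>
  Write \<open>A\<close> for the category algebra and \<open>G\<^sub>x\<close> for the group of automorphisms of an object \<open>x\<close>.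
  Over a two-sided noetherian ring of self-injective dimension at most one on both sides, a finitely
  generated module is Gorenstein-projective as soon as it is torsionless, that is, embeds into a free
  module of finite rank.  The proof shows that \<open>A\<close> is such a ring and that \<open>E\<close> embeds into \<open>A\<close>.

  The general principle (locale \<open>torsionless_module\<close>).  Self-injective dimension at most one is used
  in the form \<open>kernel_extension\<close>: a homomorphism to \<open>A\<close> from the kernel of a map between free modules
  extends to the free module.  An embedding \<open>M \<rightarrow> A\<^sup>m\<close> continues a resolution of \<open>M\<close> to the right, so
  that each cocycle of positive degree lives on such a kernel; hence the Ext groups of \<open>M\<close> vanish.
  The dual of \<open>M\<close> is torsionless as well, being the kernel of a map between free right modules, and
  the same extension property on the right shows that \<open>M\<close> is reflexive.

  Combinatorial input.  Unique factorization implies the analogue of Levi's lemma for words: if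
  \<open>b \<circ> a = d \<circ> c\<close>, then one of \<open>a\<close>, \<open>c\<close> factors through the other (\<open>equidivisible\<close>).  Unlike unique
  factorization, this property is visibly self-dual, so whatever follows from it for \<open>C\<close> also holds
  for the opposite category, that is, for right modules.  Projectivity of the bimodules enters through
  Higman's criterion (\<open>left_weights_exist\<close>): there are functions \<open>lam\<close> and \<open>rho\<close> on the morphisms
  whose sums over the orbits \<open>G\<^sub>y a\<close> and \<open>a G\<^sub>x\<close>, taken over the group elements, are \<open>1\<close>.  They
  replace division by the orders of stabilizers.

  Injective dimension (\<open>kernel_extension_category_algebra\<close>).  Let \<open>U\<close> be the span of the
  unfactorizable morphisms and \<open>S\<close> the product of the group algebras.  For a module \<open>M\<close> inside a free
  module the map \<open>U \<otimes>\<^sub>S M \<rightarrow> M\<close> is injective (\<open>rad_free_functions\<close>).  Therefore a homomorphism on a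
  kernel can be extended object by object, from small to large ones: at \<open>y\<close> its values are prescribed
  on the kernel and on the elements \<open>u \<cdot> l\<close> with \<open>u\<close> unfactorizable, injectivity makes the two
  prescriptions compatible, and linear extension followed by averaging with \<open>lam\<close> gives a map that
  commutes with \<open>G\<^sub>y\<close> (\<open>extension_step\<close>).

  The embedding (\<open>emb_inj\<close>, \<open>emb_module_hom\<close>).  It sends the formal element \<open>e\<^sub>x\<close> to the sum of the
  elements of \<open>G\<^sub>x\<close> and an arrow \<open>c\<close> to \<open>c - tau c\<close>, where \<open>tau\<close> deletes the first unfactorizable
  factor of \<open>c\<close> and puts a weighted sum of automorphisms in its place.  The definition of \<open>E\<close> on \<open>e\<^sub>x\<close>
  turns into a telescoping sum, so the map is a homomorphism; it is injective because it is
  unitriangular with respect to the domains of the arrows.  In particular the functoriality of \<open>E\<close> is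
  inherited from the associativity of \<open>A\<close>.
\<close>

section \<open>Free modules and two conditions on a ring\<close>

lemma op_ring_simps [simp]:
  "carrier (op_ring A) = carrier A" "zero (op_ring A) = zero A" "one (op_ring A) = one A"
  "add (op_ring A) = add A" "op_ring (op_ring A) = A" "monoid.mult (op_ring A) x y = y \<otimes>\<^bsub>A\<^esub> x"
  by (simp_all add: op_ring_def)

lemma regular_module_simps [simp]:
  "carrier (regular_module A) = carrier A" "zero (regular_module A) = zero A"
  "add (regular_module A) = add A" "smult (regular_module A) = monoid.mult A"
  by (simp_all add: regular_module_def)

lemma free_module_simps [simp]:
  "carrier (free_module A n) = {..<n} \<rightarrow>\<^sub>E carrier A"
  "zero (free_module A n) = (\<lambda>i\<in>{..<n}. \<zero>\<^bsub>A\<^esub>)"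
  "add (free_module A n) = (\<lambda>v w. \<lambda>i\<in>{..<n}. v i \<oplus>\<^bsub>A\<^esub> w i)"
  "smult (free_module A n) = (\<lambda>a v. \<lambda>i\<in>{..<n}. a \<otimes>\<^bsub>A\<^esub> v i)"
  by (simp_all add: free_module_def)

lemma dual_module_simps [simp]:
  "carrier (dual_module A M) = module_hom A M (regular_module A)"
  "zero (dual_module A M) = (\<lambda>x\<in>carrier M. \<zero>\<^bsub>A\<^esub>)"
  "add (dual_module A M) = (\<lambda>f g. \<lambda>x\<in>carrier M. f x \<oplus>\<^bsub>A\<^esub> g x)"
  "smult (dual_module A M) = (\<lambda>a f. \<lambda>x\<in>carrier M. f x \<otimes>\<^bsub>A\<^esub> a)"
  by (simp_all add: dual_module_def)

lemma ring_op_ring: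
  assumes "ring A" shows "ring (op_ring A)"
proof -
  interpret ring A by fact
  show ?thesis
  proof (rule ringI)
    show "abelian_group (op_ring A)"
    proof (rule abelian_groupI)
      fix x assume "x \<in> carrier (op_ring A)"
      then show "\<exists>y\<in>carrier (op_ring A). y \<oplus>\<^bsub>op_ring A\<^esub> x = \<zero>\<^bsub>op_ring A\<^esub>"
        by (intro bexI[of _ "\<ominus>\<^bsub>A\<^esub> x"]) (auto simp: l_neg)
    qed (auto simp: a_ac)
    show "Group.monoid (op_ring A)"
      by (rule monoidI) (auto simp: m_assoc)
  qed (auto simp: l_distr r_distr)
qed

lemma finsum_op_ring [simp]: "finsum (op_ring A) = finsum A"
proof -
  have "add_monoid (op_ring A) = add_monoid A" by (simp add: op_ring_def)
  then show ?thesis by (simp add: finsum_def fun_eq_iff)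
qed

definition submod :: "('a, 'r) ring_scheme \<Rightarrow> ('a, 'g) module \<Rightarrow> 'g set \<Rightarrow> bool" where
  "submod A M K \<longleftrightarrow> K \<subseteq> carrier M \<and> \<zero>\<^bsub>M\<^esub> \<in> K \<and> (\<forall>x\<in>K. \<forall>y\<in>K. x \<oplus>\<^bsub>M\<^esub> y \<in> K)
     \<and> (\<forall>a\<in>carrier A. \<forall>x\<in>K. a \<odot>\<^bsub>M\<^esub> x \<in> K)"

text \<open>The noetherian condition, with generators of the submodule packaged as a homomorphism.\<close>

definition fg_submodules :: "('a, 'r) ring_scheme \<Rightarrow> bool" where
  "fg_submodules A \<longleftrightarrow> (\<forall>n K. submod A (free_module A n) K \<longrightarrow>
     (\<exists>m. \<exists>d\<in>module_hom A (free_module A m) (free_module A n). d ` carrier (free_module A m) = K))"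

definition ker_on :: "('a, 'r) ring_scheme \<Rightarrow> nat \<Rightarrow> nat \<Rightarrow> ((nat \<Rightarrow> 'a) \<Rightarrow> (nat \<Rightarrow> 'a)) \<Rightarrow> (nat \<Rightarrow> 'a) set" where
  "ker_on A n m p = {v \<in> carrier (free_module A n). p v = \<zero>\<^bsub>free_module A m\<^esub>}"

text \<open>Since the kernel of \<open>p\<close> is a second syzygy of the cokernel of \<open>p\<close>, this says that \<open>Ext\<^sup>2\<close> of
  finitely presented modules with values in \<open>A\<close> vanishes: \<open>A\<close> has injective dimension at most one.
  The map \<open>f\<close> is given by its values on the kernel only, so that the kernel need not be made a module.\<close>

definition kernel_extension :: "('a, 'r) ring_scheme \<Rightarrow> bool" where
  "kernel_extension A \<longleftrightarrow> (\<forall>n m p f. p \<in> module_hom A (free_module A n) (free_module A m)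
     \<longrightarrow> (\<forall>v\<in>ker_on A n m p. f v \<in> carrier A)
     \<longrightarrow> (\<forall>v\<in>ker_on A n m p. \<forall>w\<in>ker_on A n m p. f (v \<oplus>\<^bsub>free_module A n\<^esub> w) = f v \<oplus>\<^bsub>A\<^esub> f w)
     \<longrightarrow> (\<forall>a\<in>carrier A. \<forall>v\<in>ker_on A n m p. f (a \<odot>\<^bsub>free_module A n\<^esub> v) = a \<otimes>\<^bsub>A\<^esub> f v)
     \<longrightarrow> (\<exists>g\<in>module_hom A (free_module A n) (regular_module A). \<forall>v\<in>ker_on A n m p. g v = f v))"

lemma module_homI:
  assumes "\<And>x. x \<in> carrier M \<Longrightarrow> f x \<in> carrier N" "\<And>x. x \<notin> carrier M \<Longrightarrow> f x = undefined"
    "\<And>x y. x \<in> carrier M \<Longrightarrow> y \<in> carrier M \<Longrightarrow> f (x \<oplus>\<^bsub>M\<^esub> y) = f x \<oplus>\<^bsub>N\<^esub> f y"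
    "\<And>a x. a \<in> carrier A \<Longrightarrow> x \<in> carrier M \<Longrightarrow> f (a \<odot>\<^bsub>M\<^esub> x) = a \<odot>\<^bsub>N\<^esub> f x"
  shows "f \<in> module_hom A M N"
  using assms by (auto simp: module_hom_def PiE_def extensional_def)

lemma module_homD:
  assumes "f \<in> module_hom A M N"
  shows "x \<in> carrier M \<Longrightarrow> f x \<in> carrier N"
    "x \<notin> carrier M \<Longrightarrow> f x = undefined"
    "x \<in> carrier M \<Longrightarrow> y \<in> carrier M \<Longrightarrow> f (x \<oplus>\<^bsub>M\<^esub> y) = f x \<oplus>\<^bsub>N\<^esub> f y"
    "a \<in> carrier A \<Longrightarrow> x \<in> carrier M \<Longrightarrow> f (a \<odot>\<^bsub>M\<^esub> x) = a \<odot>\<^bsub>N\<^esub> f x"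
  using assms by (auto simp: module_hom_def PiE_def extensional_def)

lemma module_hom_ext:
  assumes "f \<in> module_hom A M N" "g \<in> module_hom A M N" "\<And>x. x \<in> carrier M \<Longrightarrow> f x = g x"
  shows "f = g"
  using assms module_homD(2) by (metis ext)

context ring
begin

lemma left_module_free_module: "left_module R (free_module R n)"
proof (intro left_module.intro left_module_axioms.intro)
  show "abelian_group (free_module R n)"
  proof (rule abelian_groupI)
    fix x assume x: "x \<in> carrier (free_module R n)"
    then show "\<exists>y\<in>carrier (free_module R n). y \<oplus>\<^bsub>free_module R n\<^esub> x = \<zero>\<^bsub>free_module R n\<^esub>"
      by (intro bexI[of _ "\<lambda>i\<in>{..<n}. \<ominus> x i"]) (auto simp: l_neg PiE_iff intro!: restrict_ext)
  qed (auto simp: PiE_iff a_assoc extensional_def fun_eq_iff intro!: restrict_ext a_comm)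
qed (auto simp: PiE_iff l_distr r_distr m_assoc extensional_def fun_eq_iff
       intro!: restrict_ext ring_axioms)

lemma left_module_regular_module: "left_module R (regular_module R)"
proof (intro left_module.intro left_module_axioms.intro)
  show "abelian_group (regular_module R)"
  proof (rule abelian_groupI)
    fix x assume x: "x \<in> carrier (regular_module R)"
    then show "\<exists>y\<in>carrier (regular_module R). y \<oplus>\<^bsub>regular_module R\<^esub> x = \<zero>\<^bsub>regular_module R\<^esub>"
      by (intro bexI[of _ "\<ominus> x"]) (auto simp: l_neg)
  qed (auto simp: a_ac)
qed (auto simp: l_distr r_distr m_assoc intro!: ring_axioms)

end

lemma (in left_module) smult_zero_left: "x \<in> carrier M \<Longrightarrow> \<zero>\<^bsub>R\<^esub> \<odot>\<^bsub>M\<^esub> x = \<zero>\<^bsub>M\<^esub>"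
  by (metis M.add.l_cancel_one M.l_zero M.zero_closed R.l_zero R.zero_closed smult_closed smult_l_distr M.add.r_cancel_one)

lemma (in left_module) smult_zero_right: "a \<in> carrier R \<Longrightarrow> a \<odot>\<^bsub>M\<^esub> \<zero>\<^bsub>M\<^esub> = \<zero>\<^bsub>M\<^esub>"
  by (metis M.add.l_cancel_one M.l_zero M.zero_closed smult_closed smult_r_distr)

lemma module_hom_zero:
  assumes "left_module A M" "left_module A N" "f \<in> module_hom A M N"
  shows "f \<zero>\<^bsub>M\<^esub> = \<zero>\<^bsub>N\<^esub>"
proof -
  interpret M: left_module A M by fact
  interpret N: left_module A N by fact
  have "f \<zero>\<^bsub>M\<^esub> = f (\<zero>\<^bsub>A\<^esub> \<odot>\<^bsub>M\<^esub> \<zero>\<^bsub>M\<^esub>)" by (simp add: M.smult_zero_left)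
  also have "\<dots> = \<zero>\<^bsub>A\<^esub> \<odot>\<^bsub>N\<^esub> f \<zero>\<^bsub>M\<^esub>" using assms(3) by (simp add: module_homD(4))
  also have "\<dots> = \<zero>\<^bsub>N\<^esub>" using assms(3) by (simp add: N.smult_zero_left module_homD(1))
  finally show ?thesis .
qed

lemma submod_kernel:
  assumes "left_module A M" "left_module A N" "f \<in> module_hom A M N"
  shows "submod A M {x \<in> carrier M. f x = \<zero>\<^bsub>N\<^esub>}"
proof -
  interpret M: left_module A M by fact
  interpret N: left_module A N by fact
  show ?thesis using module_hom_zero[OF assms] module_homD[OF assms(3)]
    by (auto simp: submod_def N.smult_zero_right)
qed

lemma submod_image:
  assumes "left_module A M" "left_module A N" "f \<in> module_hom A M N"
  shows "submod A N (f ` carrier M)"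
proof -
  interpret M: left_module A M by fact
  interpret N: left_module A N by fact
  have "\<zero>\<^bsub>N\<^esub> \<in> f ` carrier M" using module_hom_zero[OF assms] by (metis M.M.zero_closed imageI)
  then show ?thesis using module_homD[OF assms(3)] unfolding submod_def
    by (auto simp flip: module_homD(3,4)[OF assms(3)] intro!: imageI)
qed

lemma compose_module_hom:
  assumes "f \<in> module_hom A L M" "g \<in> module_hom A M N"
    and "\<And>x y. x \<in> carrier L \<Longrightarrow> y \<in> carrier L \<Longrightarrow> x \<oplus>\<^bsub>L\<^esub> y \<in> carrier L"
    and "\<And>a x. a \<in> carrier A \<Longrightarrow> x \<in> carrier L \<Longrightarrow> a \<odot>\<^bsub>L\<^esub> x \<in> carrier L"
  shows "compose (carrier L) g f \<in> module_hom A L N"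
  using assms(3,4) module_homD[OF assms(1)] module_homD[OF assms(2)]
  by (intro module_homI) (auto simp: compose_def)

section \<open>Vanishing of Ext for torsionless modules\<close>

definition unit_vec :: "('a, 'r) ring_scheme \<Rightarrow> nat \<Rightarrow> nat \<Rightarrow> nat \<Rightarrow> 'a" where
  "unit_vec A n j = (\<lambda>i\<in>{..<n}. if i = j then \<one>\<^bsub>A\<^esub> else \<zero>\<^bsub>A\<^esub>)"

definition dot :: "('a, 'r) ring_scheme \<Rightarrow> nat \<Rightarrow> (nat \<Rightarrow> 'a) \<Rightarrow> (nat \<Rightarrow> 'a) \<Rightarrow> 'a" where
  "dot A n v w = (\<Oplus>\<^bsub>A\<^esub>i\<in>{..<n}. v i \<otimes>\<^bsub>A\<^esub> w i)"

context ring
begin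

lemma unit_vec_closed [simp, intro]: "unit_vec R n j \<in> carrier (free_module R n)"
  by (auto simp: unit_vec_def)

lemma dot_closed [simp, intro]:
  "v \<in> {..<n} \<rightarrow>\<^sub>E carrier R \<Longrightarrow> w \<in> {..<n} \<rightarrow>\<^sub>E carrier R \<Longrightarrow> dot R n v w \<in> carrier R"
  unfolding dot_def by (intro finsum_closed) (auto simp: PiE_iff)

lemma dot_add_left:
  assumes "v \<in> {..<n} \<rightarrow>\<^sub>E carrier R" "v' \<in> {..<n} \<rightarrow>\<^sub>E carrier R" "w \<in> {..<n} \<rightarrow>\<^sub>E carrier R"
  shows "dot R n (\<lambda>i\<in>{..<n}. v i \<oplus> v' i) w = dot R n v w \<oplus> dot R n v' w"
proof -
  have "dot R n (\<lambda>i\<in>{..<n}. v i \<oplus> v' i) w = (\<Oplus>i\<in>{..<n}. v i \<otimes> w i \<oplus> v' i \<otimes> w i)"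
    unfolding dot_def using assms by (intro finsum_cong') (auto simp: PiE_iff l_distr)
  also have "\<dots> = dot R n v w \<oplus> dot R n v' w"
    unfolding dot_def using assms by (intro finsum_addf) (auto simp: PiE_iff)
  finally show ?thesis .
qed

lemma dot_add_right:
  assumes "v \<in> {..<n} \<rightarrow>\<^sub>E carrier R" "w \<in> {..<n} \<rightarrow>\<^sub>E carrier R" "w' \<in> {..<n} \<rightarrow>\<^sub>E carrier R"
  shows "dot R n v (\<lambda>i\<in>{..<n}. w i \<oplus> w' i) = dot R n v w \<oplus> dot R n v w'"
proof -
  have "dot R n v (\<lambda>i\<in>{..<n}. w i \<oplus> w' i) = (\<Oplus>i\<in>{..<n}. v i \<otimes> w i \<oplus> v i \<otimes> w' i)"
    unfolding dot_def using assms by (intro finsum_cong') (auto simp: PiE_iff r_distr)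
  also have "\<dots> = dot R n v w \<oplus> dot R n v w'"
    unfolding dot_def using assms by (intro finsum_addf) (auto simp: PiE_iff)
  finally show ?thesis .
qed

lemma dot_smult_left:
  assumes "a \<in> carrier R" "v \<in> {..<n} \<rightarrow>\<^sub>E carrier R" "w \<in> {..<n} \<rightarrow>\<^sub>E carrier R"
  shows "dot R n (\<lambda>i\<in>{..<n}. a \<otimes> v i) w = a \<otimes> dot R n v w"
proof -
  have "dot R n (\<lambda>i\<in>{..<n}. a \<otimes> v i) w = (\<Oplus>i\<in>{..<n}. a \<otimes> (v i \<otimes> w i))"
    unfolding dot_def using assms by (intro finsum_cong') (auto simp: PiE_iff m_assoc)
  also have "\<dots> = a \<otimes> dot R n v w"
    unfolding dot_def using assms by (intro finsum_rdistr[symmetric]) (auto simp: PiE_iff)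
  finally show ?thesis .
qed

lemma dot_smult_right:
  assumes "a \<in> carrier R" "v \<in> {..<n} \<rightarrow>\<^sub>E carrier R" "w \<in> {..<n} \<rightarrow>\<^sub>E carrier R"
  shows "dot R n v (\<lambda>i\<in>{..<n}. w i \<otimes> a) = dot R n v w \<otimes> a"
proof -
  have "dot R n v (\<lambda>i\<in>{..<n}. w i \<otimes> a) = (\<Oplus>i\<in>{..<n}. (v i \<otimes> w i) \<otimes> a)"
    unfolding dot_def using assms by (intro finsum_cong') (auto simp: PiE_iff m_assoc)
  also have "\<dots> = dot R n v w \<otimes> a"
    unfolding dot_def using assms by (intro finsum_ldistr[symmetric]) (auto simp: PiE_iff)
  finally show ?thesis .
qed

lemma dot_unit_vec:
  assumes "w \<in> {..<n} \<rightarrow>\<^sub>E carrier R" "j < n"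
  shows "dot R n (unit_vec R n j) w = w j"
proof -
  have "dot R n (unit_vec R n j) w = (\<Oplus>i\<in>{..<n}. if j = i then w i else \<zero>)"
    unfolding dot_def using assms by (intro finsum_cong') (auto simp: PiE_iff unit_vec_def)
  also have "\<dots> = w j" using assms by (intro finsum_singleton) (auto simp: PiE_iff)
  finally show ?thesis .
qed

lemma dot_module_hom:
  assumes "w \<in> {..<n} \<rightarrow>\<^sub>E carrier R"
  shows "(\<lambda>v\<in>carrier (free_module R n). dot R n v w)
    \<in> module_hom R (free_module R n) (regular_module R)"
proof -
  interpret F: left_module R "free_module R n" by (rule left_module_free_module)
  show ?thesis
  proof (rule module_homI)
    fix x y assume "x \<in> carrier (free_module R n)" "y \<in> carrier (free_module R n)"
    moreover from this have "x \<oplus>\<^bsub>free_module R n\<^esub> y \<in> carrier (free_module R n)"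
      by (rule F.M.a_closed)
    ultimately show "(\<lambda>v\<in>carrier (free_module R n). dot R n v w) (x \<oplus>\<^bsub>free_module R n\<^esub> y)
      = (\<lambda>v\<in>carrier (free_module R n). dot R n v w) x \<oplus>\<^bsub>regular_module R\<^esub> (\<lambda>v\<in>carrier (free_module R n). dot R n v w) y"
      using dot_add_left assms by simp
  next
    fix a x assume "a \<in> carrier R" "x \<in> carrier (free_module R n)"
    moreover from this have "a \<odot>\<^bsub>free_module R n\<^esub> x \<in> carrier (free_module R n)"
      by (rule F.smult_closed)
    ultimately show "(\<lambda>v\<in>carrier (free_module R n). dot R n v w) (a \<odot>\<^bsub>free_module R n\<^esub> x)
      = a \<odot>\<^bsub>regular_module R\<^esub> (\<lambda>v\<in>carrier (free_module R n). dot R n v w) x"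
      using dot_smult_left assms by simp
  qed (use assms in auto)
qed

lemma free_module_hom_eq_dot:
  assumes f: "f \<in> module_hom R (free_module R n) (regular_module R)"
    and v: "v \<in> carrier (free_module R n)"
  shows "f v = dot R n v (\<lambda>i\<in>{..<n}. f (unit_vec R n i))"
proof -
  let ?F = "free_module R n" and ?w = "\<lambda>i\<in>{..<n}. f (unit_vec R n i)"
  interpret F: left_module R ?F by (rule left_module_free_module)
  have w: "?w \<in> {..<n} \<rightarrow>\<^sub>E carrier R" using module_homD(1)[OF f] unit_vec_closed by auto
  let ?g = "\<lambda>v\<in>carrier ?F. dot R n v ?w"
  have g: "?g \<in> module_hom R ?F (regular_module R)" using w by (rule dot_module_hom)
  \<comment> \<open>induction on the number \<open>m\<close> of coordinates that may be nonzero; each step splits off the last one\<close>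
  have "f v = ?g v" if "v \<in> carrier ?F" "\<And>i. m \<le> i \<Longrightarrow> i < n \<Longrightarrow> v i = \<zero>" "m \<le> n" for m v
    using that
  proof (induction m arbitrary: v)
    case 0
    then have "v = \<zero>\<^bsub>?F\<^esub>" by (auto simp: fun_eq_iff PiE_iff extensional_def)
    then show ?case
      using module_hom_zero[OF left_module_free_module left_module_regular_module f]
        module_hom_zero[OF left_module_free_module left_module_regular_module g]
      by (simp only: regular_module_simps)
  next
    case (Suc m)
    define v' where "v' = (\<lambda>i\<in>{..<n}. if i = m then \<zero> else v i)"
    have v': "v' \<in> carrier ?F" using Suc.prems by (auto simp: v'_def)
    have u: "unit_vec R n m \<in> carrier ?F" by (rule unit_vec_closed)
    have vm: "v m \<in> carrier R" using Suc.prems by (auto simp: PiE_iff)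
    have vu: "v m \<odot>\<^bsub>?F\<^esub> unit_vec R n m \<in> carrier ?F" using F.smult_closed[OF vm u] .
    have eq: "v = v' \<oplus>\<^bsub>?F\<^esub> (v m \<odot>\<^bsub>?F\<^esub> unit_vec R n m)"
    proof
      fix i show "v i = (v' \<oplus>\<^bsub>?F\<^esub> (v m \<odot>\<^bsub>?F\<^esub> unit_vec R n m)) i"
        using Suc.prems(1) vm by (cases "i < n") (auto simp: v'_def unit_vec_def PiE_iff extensional_def)
    qed
    have IH: "f v' = ?g v'"
    proof (rule Suc.IH[OF v'])
      show "v' i = \<zero>" if "m \<le> i" "i < n" for i
        using Suc.prems(2)[of i] that by (auto simp: v'_def)
    qed (use Suc.prems in auto)
    have unit: "f (unit_vec R n m) = ?g (unit_vec R n m)"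
      using dot_unit_vec[OF w, of m] u Suc.prems(3) by simp
    have "h v = h v' \<oplus> v m \<otimes> h (unit_vec R n m)"
      if h: "h \<in> module_hom R ?F (regular_module R)" for h
      using module_homD(3)[OF h v' vu] module_homD(4)[OF h vm u] eq by simp
    from this[OF f] this[OF g] IH unit show ?case by metis
  qed
  from this[of v n] v show ?thesis by auto
qed

end

text \<open>Each differential covers the kernel of the previous one.  The recursion carries that kernel along,
  together with the ranks of the two free modules.\<close>

lemma free_resolution_exists:
  assumes R: "ring A" and fg: "fg_submodules A"
    and e: "e \<in> module_hom A (free_module A k) M" "e ` carrier (free_module A k) = carrier M"
    and sub: "submod A (free_module A k) {v \<in> carrier (free_module A k). e v = \<zero>\<^bsub>M\<^esub>}"
  shows "\<exists>n d. free_resolution A M n d e \<and> n 0 = k"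
proof -
  interpret ring A by fact
  \<comment> \<open>a stage is \<open>(a, K, b, d)\<close> with \<open>d\<close> mapping the free module of rank \<open>b\<close> onto the submodule \<open>K\<close> of the one of rank \<open>a\<close>\<close>
  define P where "P = (\<lambda>(i::nat) (a, K, b, d). submod A (free_module A a) K
     \<and> d \<in> module_hom A (free_module A b) (free_module A a) \<and> d ` carrier (free_module A b) = K
     \<and> (i = 0 \<longrightarrow> a = k \<and> K = {v \<in> carrier (free_module A k). e v = \<zero>\<^bsub>M\<^esub>}))"
  define Q where "Q = (\<lambda>(i::nat) (a::nat, K::(nat \<Rightarrow> 'a) set, b, d) (a', K', b'::nat, d'::(nat \<Rightarrow> 'a) \<Rightarrow> (nat \<Rightarrow> 'a)).
     a' = b \<and> K' = {v \<in> carrier (free_module A b). d v = \<zero>\<^bsub>free_module A a\<^esub>})"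
  have "\<exists>f. \<forall>i. P i (f i) \<and> Q i (f i) (f (Suc i))"
  proof (rule dependent_nat_choice)
    obtain b d where "d \<in> module_hom A (free_module A b) (free_module A k)"
      "d ` carrier (free_module A b) = {v \<in> carrier (free_module A k). e v = \<zero>\<^bsub>M\<^esub>}"
      using fg sub unfolding fg_submodules_def by blast
    then have "P 0 (k, {v \<in> carrier (free_module A k). e v = \<zero>\<^bsub>M\<^esub>}, b, d)"
      using sub by (simp add: P_def del: free_module_simps)
    then show "\<exists>x. P 0 x" ..
  next
    fix x i assume "P i x"
    then obtain a K b d where x: "x = (a, K, b, d)"
      and d: "d \<in> module_hom A (free_module A b) (free_module A a)" by (cases x) (simp add: P_def del: free_module_simps)
    let ?K = "{v \<in> carrier (free_module A b). d v = \<zero>\<^bsub>free_module A a\<^esub>}"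
    have "submod A (free_module A b) ?K"
      using submod_kernel[OF left_module_free_module left_module_free_module d] .
    then obtain c d' where "d' \<in> module_hom A (free_module A c) (free_module A b)"
      "d' ` carrier (free_module A c) = ?K" "submod A (free_module A b) ?K"
      using fg unfolding fg_submodules_def by blast
    then show "\<exists>y. P (Suc i) y \<and> Q i x y"
      by (intro exI[of _ "(b, ?K, c, d')"]) (simp add: P_def Q_def x del: free_module_simps)
  qed
  then obtain f where f: "\<And>i. P i (f i)" "\<And>i. Q i (f i) (f (Suc i))" by blast
  define n where "n i = fst (f i)" for i
  define d where "d i = snd (snd (snd (f i)))" for i
  have f_eq: "f i = (n i, fst (snd (f i)), n (Suc i), d i)" for i
    using f(2)[of i] by (cases "f i"; cases "f (Suc i)") (simp add: n_def d_def Q_def del: free_module_simps)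
  have P: "P i (n i, fst (snd (f i)), n (Suc i), d i)" for i using f(1)[of i] f_eq[of i] by simp
  have Q: "Q i (n i, fst (snd (f i)), n (Suc i), d i) (n (Suc i), fst (snd (f (Suc i))), n (Suc (Suc i)), d (Suc i))" for i
    using f(2)[of i] f_eq[of i] f_eq[of "Suc i"] by simp
  have n0: "n 0 = k" and K0: "fst (snd (f 0)) = {v \<in> carrier (free_module A k). e v = \<zero>\<^bsub>M\<^esub>}"
    using P[of 0] by (simp_all add: P_def)
  have dh: "d i \<in> module_hom A (free_module A (n (Suc i))) (free_module A (n i))"
    and di: "d i ` carrier (free_module A (n (Suc i))) = fst (snd (f i))" for i
    using P[of i] by (simp_all add: P_def del: free_module_simps)
  have KS: "fst (snd (f (Suc i)))
      = {v \<in> carrier (free_module A (n (Suc i))). d i v = \<zero>\<^bsub>free_module A (n i)\<^esub>}" for i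
    using Q[of i] by (simp add: Q_def del: free_module_simps)
  have "free_resolution A M n d e"
    unfolding free_resolution_def di KS One_nat_def K0 n0 using e dh by blast
  moreover have "n 0 = k" using P[of 0] by (simp add: P_def)
  ultimately show ?thesis by blast
qed

lemma trivial_group_Mod_carrier:
  assumes "group G" shows "trivial_group (G Mod carrier G)"
proof -
  interpret group G by fact
  have n: "carrier G \<lhd> G" by (simp add: normal_inv_iff subgroup_self)
  have "rcosets\<^bsub>G\<^esub> carrier G = {carrier G}"
    by (auto simp: RCOSETS_def coset_join2 subgroup_self)
  then show ?thesis
    using normal.factorgroup_is_group[OF n] by (simp add: trivial_group_def FactGroup_def)
qed

lemma group_cocycles:
  assumes R: "ring A" and d: "d i \<in> module_hom A (free_module A (n (Suc i))) (free_module A (n i))"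
  shows "group ((hom_group A (free_module A (n i)) (regular_module A))
    \<lparr>carrier := cocycles A n d (regular_module A) i\<rparr>)"
proof -
  interpret ring A by fact
  let ?F = "free_module A (n i)"
  interpret F: left_module A ?F by (rule left_module_free_module)
  have clo: "(\<lambda>x\<in>carrier ?F. f x \<oplus>\<^bsub>A\<^esub> g x) \<in> cocycles A n d (regular_module A) i"
    if "f \<in> cocycles A n d (regular_module A) i" "g \<in> cocycles A n d (regular_module A) i" for f g
  proof -
    have fg: "f \<in> module_hom A ?F (regular_module A)" "g \<in> module_hom A ?F (regular_module A)"
      using that by (auto simp: cocycles_def)
    have "(\<lambda>x\<in>carrier ?F. f x \<oplus>\<^bsub>A\<^esub> g x) \<in> module_hom A ?F (regular_module A)"
      using module_homD[OF fg(1)] module_homD[OF fg(2)] F.M.a_closed F.smult_closed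
      by (intro module_homI) (auto simp: r_distr a_ac simp del: free_module_simps)
    then show ?thesis using that module_homD(1)[OF d]
      by (auto simp: cocycles_def simp del: free_module_simps)
  qed
  have neg: "(\<lambda>x\<in>carrier ?F. \<ominus>\<^bsub>A\<^esub> f x) \<in> cocycles A n d (regular_module A) i"
    if "f \<in> cocycles A n d (regular_module A) i" for f
  proof -
    have f: "f \<in> module_hom A ?F (regular_module A)"
      using that by (auto simp: cocycles_def)
    have "(\<lambda>x\<in>carrier ?F. \<ominus>\<^bsub>A\<^esub> f x) \<in> module_hom A ?F (regular_module A)"
      using module_homD[OF f] F.M.a_closed F.smult_closed
      by (intro module_homI) (auto simp: minus_add r_minus simp del: free_module_simps)
    then show ?thesis using that module_homD(1)[OF d]
      by (auto simp: cocycles_def simp del: free_module_simps)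
  qed
  have zero: "(\<lambda>x\<in>carrier ?F. \<zero>\<^bsub>A\<^esub>) \<in> cocycles A n d (regular_module A) i"
  proof -
    have "(\<lambda>x\<in>carrier ?F. \<zero>\<^bsub>A\<^esub>) \<in> module_hom A ?F (regular_module A)"
      using F.M.a_closed F.smult_closed
      by (intro module_homI) (auto simp del: free_module_simps)
    then show ?thesis using module_homD(1)[OF d]
      by (auto simp: cocycles_def simp del: free_module_simps)
  qed
  have cD: "f x \<in> carrier A" if "f \<in> cocycles A n d (regular_module A) i" "x \<in> carrier ?F" for f x
    using that module_homD(1)[of f A ?F "regular_module A" x] by (simp add: cocycles_def del: free_module_simps)
  have cE: "f x = undefined" if "f \<in> cocycles A n d (regular_module A) i" "x \<notin> carrier ?F" for f x
    using that module_homD(2)[of f A ?F "regular_module A" x] by (simp add: cocycles_def del: free_module_simps)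
  show ?thesis
  proof (rule groupI)
    fix f assume "f \<in> carrier (hom_group A ?F (regular_module A)\<lparr>carrier := cocycles A n d (regular_module A) i\<rparr>)"
    then have f: "f \<in> cocycles A n d (regular_module A) i" by simp
    then show "\<one>\<^bsub>hom_group A ?F (regular_module A)\<lparr>carrier := cocycles A n d (regular_module A) i\<rparr>\<^esub>
        \<otimes>\<^bsub>hom_group A ?F (regular_module A)\<lparr>carrier := cocycles A n d (regular_module A) i\<rparr>\<^esub> f = f"
      using cD[OF f] cE[OF f] by (auto simp: hom_group_def fun_eq_iff restrict_def simp del: free_module_simps)
    show "\<exists>g\<in>carrier (hom_group A ?F (regular_module A)\<lparr>carrier := cocycles A n d (regular_module A) i\<rparr>).
       g \<otimes>\<^bsub>hom_group A ?F (regular_module A)\<lparr>carrier := cocycles A n d (regular_module A) i\<rparr>\<^esub> f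
       = \<one>\<^bsub>hom_group A ?F (regular_module A)\<lparr>carrier := cocycles A n d (regular_module A) i\<rparr>\<^esub>"
      using cD[OF f] neg[OF f]
      by (intro bexI[of _ "\<lambda>x\<in>carrier ?F. \<ominus>\<^bsub>A\<^esub> f x"]) (auto simp: hom_group_def l_neg fun_eq_iff simp del: free_module_simps)
  qed (use clo zero cD in \<open>auto simp: hom_group_def a_assoc fun_eq_iff simp del: free_module_simps\<close>)
qed

lemma module_hom_minus:
  assumes "left_module A M" "left_module A N" "f \<in> module_hom A M N"
    and "x \<in> carrier M" "y \<in> carrier M"
  shows "f (x \<ominus>\<^bsub>M\<^esub> y) = f x \<ominus>\<^bsub>N\<^esub> f y"
proof -
  interpret M: left_module A M by fact
  interpret N: left_module A N by fact
  note f = module_homD[OF assms(3)]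
  have "f (\<ominus>\<^bsub>M\<^esub> y) \<oplus>\<^bsub>N\<^esub> f y = \<zero>\<^bsub>N\<^esub>"
    using f(3)[of "\<ominus>\<^bsub>M\<^esub> y" y] assms module_hom_zero[OF assms(1-3)] by (simp add: M.M.l_neg)
  then have "f (\<ominus>\<^bsub>M\<^esub> y) = \<ominus>\<^bsub>N\<^esub> f y"
    using f(1) assms by (intro N.M.minus_equality[symmetric]) auto
  then show ?thesis using f(3)[of x "\<ominus>\<^bsub>M\<^esub> y"] assms by (simp add: M.M.minus_eq N.M.minus_eq)
qed

lemma module_hom_factor:
  assumes L: "left_module A L" "left_module A M" "left_module A N"
    and p: "p \<in> module_hom A L M" and g: "g \<in> module_hom A L N"
    and ker: "\<And>v. v \<in> carrier L \<Longrightarrow> p v = \<zero>\<^bsub>M\<^esub> \<Longrightarrow> g v = \<zero>\<^bsub>N\<^esub>"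
  shows "\<exists>f. \<forall>v\<in>carrier L. f (p v) = g v"
proof -
  interpret L: left_module A L by fact
  interpret M: left_module A M by fact
  interpret N: left_module A N by fact
  have "g v = g w" if "v \<in> carrier L" "w \<in> carrier L" "p v = p w" for v w
  proof -
    have "p (v \<ominus>\<^bsub>L\<^esub> w) = \<zero>\<^bsub>M\<^esub>"
      using module_hom_minus[OF L(1,2) p that(1,2)] that module_homD(1)[OF p]
      by (simp add: M.M.minus_eq M.M.r_neg)
    then have "g v \<ominus>\<^bsub>N\<^esub> g w = \<zero>\<^bsub>N\<^esub>"
      using ker[of "v \<ominus>\<^bsub>L\<^esub> w"] module_hom_minus[OF L(1,3) g that(1,2)] that by simp
    then show ?thesis using module_homD(1)[OF g] that
      by (metis N.M.minus_eq N.M.minus_equality N.M.minus_minus N.M.a_inv_closed)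
  qed
  then show ?thesis
    by (intro exI[of _ "\<lambda>x. g (SOME v. v \<in> carrier L \<and> p v = x)"])
      (metis (mono_tags, lifting) someI_ex)
qed

text \<open>The map \<open>g\<close> vanishes on the kernel of \<open>q\<close>, so it is defined on the image of \<open>q\<close>; by exactness this
  is a kernel to which the extension property applies.\<close>

lemma extend_along_exact:
  assumes R: "ring A" and ext: "kernel_extension A"
    and q: "q \<in> module_hom A (free_module A k) (free_module A l)"
    and p: "p \<in> module_hom A (free_module A l) (free_module A m)"
    and exact: "q ` carrier (free_module A k) = {v \<in> carrier (free_module A l). p v = \<zero>\<^bsub>free_module A m\<^esub>}"
    and g: "g \<in> module_hom A (free_module A k) (regular_module A)"
    and ker: "\<And>v. v \<in> carrier (free_module A k) \<Longrightarrow> q v = \<zero>\<^bsub>free_module A l\<^esub> \<Longrightarrow> g v = \<zero>\<^bsub>A\<^esub>"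
  shows "\<exists>h\<in>module_hom A (free_module A l) (regular_module A).
    \<forall>v\<in>carrier (free_module A k). h (q v) = g v"
proof -
  interpret ring A by fact
  interpret F: left_module A "free_module A k" by (rule left_module_free_module)
  obtain f where f: "\<And>v. v \<in> carrier (free_module A k) \<Longrightarrow> f (q v) = g v"
    using module_hom_factor[OF left_module_free_module left_module_free_module
        left_module_regular_module q g] ker
    unfolding regular_module_simps by blast
  have K: "ker_on A l m p = q ` carrier (free_module A k)"
    unfolding ker_on_def exact ..
  have "\<exists>h\<in>module_hom A (free_module A l) (regular_module A). \<forall>v\<in>ker_on A l m p. h v = f v"
  proof (rule ext[unfolded kernel_extension_def, rule_format, OF p])
    fix v assume "v \<in> ker_on A l m p"
    then obtain v' where v: "v' \<in> carrier (free_module A k)" "v = q v'" unfolding K by blast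
    then show "f v \<in> carrier A" using f module_homD(1)[OF g] by simp
    fix a assume a: "a \<in> carrier A"
    then have "f (q (a \<odot>\<^bsub>free_module A k\<^esub> v')) = a \<otimes>\<^bsub>A\<^esub> f (q v')"
      using f[OF v(1)] f[OF F.smult_closed[OF a v(1)]] module_homD(4)[OF g a v(1)] by simp
    then show "f (a \<odot>\<^bsub>free_module A l\<^esub> v) = a \<otimes>\<^bsub>A\<^esub> f v"
      using module_homD(4)[OF q a v(1)] v(2) by simp
  next
    fix v w assume "v \<in> ker_on A l m p" "w \<in> ker_on A l m p"
    then obtain v' w' where v: "v' \<in> carrier (free_module A k)" "v = q v'"
      and w: "w' \<in> carrier (free_module A k)" "w = q w'" unfolding K by blast
    have "f (q (v' \<oplus>\<^bsub>free_module A k\<^esub> w')) = f (q v') \<oplus>\<^bsub>A\<^esub> f (q w')"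
      using f[OF v(1)] f[OF w(1)] f[OF F.M.a_closed[OF v(1) w(1)]] module_homD(3)[OF g v(1) w(1)] by simp
    then show "f (v \<oplus>\<^bsub>free_module A l\<^esub> w) = f v \<oplus>\<^bsub>A\<^esub> f w"
      using module_homD(3)[OF q v(1) w(1)] v(2) w(2) by simp
  qed
  then show ?thesis using f unfolding K by (metis imageI)
qed

text \<open>The embedding of \<open>M\<close> into a free module continues the resolution to the right.  Hence in every
  positive degree, also in degree one, the cocycle is defined on the kernel of a map between free
  modules.\<close>

lemma resolution_cohomology_trivial:
  assumes R: "ring A" and ext: "kernel_extension A"
    and res: "free_resolution A M n d e" and M: "left_module A M"
    and j: "j \<in> module_hom A M (free_module A m)" "inj_on j (carrier M)"
    and i: "i \<ge> 1"
  shows "trivial_group (resolution_cohomology A n d (regular_module A) i)"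
proof -
  interpret ring A by fact
  interpret M: left_module A M by fact
  let ?F = "\<lambda>i. free_module A (n i)"
  have d: "d t \<in> module_hom A (?F (Suc t)) (?F t)" for t
    using res unfolding free_resolution_def by blast
  have e: "e \<in> module_hom A (?F 0) M" using res unfolding free_resolution_def by blast
  have im0: "d 0 ` carrier (?F (Suc 0)) = {v \<in> carrier (?F 0). e v = \<zero>\<^bsub>M\<^esub>}"
    using res unfolding free_resolution_def by simp
  have im: "d (Suc t) ` carrier (?F (Suc (Suc t)))
      = {v \<in> carrier (?F (Suc t)). d t v = \<zero>\<^bsub>?F t\<^esub>}" for t
    using res unfolding free_resolution_def by blast
  obtain t where t: "i = Suc t" using i by (cases i) auto
  have exact: "\<exists>p l. p \<in> module_hom A (?F t) (free_module A l) \<and>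
     d t ` carrier (?F (Suc t)) = {v \<in> carrier (?F t). p v = \<zero>\<^bsub>free_module A l\<^esub>}"
  proof (cases t)
    case 0
    interpret F: left_module A "?F 0" by (rule left_module_free_module)
    have "compose (carrier (?F 0)) j e \<in> module_hom A (?F 0) (free_module A m)"
      using e j(1) F.M.a_closed F.smult_closed by (rule compose_module_hom)
    moreover have "e v = \<zero>\<^bsub>M\<^esub> \<longleftrightarrow> compose (carrier (?F 0)) j e v = \<zero>\<^bsub>free_module A m\<^esub>"
      if "v \<in> carrier (?F 0)" for v
    proof -
      have "e v = \<zero>\<^bsub>M\<^esub> \<longleftrightarrow> j (e v) = j \<zero>\<^bsub>M\<^esub>"
        using j(2) M.M.zero_closed module_homD(1)[OF e that] by (simp add: inj_on_eq_iff)
      then show ?thesis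
        using that module_hom_zero[OF M left_module_free_module j(1)] by (simp add: compose_def)
    qed
    moreover from this have "d 0 ` carrier (?F (Suc 0)) = {v \<in> carrier (?F 0).
        compose (carrier (?F 0)) j e v = \<zero>\<^bsub>free_module A m\<^esub>}"
      unfolding im0 by blast
    ultimately show ?thesis unfolding 0 by blast
  next
    case (Suc s)
    show ?thesis using d[of s] im[of s] Suc by blast
  qed
  have "coboundaries A n d (regular_module A) i = cocycles A n d (regular_module A) i"
  proof
    show "coboundaries A n d (regular_module A) i \<subseteq> cocycles A n d (regular_module A) i"
    proof
      fix f assume "f \<in> coboundaries A n d (regular_module A) i"
      then obtain h where h: "h \<in> module_hom A (?F t) (regular_module A)"
        and f: "f = compose (carrier (?F (Suc t))) h (d t)" by (auto simp: coboundaries_def t)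
      interpret F: left_module A "?F (Suc t)" by (rule left_module_free_module)
      have "f \<in> module_hom A (?F (Suc t)) (regular_module A)"
        unfolding f using d h F.M.a_closed F.smult_closed by (rule compose_module_hom)
      moreover have "f (d (Suc t) v) = \<zero>\<^bsub>A\<^esub>" if "v \<in> carrier (?F (Suc (Suc t)))" for v
      proof -
        have "d (Suc t) v \<in> carrier (?F (Suc t))" "d t (d (Suc t) v) = \<zero>\<^bsub>?F t\<^esub>"
          using im[of t] that by blast+
        then show ?thesis
          using module_hom_zero[OF left_module_free_module left_module_regular_module h]
          by (simp only: f compose_eq regular_module_simps)
      qed
      ultimately show "f \<in> cocycles A n d (regular_module A) i" by (simp add: cocycles_def t)
    qed
    show "cocycles A n d (regular_module A) i \<subseteq> coboundaries A n d (regular_module A) i"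
    proof
      fix g assume "g \<in> cocycles A n d (regular_module A) i"
      then have g: "g \<in> module_hom A (?F (Suc t)) (regular_module A)"
        and g0: "\<And>v. v \<in> carrier (?F (Suc (Suc t))) \<Longrightarrow> g (d (Suc t) v) = \<zero>\<^bsub>A\<^esub>"
        by (auto simp: cocycles_def t simp del: free_module_simps)
      obtain p l where p: "p \<in> module_hom A (?F t) (free_module A l)"
        "d t ` carrier (?F (Suc t)) = {v \<in> carrier (?F t). p v = \<zero>\<^bsub>free_module A l\<^esub>}"
        using exact by blast
      have "g v = \<zero>\<^bsub>A\<^esub>" if "v \<in> carrier (?F (Suc t))" "d t v = \<zero>\<^bsub>?F t\<^esub>" for v
      proof -
        have "v \<in> d (Suc t) ` carrier (?F (Suc (Suc t)))" using that unfolding im by blast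
        then show ?thesis using g0 by blast
      qed
      then obtain h where h: "h \<in> module_hom A (?F t) (regular_module A)"
        "\<And>v. v \<in> carrier (?F (Suc t)) \<Longrightarrow> h (d t v) = g v"
        using extend_along_exact[OF R ext d p g] by blast
      have "g = compose (carrier (?F (Suc t))) h (d t)"
      proof
        fix v show "g v = compose (carrier (?F (Suc t))) h (d t) v"
          using h(2)[of v] module_homD(2)[OF g, of v] by (simp add: compose_def restrict_def del: free_module_simps)
      qed
      then show "g \<in> coboundaries A n d (regular_module A) i"
        using h(1) by (auto simp: coboundaries_def t simp del: free_module_simps)
    qed
  qed
  then show ?thesis
    using trivial_group_Mod_carrier[OF group_cocycles[where d = d and n = n and i = i, OF R d]]
    by (simp add: resolution_cohomology_def del: free_module_simps)
qed

text \<open>The Ext groups are computed from a resolution about which nothing is known except that it is one,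
  and even this holds only because some resolution exists.\<close>

theorem Ext_trivial:
  assumes M: "left_module A M" and fg: "fg_submodules A" and ext: "kernel_extension A"
    and e: "e \<in> module_hom A (free_module A k) M" "e ` carrier (free_module A k) = carrier M"
    and j: "j \<in> module_hom A M (free_module A m)" "inj_on j (carrier M)"
    and i: "i \<ge> 1"
  shows "trivial_group (Ext A M (regular_module A) i)"
proof -
  interpret M: left_module A M by fact
  have "submod A (free_module A k) {v \<in> carrier (free_module A k). e v = \<zero>\<^bsub>M\<^esub>}"
    by (rule submod_kernel[OF M.R.left_module_free_module M e(1)])
  then have "\<exists>n d e. free_resolution A M n d e"
    using free_resolution_exists[OF M.R.ring_axioms fg e] by blast
  then have "\<exists>x. case x of (n, d, e) \<Rightarrow> free_resolution A M n d e" by auto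
  then have "case (SOME (n, d, e). free_resolution A M n d e) of (n, d, e) \<Rightarrow> free_resolution A M n d e"
    by (rule someI_ex)
  then show ?thesis
    using resolution_cohomology_trivial[OF M.R.ring_axioms ext _ M j i]
    by (auto simp: Ext_def split: prod.splits)
qed

text \<open>The module axioms are identities, so an injective map that respects the operations reflects them.\<close>

lemma left_module_of_embedding:
  assumes M: "abelian_group M" and N: "left_module A N"
    and smult: "\<And>a x. a \<in> carrier A \<Longrightarrow> x \<in> carrier M \<Longrightarrow> a \<odot>\<^bsub>M\<^esub> x \<in> carrier M"
    and j: "j \<in> module_hom A M N" and inj: "inj_on j (carrier M)"
  shows "left_module A M"
proof -
  interpret M: abelian_group M by fact
  interpret N: left_module A N by fact
  note J = module_homD[OF j]
  have eq: "x = y" if "x \<in> carrier M" "y \<in> carrier M" "j x = j y" for x y using inj_onD[OF inj] that by blast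
  show ?thesis
  proof (intro left_module.intro left_module_axioms.intro N.R.ring_axioms M.abelian_group_axioms)
    show "(a \<oplus>\<^bsub>A\<^esub> b) \<odot>\<^bsub>M\<^esub> x = a \<odot>\<^bsub>M\<^esub> x \<oplus>\<^bsub>M\<^esub> b \<odot>\<^bsub>M\<^esub> x"
      if "a \<in> carrier A" "b \<in> carrier A" "x \<in> carrier M" for a b x
      using that by (intro eq) (simp_all add: smult J N.smult_l_distr)
    show "a \<odot>\<^bsub>M\<^esub> (x \<oplus>\<^bsub>M\<^esub> y) = a \<odot>\<^bsub>M\<^esub> x \<oplus>\<^bsub>M\<^esub> a \<odot>\<^bsub>M\<^esub> y"
      if "a \<in> carrier A" "x \<in> carrier M" "y \<in> carrier M" for a x y
      using that by (intro eq) (simp_all add: smult J N.smult_r_distr)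
    show "(a \<otimes>\<^bsub>A\<^esub> b) \<odot>\<^bsub>M\<^esub> x = a \<odot>\<^bsub>M\<^esub> (b \<odot>\<^bsub>M\<^esub> x)"
      if "a \<in> carrier A" "b \<in> carrier A" "x \<in> carrier M" for a b x
      using that by (intro eq) (simp_all add: smult J N.smult_assoc1)
    show "\<one>\<^bsub>A\<^esub> \<odot>\<^bsub>M\<^esub> x = x" if "x \<in> carrier M" for x
      using that by (intro eq) (simp_all add: smult J)
  qed (rule smult)
qed

lemma generated_of_embedding:
  assumes M: "left_module A M" and fg: "fg_submodules A"
    and j: "j \<in> module_hom A M (free_module A m)" and inj: "inj_on j (carrier M)"
  shows "\<exists>n. \<exists>e\<in>module_hom A (free_module A n) M. e ` carrier (free_module A n) = carrier M"
proof -
  interpret M: left_module A M by fact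
  have "submod A (free_module A m) (j ` carrier M)"
    by (rule submod_image[OF M M.R.left_module_free_module j])
  from fg[unfolded fg_submodules_def, rule_format, OF this]
  obtain n d where d: "d \<in> module_hom A (free_module A n) (free_module A m)"
    and im: "d ` carrier (free_module A n) = j ` carrier M" by (elim exE bexE)
  let ?F = "free_module A n"
  interpret F: left_module A ?F by (rule M.R.left_module_free_module)
  define e where "e = (\<lambda>v\<in>carrier ?F. inv_into (carrier M) j (d v))"
  have e: "e v \<in> carrier M" "j (e v) = d v" if "v \<in> carrier ?F" for v
  proof -
    have "d v \<in> j ` carrier M" using that im by blast
    then show "e v \<in> carrier M" "j (e v) = d v"
      using that inv_into_into[of "d v" j "carrier M"] f_inv_into_f[of "d v" j "carrier M"]
      by (simp_all only: e_def restrict_apply if_True)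
  qed
  have eqI: "x = y" if "x \<in> carrier M" "y \<in> carrier M" "j x = j y" for x y
    using inj_onD[OF inj] that by blast
  have "e \<in> module_hom A ?F M"
  proof (rule module_homI)
    fix v w assume v: "v \<in> carrier ?F" and w: "w \<in> carrier ?F"
    show "e (v \<oplus>\<^bsub>?F\<^esub> w) = e v \<oplus>\<^bsub>M\<^esub> e w"
      using e(1)[OF F.M.a_closed[OF v w]] M.M.a_closed[OF e(1)[OF v] e(1)[OF w]]
      by (rule eqI) (simp only: e(2)[OF F.M.a_closed[OF v w]] module_homD(3)[OF j e(1)[OF v] e(1)[OF w]]
          e(2)[OF v] e(2)[OF w] module_homD(3)[OF d v w])
  next
    fix a v assume a: "a \<in> carrier A" and v: "v \<in> carrier ?F"
    show "e (a \<odot>\<^bsub>?F\<^esub> v) = a \<odot>\<^bsub>M\<^esub> e v"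
      using e(1)[OF F.smult_closed[OF a v]] M.smult_closed[OF a e(1)[OF v]]
      by (rule eqI) (simp only: e(2)[OF F.smult_closed[OF a v]] module_homD(4)[OF j a e(1)[OF v]]
          e(2)[OF v] module_homD(4)[OF d a v])
  qed (use e(1) in \<open>simp_all only: e_def restrict_apply if_False\<close>)
  moreover have "e ` carrier ?F = carrier M"
  proof
    show "carrier M \<subseteq> e ` carrier ?F"
    proof
      fix x assume x: "x \<in> carrier M"
      then have "j x \<in> d ` carrier ?F" unfolding im by blast
      then obtain v where v: "v \<in> carrier ?F" "d v = j x" by (metis imageE)
      have "e v = x" using e[OF v(1)] v(2) x by (intro eqI) simp_all
      then show "x \<in> e ` carrier ?F" using v(1) by blast
    qed
  qed (use e(1) in blast)
  ultimately show ?thesis by blast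
qed

section \<open>Duals of torsionless modules and reflexivity\<close>

text \<open>The surjection \<open>e\<close> makes \<open>M\<close> finitely generated and the injection \<open>j\<close> makes it torsionless.\<close>

locale torsionless_module = left_module +
  fixes n m :: nat and e j
  assumes fg: "fg_submodules R" and fg_op: "fg_submodules (op_ring R)"
    and ext: "kernel_extension R" and ext_op: "kernel_extension (op_ring R)"
    and e: "e \<in> module_hom R (free_module R n) M" and e_surj: "e ` carrier (free_module R n) = carrier M"
    and j: "j \<in> module_hom R M (free_module R m)" and j_inj: "inj_on j (carrier M)"
begin

text \<open>A functional is determined by its values on the generators; recording them embeds the dual into a
  free right module.\<close>

abbreviation "ev f \<equiv> (\<lambda>i\<in>{..<n}. f (e (unit_vec R n i)))"

lemma e_unit_closed [simp]: "e (unit_vec R n i) \<in> carrier M"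
  using module_homD(1)[OF e] unit_vec_closed by blast

lemma ev_closed: "f \<in> carrier (dual_module R M) \<Longrightarrow> ev f \<in> carrier (free_module R n)"
  using module_homD(1)[of f R M "regular_module R"] by auto

lemma dual_eq_dot:
  assumes f: "f \<in> carrier (dual_module R M)" and v: "v \<in> carrier (free_module R n)"
  shows "f (e v) = dot R n v (ev f)"
proof -
  interpret F: left_module R "free_module R n" by (rule left_module_free_module)
  have f': "f \<in> module_hom R M (regular_module R)" using f by simp
  have c: "compose (carrier (free_module R n)) f e \<in> module_hom R (free_module R n) (regular_module R)"
    using e f' F.M.a_closed F.smult_closed by (rule compose_module_hom)
  have "(\<lambda>i\<in>{..<n}. compose (carrier (free_module R n)) f e (unit_vec R n i)) = ev f"
    using unit_vec_closed by (intro restrict_ext) (simp add: compose_def del: free_module_simps)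
  then show ?thesis
    using free_module_hom_eq_dot[OF c v] v by (simp add: compose_def del: free_module_simps)
qed

lemma dual_add_closed:
  assumes "f \<in> carrier (dual_module R M)" "g \<in> carrier (dual_module R M)"
  shows "f \<oplus>\<^bsub>dual_module R M\<^esub> g \<in> carrier (dual_module R M)"
  using module_homD[of f R M "regular_module R"] module_homD[of g R M "regular_module R"] assms
  by (auto intro!: module_homI simp: R.r_distr R.a_ac)

lemma dual_smult_closed:
  assumes "f \<in> carrier (dual_module R M)" "a \<in> carrier R"
  shows "a \<odot>\<^bsub>dual_module R M\<^esub> f \<in> carrier (dual_module R M)"
  using module_homD[of f R M "regular_module R"] assms
  by (auto intro!: module_homI simp: R.l_distr R.m_assoc)

lemma dual_zero_closed: "\<zero>\<^bsub>dual_module R M\<^esub> \<in> carrier (dual_module R M)"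
  by (auto intro!: module_homI)

lemma dual_value_closed: "f \<in> carrier (dual_module R M) \<Longrightarrow> x \<in> carrier M \<Longrightarrow> f x \<in> carrier R"
  using module_homD(1)[of f R M "regular_module R"] by simp

lemma ev_inj: "inj_on ev (carrier (dual_module R M))"
proof (rule inj_onI)
  fix f g assume f: "f \<in> carrier (dual_module R M)" and g: "g \<in> carrier (dual_module R M)"
    and eq: "ev f = ev g"
  show "f = g"
  proof (rule module_hom_ext)
    fix x assume "x \<in> carrier M"
    then obtain v where v: "v \<in> carrier (free_module R n)" "x = e v" using e_surj by blast
    show "f x = g x" using dual_eq_dot[OF f v(1)] dual_eq_dot[OF g v(1)] eq v(2) by (simp only:)
  qed (use f g in simp_all)
qed

lemma ev_add: "ev (f \<oplus>\<^bsub>dual_module R M\<^esub> g) = ev f \<oplus>\<^bsub>free_module (op_ring R) n\<^esub> ev g"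
  by (auto simp: fun_eq_iff)

lemma ev_smult: "ev (a \<odot>\<^bsub>dual_module R M\<^esub> f) = a \<odot>\<^bsub>free_module (op_ring R) n\<^esub> ev f"
  by (auto simp: fun_eq_iff)

lemma op_free_carrier: "carrier (free_module (op_ring R) n) = carrier (free_module R n)"
  by simp

lemma ev_module_hom:
  "restrict ev (carrier (dual_module R M))
    \<in> module_hom (op_ring R) (dual_module R M) (free_module (op_ring R) n)"
proof (rule module_homI)
  show "restrict ev (carrier (dual_module R M)) f \<in> carrier (free_module (op_ring R) n)"
    if "f \<in> carrier (dual_module R M)" for f
    unfolding op_free_carrier using ev_closed[OF that] that by (simp only: restrict_apply if_True)
  show "restrict ev (carrier (dual_module R M)) (f \<oplus>\<^bsub>dual_module R M\<^esub> g)
      = restrict ev (carrier (dual_module R M)) f \<oplus>\<^bsub>free_module (op_ring R) n\<^esub> restrict ev (carrier (dual_module R M)) g"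
    if "f \<in> carrier (dual_module R M)" "g \<in> carrier (dual_module R M)" for f g
    using dual_add_closed[OF that] that by (simp only: restrict_apply if_True ev_add)
  show "restrict ev (carrier (dual_module R M)) (a \<odot>\<^bsub>dual_module R M\<^esub> f)
      = a \<odot>\<^bsub>free_module (op_ring R) n\<^esub> restrict ev (carrier (dual_module R M)) f"
    if "a \<in> carrier (op_ring R)" "f \<in> carrier (dual_module R M)" for a f
    using dual_smult_closed[of f a] that by (simp only: restrict_apply if_True ev_smult op_ring_simps)
qed (simp only: restrict_apply if_False)

text \<open>The vectors in the image are those orthogonal to the relations between the generators.  The
  relations are finitely generated, and pairing with generators of them is the map \<open>q\<close>.\<close>

lemma ev_image_kernel:
  obtains l q where "q \<in> module_hom (op_ring R) (free_module (op_ring R) n) (free_module (op_ring R) l)"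
    "ev ` carrier (dual_module R M) = ker_on (op_ring R) n l q"
proof -
  interpret F: left_module R "free_module R n" by (rule R.left_module_free_module)
  have reg: "left_module R (regular_module R)" by (rule R.left_module_regular_module)
  have M: "left_module R M" by (rule left_module_axioms)
  obtain l d where d: "d \<in> module_hom R (free_module R l) (free_module R n)"
    and im: "d ` carrier (free_module R l) = {v \<in> carrier (free_module R n). e v = \<zero>\<^bsub>M\<^esub>}"
    using fg submod_kernel[OF F.left_module_axioms M e] unfolding fg_submodules_def by blast
  interpret L: left_module R "free_module R l" by (rule R.left_module_free_module)
  define q where "q = (\<lambda>w\<in>carrier (free_module R n). \<lambda>i\<in>{..<l}. dot R n (d (unit_vec R l i)) w)"
  have du: "d (unit_vec R l i) \<in> carrier (free_module R n)" for i
    using d R.unit_vec_closed by (rule module_homD(1))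
  then have du': "d (unit_vec R l i) \<in> {..<n} \<rightarrow>\<^sub>E carrier R" for i by simp
  have q: "q \<in> module_hom (op_ring R) (free_module (op_ring R) n) (free_module (op_ring R) l)"
  proof (rule module_homI)
    fix x assume "x \<in> carrier (free_module (op_ring R) n)"
    then show "q x \<in> carrier (free_module (op_ring R) l)" using du' by (auto simp: q_def)
  next
    fix x y assume "x \<in> carrier (free_module (op_ring R) n)" "y \<in> carrier (free_module (op_ring R) n)"
    then show "q (x \<oplus>\<^bsub>free_module (op_ring R) n\<^esub> y) = q x \<oplus>\<^bsub>free_module (op_ring R) l\<^esub> q y"
      using R.dot_add_right[OF du'] F.M.a_closed[of x y] by (auto simp: q_def)
  next
    fix a x assume "a \<in> carrier (op_ring R)" "x \<in> carrier (free_module (op_ring R) n)"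
    then show "q (a \<odot>\<^bsub>free_module (op_ring R) n\<^esub> x) = a \<odot>\<^bsub>free_module (op_ring R) l\<^esub> q x"
      using R.dot_smult_right[OF _ du'] by (auto simp: q_def)
  qed (simp add: q_def)
  have "ev ` carrier (dual_module R M) = ker_on (op_ring R) n l q"
  proof
    show "ev ` carrier (dual_module R M) \<subseteq> ker_on (op_ring R) n l q"
    proof
      fix w assume "w \<in> ev ` carrier (dual_module R M)"
      then obtain f where f: "f \<in> carrier (dual_module R M)" and w: "w = ev f" by blast
      have "dot R n (d (unit_vec R l i)) (ev f) = \<zero>" for i
      proof -
        have "e (d (unit_vec R l i)) = \<zero>\<^bsub>M\<^esub>" using im R.unit_vec_closed by blast
        moreover have "f \<zero>\<^bsub>M\<^esub> = \<zero>" using module_hom_zero[OF M reg, of f] f by simp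
        ultimately show ?thesis using dual_eq_dot[OF f du, of i] by (simp only:)
      qed
      then have "(\<lambda>i\<in>{..<l}. dot R n (d (unit_vec R l i)) w) = \<zero>\<^bsub>free_module (op_ring R) l\<^esub>"
        unfolding w by (simp only: free_module_simps op_ring_simps)
      moreover have "w \<in> carrier (free_module R n)" unfolding w by (rule ev_closed[OF f])
      ultimately show "w \<in> ker_on (op_ring R) n l q"
        by (simp only: ker_on_def q_def mem_Collect_eq op_free_carrier restrict_apply if_True simp_thms)
    qed
    show "ker_on (op_ring R) n l q \<subseteq> ev ` carrier (dual_module R M)"
    proof
      fix w assume "w \<in> ker_on (op_ring R) n l q"
      then have w: "w \<in> carrier (free_module R n)" and qw: "q w = (\<lambda>i\<in>{..<l}. \<zero>)"
        by (simp_all add: ker_on_def)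
      have w': "w \<in> {..<n} \<rightarrow>\<^sub>E carrier R" using w by simp
      let ?g = "\<lambda>v\<in>carrier (free_module R n). dot R n v w"
      have g: "?g \<in> module_hom R (free_module R n) (regular_module R)"
        using w' by (rule R.dot_module_hom)
      have gd: "compose (carrier (free_module R l)) ?g d \<in> module_hom R (free_module R l) (regular_module R)"
        using d g L.M.a_closed L.smult_closed by (rule compose_module_hom)
      have z: "?g (d (unit_vec R l i)) = \<zero>" if "i < l" for i
        using fun_cong[OF qw, of i] that w du[of i] by (simp add: q_def)
      have gdu: "?g (d u) = \<zero>" if u: "u \<in> carrier (free_module R l)" for u
      proof -
        have "compose (carrier (free_module R l)) ?g d u
            = dot R l u (\<lambda>i\<in>{..<l}. compose (carrier (free_module R l)) ?g d (unit_vec R l i))"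
          by (rule R.free_module_hom_eq_dot[OF gd u])
        also have "(\<lambda>i\<in>{..<l}. compose (carrier (free_module R l)) ?g d (unit_vec R l i)) = (\<lambda>i\<in>{..<l}. \<zero>)"
          using z by (intro restrict_ext) (simp only: compose_eq R.unit_vec_closed lessThan_iff)
        also have "dot R l u (\<lambda>i\<in>{..<l}. \<zero>) = (\<Oplus>i\<in>{..<l}. \<zero>)"
          unfolding dot_def using u by (intro R.finsum_cong') (auto simp: PiE_iff)
        also have "\<dots> = \<zero>" by (rule R.finsum_zero)
        finally show ?thesis using u by (simp only: compose_eq)
      qed
      have gker: "?g v = \<zero>\<^bsub>regular_module R\<^esub>"
        if "v \<in> carrier (free_module R n)" "e v = \<zero>\<^bsub>M\<^esub>" for v
      proof -
        have "v \<in> d ` carrier (free_module R l)" unfolding im using that by simp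
        then obtain u where "u \<in> carrier (free_module R l)" "v = d u" by (rule imageE)
        then show ?thesis using gdu[of u] by (simp only: regular_module_simps)
      qed
      obtain f0 where f0: "\<And>v. v \<in> carrier (free_module R n) \<Longrightarrow> f0 (e v) = ?g v"
        using module_hom_factor[OF F.left_module_axioms M reg e g gker] by blast
      define f where "f = restrict f0 (carrier M)"
      have f: "f \<in> carrier (dual_module R M)"
        unfolding dual_module_simps
      proof (rule module_homI)
        fix x assume "x \<in> carrier M"
        then obtain v where v: "v \<in> carrier (free_module R n)" "x = e v" using e_surj by blast
        then show "f x \<in> carrier (regular_module R)"
          using f0[OF v(1)] module_homD(1)[OF g v(1)] module_homD(1)[OF e v(1)] by (simp only: f_def restrict_apply if_True)
        fix a assume a: "a \<in> carrier R"
        have "e (a \<odot>\<^bsub>free_module R n\<^esub> v) = a \<odot>\<^bsub>M\<^esub> e v" by (rule module_homD(4)[OF e a v(1)])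
        then show "f (a \<odot>\<^bsub>M\<^esub> x) = a \<odot>\<^bsub>regular_module R\<^esub> f x"
          using f0[OF v(1)] f0[OF F.smult_closed[OF a v(1)]] module_homD(4)[OF g a v(1)]
            smult_closed[OF a, of x] \<open>x \<in> carrier M\<close> v(2) by (simp only: f_def restrict_apply if_True)
      next
        fix x y assume x: "x \<in> carrier M" and y: "y \<in> carrier M"
        obtain v where v: "v \<in> carrier (free_module R n)" "x = e v" using x e_surj by blast
        obtain u where u: "u \<in> carrier (free_module R n)" "y = e u" using y e_surj by blast
        have "e (v \<oplus>\<^bsub>free_module R n\<^esub> u) = e v \<oplus>\<^bsub>M\<^esub> e u" by (rule module_homD(3)[OF e v(1) u(1)])
        then show "f (x \<oplus>\<^bsub>M\<^esub> y) = f x \<oplus>\<^bsub>regular_module R\<^esub> f y"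
          using f0[OF v(1)] f0[OF u(1)] f0[OF F.M.a_closed[OF v(1) u(1)]] module_homD(3)[OF g v(1) u(1)]
            M.a_closed[OF x y] x y v(2) u(2) by (simp only: f_def restrict_apply if_True)
      qed (simp add: f_def)
      have "ev f = w"
      proof
        fix i show "ev f i = w i"
        proof (cases "i < n")
          case True
          have "f (e (unit_vec R n i)) = dot R n (unit_vec R n i) w"
            using f0[OF R.unit_vec_closed[of n i]] R.unit_vec_closed[of n i]
            by (simp only: f_def restrict_apply e_unit_closed if_True)
          then show ?thesis using R.dot_unit_vec[OF w' True] True by simp
        qed (use w' in \<open>auto simp: PiE_iff extensional_def\<close>)
      qed
      then show "w \<in> ev ` carrier (dual_module R M)" using f by blast
    qed
  qed
  then show ?thesis using q that by blast
qed

lemma abelian_group_dual: "abelian_group (dual_module R M)"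
proof (rule abelian_groupI)
  fix f assume f: "f \<in> carrier (dual_module R M)"
  have "(\<lambda>x\<in>carrier M. \<ominus> f x) \<in> carrier (dual_module R M)"
    using module_homD[of f R M "regular_module R"] f
    by (auto intro!: module_homI simp: R.minus_add R.r_minus)
  then show "\<exists>g\<in>carrier (dual_module R M). g \<oplus>\<^bsub>dual_module R M\<^esub> f = \<zero>\<^bsub>dual_module R M\<^esub>"
    by (rule bexI[rotated]) (use dual_value_closed[OF f] in \<open>auto simp: R.l_neg fun_eq_iff\<close>)
  show "\<zero>\<^bsub>dual_module R M\<^esub> \<oplus>\<^bsub>dual_module R M\<^esub> f = f"
    using dual_value_closed[OF f] module_homD(2)[of f R M "regular_module R"] f
    by (auto simp: fun_eq_iff restrict_def)
next
  fix f g assume "f \<in> carrier (dual_module R M)" "g \<in> carrier (dual_module R M)"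
  then show "f \<oplus>\<^bsub>dual_module R M\<^esub> g = g \<oplus>\<^bsub>dual_module R M\<^esub> f"
    using dual_value_closed by (auto simp: fun_eq_iff R.a_comm)
next
  fix f g h assume "f \<in> carrier (dual_module R M)" "g \<in> carrier (dual_module R M)" "h \<in> carrier (dual_module R M)"
  then show "f \<oplus>\<^bsub>dual_module R M\<^esub> g \<oplus>\<^bsub>dual_module R M\<^esub> h = f \<oplus>\<^bsub>dual_module R M\<^esub> (g \<oplus>\<^bsub>dual_module R M\<^esub> h)"
    using dual_value_closed by (auto simp: fun_eq_iff R.a_assoc)
qed (rule dual_add_closed dual_zero_closed; assumption?)+

lemma left_module_dual: "left_module (op_ring R) (dual_module R M)"
proof -
  interpret Rop: ring "op_ring R" by (rule ring_op_ring[OF R.ring_axioms])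
  show ?thesis
  proof (rule left_module_of_embedding[OF abelian_group_dual Rop.left_module_free_module _ ev_module_hom])
    show "inj_on (restrict ev (carrier (dual_module R M))) (carrier (dual_module R M))"
      using ev_inj by (simp only: inj_on_restrict_eq)
  qed (use dual_smult_closed in \<open>simp only: op_ring_simps\<close>)
qed

text \<open>Evaluation is injective because the coordinates of \<open>j\<close> separate points.  It is surjective because
  an element of the bidual is a functional on the kernel found in \<open>ev_image_kernel\<close>; it extends to
  the free right module, is there given by a dot product with some vector \<open>u\<close>, and so is the
  evaluation at \<open>e u\<close>.\<close>

lemma bidual_eval_bij:
  "bij_betw (bidual_eval R M) (carrier M) (carrier (dual_module (op_ring R) (dual_module R M)))"
  unfolding bij_betw_def
proof
  let ?D = "carrier (dual_module R M)"
  show "inj_on (bidual_eval R M) (carrier M)"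
  proof (rule inj_onI)
    fix x y assume x: "x \<in> carrier M" and y: "y \<in> carrier M" and eq: "bidual_eval R M x = bidual_eval R M y"
    have "j x i = j y i" for i
    proof (cases "i < m")
      case True
      define f where "f = (\<lambda>x\<in>carrier M. j x i)"
      have "f \<in> ?D"
        using True module_homD[OF j] by (auto simp: f_def PiE_iff intro!: module_homI)
      then have "f x = f y" using fun_cong[OF eq, of f] by (simp add: bidual_eval_def)
      then show ?thesis using x y by (simp add: f_def)
    next
      case False
      then show ?thesis using module_homD(1)[OF j x] module_homD(1)[OF j y] by (auto simp: PiE_iff extensional_def)
    qed
    then show "x = y" using inj_onD[OF j_inj _ x y] by blast
  qed
  show "bidual_eval R M ` carrier M = carrier (dual_module (op_ring R) (dual_module R M))"
  proof
    show "bidual_eval R M ` carrier M \<subseteq> carrier (dual_module (op_ring R) (dual_module R M))"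
    proof
      fix p assume "p \<in> bidual_eval R M ` carrier M"
      then obtain x where x: "x \<in> carrier M" and p: "p = bidual_eval R M x" by blast
      have "p \<in> module_hom (op_ring R) (dual_module R M) (regular_module (op_ring R))"
      proof (rule module_homI)
        show "p f \<in> carrier (regular_module (op_ring R))" if "f \<in> ?D" for f
          using that dual_value_closed[OF that x] by (simp add: p bidual_eval_def)
        show "p (f \<oplus>\<^bsub>dual_module R M\<^esub> g) = p f \<oplus>\<^bsub>regular_module (op_ring R)\<^esub> p g" if "f \<in> ?D" "g \<in> ?D" for f g
          using that dual_add_closed[OF that] x by (simp add: p bidual_eval_def)
        show "p (a \<odot>\<^bsub>dual_module R M\<^esub> f) = a \<odot>\<^bsub>regular_module (op_ring R)\<^esub> p f"
          if "a \<in> carrier (op_ring R)" "f \<in> ?D" for a f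
          using that dual_smult_closed[of f a] x by (simp add: p bidual_eval_def)
      qed (simp add: p bidual_eval_def)
      then show "p \<in> carrier (dual_module (op_ring R) (dual_module R M))" by simp
    qed
    show "carrier (dual_module (op_ring R) (dual_module R M)) \<subseteq> bidual_eval R M ` carrier M"
    proof
      fix p assume "p \<in> carrier (dual_module (op_ring R) (dual_module R M))"
      then have p: "p \<in> module_hom (op_ring R) (dual_module R M) (regular_module (op_ring R))" by simp
      interpret Rop: ring "op_ring R" by (rule ring_op_ring[OF R.ring_axioms])
      obtain l q where q: "q \<in> module_hom (op_ring R) (free_module (op_ring R) n) (free_module (op_ring R) l)"
        and W: "ev ` ?D = ker_on (op_ring R) n l q"
        by (rule ev_image_kernel)
      define s where "s = (\<lambda>w. p (inv_into ?D ev w))"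
      have s: "s (ev f) = p f" if "f \<in> ?D" for f
        using inv_into_f_f[OF ev_inj that] by (simp only: s_def)
      have "\<exists>h\<in>module_hom (op_ring R) (free_module (op_ring R) n) (regular_module (op_ring R)).
          \<forall>v\<in>ker_on (op_ring R) n l q. h v = s v"
      proof (rule ext_op[unfolded kernel_extension_def, rule_format, OF q])
        fix v assume "v \<in> ker_on (op_ring R) n l q"
        then obtain f where f: "f \<in> ?D" "v = ev f" unfolding W[symmetric] by blast
        show "s v \<in> carrier (op_ring R)"
          unfolding f(2) s[OF f(1)] using module_homD(1)[OF p f(1)] by simp
        fix a assume a: "a \<in> carrier (op_ring R)"
        then have "a \<in> carrier R" by simp
        from dual_smult_closed[OF f(1) this] show "s (a \<odot>\<^bsub>free_module (op_ring R) n\<^esub> v) = a \<otimes>\<^bsub>op_ring R\<^esub> s v"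
          unfolding f(2) ev_smult[symmetric] s[OF f(1)] using module_homD(4)[OF p a f(1)] s
          by (simp only: regular_module_simps)
      next
        fix v w assume "v \<in> ker_on (op_ring R) n l q" "w \<in> ker_on (op_ring R) n l q"
        then obtain f g where f: "f \<in> ?D" "v = ev f" and g: "g \<in> ?D" "w = ev g" unfolding W[symmetric] by blast
        show "s (v \<oplus>\<^bsub>free_module (op_ring R) n\<^esub> w) = s v \<oplus>\<^bsub>op_ring R\<^esub> s w"
          unfolding f(2) g(2) ev_add[symmetric] s[OF f(1)] s[OF g(1)] s[OF dual_add_closed[OF f(1) g(1)]]
          using module_homD(3)[OF p f(1) g(1)] by (simp only: regular_module_simps)
      qed
      then obtain h where h: "h \<in> module_hom (op_ring R) (free_module (op_ring R) n) (regular_module (op_ring R))"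
        and hW: "\<And>v. v \<in> ker_on (op_ring R) n l q \<Longrightarrow> h v = s v" by blast
      have hs: "h (ev f) = p f" if "f \<in> ?D" for f
      proof -
        have "ev f \<in> ker_on (op_ring R) n l q" unfolding W[symmetric] using that by (rule imageI)
        then show ?thesis using hW s[OF that] by (simp only:)
      qed
      define u where "u = (\<lambda>i\<in>{..<n}. h (unit_vec (op_ring R) n i))"
      have u: "u \<in> carrier (free_module R n)"
        using module_homD(1)[OF h Rop.unit_vec_closed] by (auto simp: u_def)
      have "p f = f (e u)" if f: "f \<in> ?D" for f
      proof -
        have "p f = dot (op_ring R) n (ev f) u"
          unfolding hs[OF f, symmetric] u_def
          using Rop.free_module_hom_eq_dot[OF h] ev_closed[OF f] op_free_carrier by blast
        also have "\<dots> = dot R n u (ev f)" by (simp add: dot_def)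
        also have "\<dots> = f (e u)" by (rule dual_eq_dot[OF f u, symmetric])
        finally show ?thesis .
      qed
      then have "p = bidual_eval R M (e u)"
        using module_homD(2)[OF p] by (auto simp: bidual_eval_def fun_eq_iff)
      then show "p \<in> bidual_eval R M ` carrier M" using module_homD(1)[OF e u] by blast
    qed
  qed
qed

lemma Ext_module_trivial: "i \<ge> 1 \<Longrightarrow> trivial_group (Ext R M (regular_module R) i)"
  by (rule Ext_trivial[OF left_module_axioms fg ext e e_surj j j_inj])

lemma Ext_dual_trivial:
  assumes "i \<ge> 1"
  shows "trivial_group (Ext (op_ring R) (dual_module R M) (regular_module (op_ring R)) i)"
proof -
  have inj: "inj_on (restrict ev (carrier (dual_module R M))) (carrier (dual_module R M))"
    using ev_inj by (simp only: inj_on_restrict_eq)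
  obtain k e' where "e' \<in> module_hom (op_ring R) (free_module (op_ring R) k) (dual_module R M)"
    "e' ` carrier (free_module (op_ring R) k) = carrier (dual_module R M)"
    using generated_of_embedding[OF left_module_dual fg_op ev_module_hom inj] by blast
  then show ?thesis
    by (rule Ext_trivial[OF left_module_dual fg_op ext_op _ _ ev_module_hom inj assms])
qed

end

section \<open>Finite EI categories\<close>

locale ei_category = category C for C :: "('o, 'm) precategory" +
  assumes finite_Mor: "finite (Mor C)"
    and endo_iso: "\<lbrakk>x \<in> Obj C; f \<in> Hom C x x\<rbrakk> \<Longrightarrow> iso_mor C f"
    and iso_endo: "\<lbrakk>f \<in> Hom C x y; iso_mor C f\<rbrakk> \<Longrightarrow> x = y"
begin

abbreviation cmp (infixr "\<cdot>" 70) where "g \<cdot> f \<equiv> Cmp C g f"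
abbreviation hom where "hom x y \<equiv> Hom C x y"
abbreviation inve where "inve f \<equiv> inv_mor C f"

lemma HomI: "f \<in> Mor C \<Longrightarrow> Dom C f = x \<Longrightarrow> Cod C f = y \<Longrightarrow> f \<in> hom x y"
  by (simp add: Hom_def)

lemma HomD: "f \<in> hom x y \<Longrightarrow> f \<in> Mor C" "f \<in> hom x y \<Longrightarrow> Dom C f = x" "f \<in> hom x y \<Longrightarrow> Cod C f = y"
  "f \<in> hom x y \<Longrightarrow> x \<in> Obj C" "f \<in> hom x y \<Longrightarrow> y \<in> Obj C"
  using dom_in cod_in by (auto simp: Hom_def)

lemma Mor_hom: "f \<in> Mor C \<Longrightarrow> f \<in> hom (Dom C f) (Cod C f)"
  by (simp add: Hom_def)

lemma finite_hom [simp]: "finite (hom x y)"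
  using finite_Mor by (simp add: Hom_def)

lemma Dom_Idt: "x \<in> Obj C \<Longrightarrow> Dom C (Idt C x) = x"
  and Cod_Idt: "x \<in> Obj C \<Longrightarrow> Cod C (Idt C x) = x"
  using id_in by (auto simp: Hom_def)

lemma finite_Obj: "finite (Obj C)"
proof (rule inj_on_finite[of "Idt C" _ "Mor C"])
  show "inj_on (Idt C) (Obj C)" by (metis Dom_Idt inj_onI)
  show "Idt C ` Obj C \<subseteq> Mor C" using id_in by (auto simp: Hom_def)
qed (rule finite_Mor)

lemma inverse_mors_unique:
  assumes "inverse_mors C f g" "inverse_mors C f g'" shows "g = g'"
proof -
  let ?x = "Dom C f" and ?y = "Cod C f"
  have f: "f \<in> hom ?x ?y" and g: "g \<in> hom ?y ?x" and g': "g' \<in> hom ?y ?x"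
    using assms by (auto simp: inverse_mors_def intro: Mor_hom)
  have "g = g \<cdot> (f \<cdot> g')" using assms g comp_id_right by (simp add: inverse_mors_def)
  also have "\<dots> = (g \<cdot> f) \<cdot> g'" by (rule comp_assoc[OF g' f g])
  also have "\<dots> = g'" using assms g' comp_id_left by (simp add: inverse_mors_def)
  finally show ?thesis .
qed

lemma inverse_inve: "g \<in> hom x x \<Longrightarrow> inverse_mors C g (inve g)"
  unfolding inv_mor_def
  by (rule theI') (metis endo_iso HomD(4) iso_mor_def inverse_mors_unique)

lemma inve_in [intro]: "g \<in> hom x x \<Longrightarrow> inve g \<in> hom x x"
  using inverse_inve[of g x] HomD by (auto simp: inverse_mors_def)

lemma inve_left: "g \<in> hom x x \<Longrightarrow> inve g \<cdot> g = Idt C x"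
  using inverse_inve[of g x] HomD by (auto simp: inverse_mors_def)

lemma inve_right: "g \<in> hom x x \<Longrightarrow> g \<cdot> inve g = Idt C x"
  using inverse_inve[of g x] HomD by (auto simp: inverse_mors_def)

lemma cancel_right1: "g \<in> hom x x \<Longrightarrow> f \<in> hom x y \<Longrightarrow> (f \<cdot> g) \<cdot> inve g = f"
  using comp_assoc[of "inve g" x x g x f y] comp_id_right[of f x y] by (simp add: inve_in inve_right)

lemma cancel_right2: "g \<in> hom x x \<Longrightarrow> f \<in> hom x y \<Longrightarrow> (f \<cdot> inve g) \<cdot> g = f"
  using comp_assoc[of g x x "inve g" x f y] comp_id_right[of f x y] by (simp add: inve_in inve_left)

lemma cancel_left1: "g \<in> hom y y \<Longrightarrow> f \<in> hom x y \<Longrightarrow> g \<cdot> (inve g \<cdot> f) = f"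
  using comp_assoc[of f x y "inve g" y g y] comp_id_left[of f x y] by (simp add: inve_in inve_right)

lemma cancel_left2: "g \<in> hom y y \<Longrightarrow> f \<in> hom x y \<Longrightarrow> inve g \<cdot> (g \<cdot> f) = f"
  using comp_assoc[of f x y g y "inve g" y] comp_id_left[of f x y] by (simp add: inve_in inve_left)

lemma inve_inve: "g \<in> hom x x \<Longrightarrow> inve (inve g) = g"
  using cancel_left2[of "inve g" x g x] comp_id_right[of "inve (inve g)" x x] by (simp add: inve_in inve_left)

lemma inve_Idt: "x \<in> Obj C \<Longrightarrow> inve (Idt C x) = Idt C x"
  using inve_right[OF id_in] comp_id_left[OF inve_in[OF id_in]] by simp

lemma iso_iff: "f \<in> Mor C \<Longrightarrow> iso_mor C f \<longleftrightarrow> Dom C f = Cod C f"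
  using endo_iso iso_endo Mor_hom by (metis dom_in)

lemma Aut_eq: "x \<in> Obj C \<Longrightarrow> Aut C x = hom x x"
  using endo_iso by (auto simp: Aut_def)

lemma hom_antisym:
  assumes f: "f \<in> hom x y" and g: "g \<in> hom y x" shows "x = y"
proof -
  have gf: "g \<cdot> f \<in> hom x x" and fg: "f \<cdot> g \<in> hom y y" using comp_in f g by auto
  \<comment> \<open>since \<open>g \<circ> f\<close> and \<open>f \<circ> g\<close> are automorphisms, \<open>f\<close> has a left and a right inverse\<close>
  let ?l = "inve (g \<cdot> f) \<cdot> g" and ?r = "g \<cdot> inve (f \<cdot> g)"
  have l: "?l \<in> hom y x" and r: "?r \<in> hom y x" using gf fg g by (meson comp_in inve_in)+
  have lf: "?l \<cdot> f = Idt C x" using comp_assoc[OF f g inve_in[OF gf]] inve_left[OF gf] by simp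
  have fr: "f \<cdot> ?r = Idt C y" using comp_assoc[OF inve_in[OF fg] g f] inve_right[OF fg] by simp
  have "?l = ?l \<cdot> (f \<cdot> ?r)" using fr l comp_id_right by simp
  also have "\<dots> = ?r" using comp_assoc[OF r f l] lf comp_id_left[OF r] by simp
  finally have "inverse_mors C f ?l" using lf fr l f HomD by (auto simp: inverse_mors_def)
  then have "iso_mor C f" by (auto simp: iso_mor_def)
  then show ?thesis using iso_endo f by blast
qed

lemma path_comp_in:
  assumes "as \<noteq> []" "set as \<subseteq> Mor C" "successively (\<lambda>a b. Cod C a = Dom C b) as"
  shows "path_comp C as \<in> hom (Dom C (hd as)) (Cod C (last as))"
  using assms
proof (induction as rule: list_nonempty_induct)
  case (single a)
  then show ?case using Mor_hom by simp
next
  case (cons a as)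
  obtain b as' where as: "as = b # as'" using cons.hyps by (cases as) auto
  have "path_comp C as \<in> hom (Dom C (hd as)) (Cod C (last as))"
    using cons by (auto simp: successively_Cons)
  moreover have "a \<in> hom (Dom C a) (Dom C (hd as))"
    using cons Mor_hom[of a] by (auto simp: successively_Cons)
  ultimately have "path_comp C as \<cdot> a \<in> hom (Dom C a) (Cod C (last as))"
    using comp_in by blast
  then show ?case using as by simp
qed

lemma path_comp_append:
  assumes "as \<noteq> []" "bs \<noteq> []" "set as \<subseteq> Mor C" "set bs \<subseteq> Mor C"
    "successively (\<lambda>a b. Cod C a = Dom C b) (as @ bs)"
  shows "path_comp C (as @ bs) = path_comp C bs \<cdot> path_comp C as"
  using assms(1,3,5)
proof (induction as rule: list_nonempty_induct)
  case (single a)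
  then show ?case using assms(2) by (cases bs) auto
next
  case (cons a as)
  obtain b as' where as: "as = b # as'" using cons.hyps by (cases as) auto
  have s: "successively (\<lambda>a b. Cod C a = Dom C b) (as @ bs)" "Cod C a = Dom C (hd as)"
    using cons.hyps cons.prems(2) by (auto simp: successively_Cons)
  then have s': "successively (\<lambda>a b. Cod C a = Dom C b) as" "successively (\<lambda>a b. Cod C a = Dom C b) bs"
     "Cod C (last as) = Dom C (hd bs)"
    using cons.hyps assms(2) by (auto simp: successively_append_iff)
  have a: "a \<in> hom (Dom C a) (Dom C (hd as))" using s(2) cons.prems(1) Mor_hom[of a] by simp
  have pa: "path_comp C as \<in> hom (Dom C (hd as)) (Dom C (hd bs))"
    using path_comp_in[OF cons.hyps _ s'(1)] s'(3) cons.prems(1) by simp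
  have pb: "path_comp C bs \<in> hom (Dom C (hd bs)) (Cod C (last bs))"
    by (rule path_comp_in[OF assms(2,4) s'(2)])
  have "path_comp C ((a # as) @ bs) = path_comp C (as @ bs) \<cdot> a" using as by simp
  also have "path_comp C (as @ bs) = path_comp C bs \<cdot> path_comp C as" using cons s by simp
  also have "(path_comp C bs \<cdot> path_comp C as) \<cdot> a = path_comp C bs \<cdot> (path_comp C as \<cdot> a)"
    by (rule comp_assoc[OF a pa pb, symmetric])
  also have "path_comp C as \<cdot> a = path_comp C (a # as)" using as by simp
  finally show ?case .
qed

lemma decomposition_iff:
  "decomposition C a as \<longleftrightarrow> as \<noteq> [] \<and> (\<forall>b\<in>set as. unfactorizable C b)
     \<and> successively (\<lambda>a b. Cod C a = Dom C b) as \<and> a = path_comp C as"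
  by (auto simp: decomposition_def successively_conv_nth)

lemma decomposition_append:
  assumes "decomposition C a as" "decomposition C b bs" "Cod C a = Dom C b"
  shows "decomposition C (b \<cdot> a) (as @ bs)"
proof -
  have m: "set as \<subseteq> Mor C" "set bs \<subseteq> Mor C" using assms by (auto simp: decomposition_def unfactorizable_def)
  have "a \<in> hom (Dom C (hd as)) (Cod C (last as))" "b \<in> hom (Dom C (hd bs)) (Cod C (last bs))"
    using path_comp_in[OF _ m(1)] path_comp_in[OF _ m(2)] assms(1,2) by (simp_all add: decomposition_iff)
  then have e: "Cod C (last as) = Dom C (hd bs)" using assms(3) HomD(2,3) by simp
  have s: "successively (\<lambda>a b. Cod C a = Dom C b) (as @ bs)"
    using e assms(1,2) by (simp add: decomposition_iff successively_append_iff)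
  show ?thesis using assms(1,2) s path_comp_append[OF _ _ m s]
    by (auto simp: decomposition_iff)
qed

text \<open>The rank strictly increases along every morphism between distinct objects and serves as the measure
  in all inductions along the category.\<close>

definition rank :: "'o \<Rightarrow> nat" where "rank y = card {w \<in> Obj C. hom w y \<noteq> {}}"

lemma rank_less:
  assumes "f \<in> hom x y" "x \<noteq> y" shows "rank x < rank y"
  unfolding rank_def
proof (rule psubset_card_mono)
  have "y \<in> {w \<in> Obj C. hom w y \<noteq> {}}" using HomD(5)[OF assms(1)] id_in by blast
  moreover have "y \<notin> {w \<in> Obj C. hom w x \<noteq> {}}" using hom_antisym assms by blast
  moreover have "{w \<in> Obj C. hom w x \<noteq> {}} \<subseteq> {w \<in> Obj C. hom w y \<noteq> {}}"
    using comp_in assms(1) by blast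
  ultimately show "{w \<in> Obj C. hom w x \<noteq> {}} \<subset> {w \<in> Obj C. hom w y \<noteq> {}}" by blast
qed (simp add: finite_Obj)

lemma unfactorizable_iff:
  "unfactorizable C a \<longleftrightarrow> a \<in> Mor C \<and> Dom C a \<noteq> Cod C a
     \<and> (\<forall>x y z b c. b \<in> hom x y \<longrightarrow> c \<in> hom y z \<longrightarrow> a = c \<cdot> b \<longrightarrow> x = y \<or> y = z)"
    (is "_ \<longleftrightarrow> _ \<and> _ \<and> ?r")
proof
  assume u: "unfactorizable C a"
  have "x = y \<or> y = z" if b: "b \<in> hom x y" and c: "c \<in> hom y z" and a: "a = c \<cdot> b" for x y z b c
  proof -
    have bc: "Cod C b = Dom C c" using HomD(3)[OF b] HomD(2)[OF c] by (simp only:)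
    have "iso_mor C b \<or> iso_mor C c"
      using u HomD(1)[OF b] HomD(1)[OF c] bc a unfolding unfactorizable_def by blast
    then show ?thesis using iso_endo[OF b] iso_endo[OF c] by (elim disjE) simp_all
  qed
  then have ?r by (intro allI impI)
  then show "a \<in> Mor C \<and> Dom C a \<noteq> Cod C a \<and> ?r"
    using u iso_iff[of a] unfolding unfactorizable_def by (elim conjE) (intro conjI, simp_all)
next
  assume r: "a \<in> Mor C \<and> Dom C a \<noteq> Cod C a \<and> ?r"
  have "iso_mor C b \<or> iso_mor C c"
    if b: "b \<in> Mor C" and c: "c \<in> Mor C" and bc: "Cod C b = Dom C c" and a: "a = c \<cdot> b" for b c
  proof -
    have "c \<in> hom (Cod C b) (Cod C c)" using Mor_hom[OF c] bc by (simp only:)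
    with r Mor_hom[OF b] a have "Dom C b = Cod C b \<or> Cod C b = Cod C c" by blast
    then show ?thesis using iso_iff b c bc by auto
  qed
  then show "unfactorizable C a" using r iso_iff unfolding unfactorizable_def by blast
qed

lemma unfactorizableD:
  assumes "unfactorizable C a" "a \<in> hom x y"
  shows "x \<noteq> y" "\<And>z b c. b \<in> hom x z \<Longrightarrow> c \<in> hom z y \<Longrightarrow> a = c \<cdot> b \<Longrightarrow> z = x \<or> z = y"
proof -
  show "x \<noteq> y" using assms HomD(2,3)[OF assms(2)] by (simp add: unfactorizable_iff)
  show "z = x \<or> z = y" if "b \<in> hom x z" "c \<in> hom z y" "a = c \<cdot> b" for z b c
    using assms(1)[unfolded unfactorizable_iff, THEN conjunct2, THEN conjunct2, rule_format, OF that] by (elim disjE) simp_all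
qed

lemma not_unfactorizableE:
  assumes "a \<in> hom x y" "x \<noteq> y" "\<not> unfactorizable C a"
  obtains z b c where "b \<in> hom x z" "c \<in> hom z y" "a = c \<cdot> b" "z \<noteq> x" "z \<noteq> y"
proof -
  obtain x' z y' b c where bc: "b \<in> hom x' z" "c \<in> hom z y'" "a = c \<cdot> b" "x' \<noteq> z" "z \<noteq> y'"
    using assms HomD[OF assms(1)] unfolding unfactorizable_iff by auto
  then have "x' = x" "y' = y" using comp_in[OF bc(1,2)] assms(1) HomD(2,3) by metis+
  then show ?thesis using that bc by blast
qed

lemma unfactorizable_comp_iso:
  assumes u: "unfactorizable C u" "u \<in> hom x y" and g: "g \<in> hom x x"
  shows "unfactorizable C (u \<cdot> g)"
proof (rule ccontr)
  assume n: "\<not> ?thesis"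
  have ug: "u \<cdot> g \<in> hom x y" using comp_in u g by blast
  obtain z b c where bc: "b \<in> hom x z" "c \<in> hom z y" "u \<cdot> g = c \<cdot> b" "z \<noteq> x" "z \<noteq> y"
    using not_unfactorizableE[OF ug unfactorizableD(1)[OF u] n] .
  have "u = (u \<cdot> g) \<cdot> inve g" using cancel_right1[OF g u(2)] by simp
  also have "\<dots> = c \<cdot> (b \<cdot> inve g)" unfolding bc(3) using comp_assoc[OF inve_in[OF g] bc(1,2)] by simp
  finally show False using unfactorizableD(2)[OF u comp_in[OF inve_in[OF g] bc(1)] bc(2)] bc(4,5) by blast
qed

lemma unfactorizable_iso_comp:
  assumes u: "unfactorizable C u" "u \<in> hom x y" and g: "g \<in> hom y y"
  shows "unfactorizable C (g \<cdot> u)"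
proof (rule ccontr)
  assume n: "\<not> ?thesis"
  have ug: "g \<cdot> u \<in> hom x y" using comp_in u g by blast
  obtain z b c where bc: "b \<in> hom x z" "c \<in> hom z y" "g \<cdot> u = c \<cdot> b" "z \<noteq> x" "z \<noteq> y"
    using not_unfactorizableE[OF ug unfactorizableD(1)[OF u] n] .
  have "u = inve g \<cdot> (g \<cdot> u)" using cancel_left2[OF g u(2)] by simp
  also have "\<dots> = (inve g \<cdot> c) \<cdot> b" unfolding bc(3) using comp_assoc[OF bc(1,2) inve_in[OF g]] by simp
  finally show False using unfactorizableD(2)[OF u bc(1) comp_in[OF bc(2) inve_in[OF g]]] bc(4,5) by blast
qed

lemma hom_induct [consumes 1, case_names iso unfactorizable comp]:
  assumes "f \<in> hom x y"
    and "\<And>x f. f \<in> hom x x \<Longrightarrow> P f"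
    and "\<And>x y f. f \<in> hom x y \<Longrightarrow> unfactorizable C f \<Longrightarrow> P f"
    and "\<And>x y z f g. f \<in> hom x y \<Longrightarrow> g \<in> hom y z \<Longrightarrow> x \<noteq> y \<Longrightarrow> y \<noteq> z \<Longrightarrow> P f \<Longrightarrow> P g \<Longrightarrow> P (g \<cdot> f)"
  shows "P f"
  using assms(1)
proof (induction "rank y - rank x" arbitrary: x y f rule: less_induct)
  case less
  show ?case
  proof (cases "x = y \<or> unfactorizable C f")
    case True then show ?thesis using assms(2,3) less.prems by blast
  next
    case False
    then obtain z b c where bc: "b \<in> hom x z" "c \<in> hom z y" "f = c \<cdot> b" "z \<noteq> x" "z \<noteq> y"
      using not_unfactorizableE[OF less.prems] by metis
    then have "rank x < rank z" "rank z < rank y" using rank_less by metis+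
    then show ?thesis using less.hyps[OF _ bc(1)] less.hyps[OF _ bc(2)] assms(4)[OF bc(1,2)] bc by auto
  qed
qed

lemma last_unfactorizable:
  assumes "f \<in> hom x y" "x \<noteq> y"
  shows "\<exists>z u b. u \<in> hom z y \<and> unfactorizable C u \<and> b \<in> hom x z \<and> f = u \<cdot> b"
proof -
  have "f \<in> hom x y \<and> x \<noteq> y \<longrightarrow> (\<exists>z u b. u \<in> hom z y \<and> unfactorizable C u \<and> b \<in> hom x z \<and> f = u \<cdot> b)" for x y
    using assms(1)
  proof (induction f arbitrary: x y rule: hom_induct)
    case (iso x' f) then show ?case using HomD(2,3) by metis
  next
    case (unfactorizable x' y' f)
    show ?case
    proof
      assume f: "f \<in> hom x y \<and> x \<noteq> y"
      then show "\<exists>z u b. u \<in> hom z y \<and> unfactorizable C u \<and> b \<in> hom x z \<and> f = u \<cdot> b"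
        using unfactorizable(2) id_in[OF HomD(4), of f x y] comp_id_right[of f x y]
        by (intro exI[of _ x] exI[of _ f] exI[of _ "Idt C x"]) simp
    qed
  next
    case (comp x' y' z' f g)
    show ?case
    proof
      assume "g \<cdot> f \<in> hom x y \<and> x \<noteq> y"
      moreover have gf: "g \<cdot> f \<in> hom x' z'" using comp_in comp by blast
      ultimately have e: "x = x'" "y = z'" using HomD(2,3)[of "g \<cdot> f"] by metis+
      obtain w u b where u: "u \<in> hom w z'" "unfactorizable C u" "b \<in> hom y' w" "g = u \<cdot> b"
        using comp by blast
      have "g \<cdot> f = u \<cdot> (b \<cdot> f)" unfolding u(4) by (rule comp_assoc[OF comp(1) u(3,1), symmetric])
      moreover have "b \<cdot> f \<in> hom x' w" by (rule comp_in[OF comp(1) u(3)])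
      ultimately
      show "\<exists>z u b. u \<in> hom z y \<and> unfactorizable C u \<and> b \<in> hom x z \<and> g \<cdot> f = u \<cdot> b"
        unfolding e using u by blast
    qed
  qed
  then show ?thesis using assms by blast
qed

lemma decomposition_exists:
  assumes "f \<in> hom x y" "x \<noteq> y" shows "\<exists>as. decomposition C f as"
proof -
  have "Dom C f \<noteq> Cod C f \<longrightarrow> (\<exists>as. decomposition C f as)"
    using assms(1)
  proof (induction f rule: hom_induct)
    case (iso x f) then show ?case using HomD(2,3) by metis
  next
    case (unfactorizable x y f) then show ?case by (auto intro!: exI[of _ "[f]"] simp: decomposition_def)
  next
    case (comp x y z f g)
    obtain as bs where "decomposition C f as" "decomposition C g bs"
      using comp(3-6) HomD(2,3)[OF comp(1)] HomD(2,3)[OF comp(2)] by auto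
    then have "decomposition C (g \<cdot> f) (as @ bs)"
      using HomD(3)[OF comp(1)] HomD(2)[OF comp(2)] by (intro decomposition_append) simp_all
    then show ?case by blast
  qed
  then show ?thesis using assms HomD(2,3) by metis
qed

end

section \<open>Equidivisibility and duality\<close>

context ei_category
begin

text \<open>The automorphisms that relate two decompositions telescope in the composite of an initial segment,
  so that only the last one survives.\<close>

lemma unique_factorization_prefix:
  assumes as: "as \<noteq> []" "set as \<subseteq> Mor C" "successively (\<lambda>a b. Cod C a = Dom C b) as"
    and bs: "set bs \<subseteq> Mor C" "successively (\<lambda>a b. Cod C a = Dom C b) bs" "length bs = length as"
    and h0: "h 0 = Idt C (Dom C (hd as))"
    and h: "\<And>i. Suc i < length as \<Longrightarrow> h (Suc i) \<in> hom (Cod C (as ! i)) (Cod C (as ! i))"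
    and eq: "\<And>i. i < length as \<Longrightarrow> bs ! i = h (Suc i) \<cdot> (as ! i \<cdot> inve (h i))"
    and i: "Suc i < length as"
  shows "path_comp C (take (Suc i) bs) = h (Suc i) \<cdot> path_comp C (take (Suc i) as)"
  using i
proof (induction i)
  case 0
  have a: "as ! 0 \<in> hom (Dom C (hd as)) (Cod C (as ! 0))"
    using as(1) Mor_hom[OF subsetD[OF as(2) nth_mem[of 0]]] by (simp add: hd_conv_nth)
  have "take (Suc 0) as = [as ! 0]" "take (Suc 0) bs = [bs ! 0]"
    using as bs by (auto simp: take_Suc_conv_app_nth)
  moreover have "bs ! 0 = h 1 \<cdot> as ! 0"
    using eq[of 0] as(1) h0 comp_id_right[OF a] inve_Idt[OF HomD(4)[OF a]] by simp
  ultimately show ?case by simp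
next
  case (Suc i)
  let ?x = "Cod C (as ! i)" and ?y = "Cod C (as ! Suc i)"
  have ta: "take (Suc (Suc i)) as = take (Suc i) as @ [as ! Suc i]"
    and tb: "take (Suc (Suc i)) bs = take (Suc i) bs @ [bs ! Suc i]"
    using Suc.prems bs by (simp_all add: take_Suc_conv_app_nth)
  have ne: "take (Suc i) as \<noteq> []" "take (Suc i) bs \<noteq> []" using as bs by auto
  have sa: "successively (\<lambda>a b. Cod C a = Dom C b) (take (Suc i) as @ [as ! Suc i])"
    using as(3) unfolding ta[symmetric] by (auto simp: successively_conv_nth)
  have sb: "successively (\<lambda>a b. Cod C a = Dom C b) (take (Suc i) bs @ [bs ! Suc i])"
    using bs(2) unfolding tb[symmetric] by (auto simp: successively_conv_nth)
  have ma: "set (take (Suc i) as) \<subseteq> Mor C" "set [as ! Suc i] \<subseteq> Mor C"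
    using as(2) Suc.prems set_take_subset[of "Suc i" as] by auto
  have mb: "set (take (Suc i) bs) \<subseteq> Mor C" "set [bs ! Suc i] \<subseteq> Mor C"
    using bs Suc.prems set_take_subset[of "Suc i" bs] by auto
  let ?p = "path_comp C (take (Suc i) as)"
  have sa': "successively (\<lambda>a b. Cod C a = Dom C b) (take (Suc i) as)"
    using sa by (simp add: successively_append_iff)
  have "last (take (Suc i) as) = as ! i" using Suc.prems by (simp add: take_Suc_conv_app_nth)
  then have p: "?p \<in> hom (Dom C (hd (take (Suc i) as))) ?x"
    using path_comp_in[OF ne(1) ma(1) sa'] by simp
  have "Dom C (as ! Suc i) = ?x" using as(3) Suc.prems by (simp add: successively_conv_nth)
  then have a: "as ! Suc i \<in> hom ?x ?y" using Mor_hom[OF subsetD[OF ma(2)], of "as ! Suc i"] by simp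
  have hi: "h (Suc i) \<in> hom ?x ?x" and hs: "h (Suc (Suc i)) \<in> hom ?y ?y"
    using h[of i] h[of "Suc i"] Suc.prems by auto
  have ai: "as ! Suc i \<cdot> inve (h (Suc i)) \<in> hom ?x ?y" using comp_in[OF inve_in[OF hi] a] .
  have "path_comp C (take (Suc (Suc i)) bs) = bs ! Suc i \<cdot> path_comp C (take (Suc i) bs)"
    unfolding tb path_comp_append[OF ne(2) _ mb sb, simplified] by simp
  also have "\<dots> = (h (Suc (Suc i)) \<cdot> (as ! Suc i \<cdot> inve (h (Suc i)))) \<cdot> (h (Suc i) \<cdot> ?p)"
    using eq[of "Suc i"] Suc by simp
  also have "\<dots> = h (Suc (Suc i)) \<cdot> ((as ! Suc i \<cdot> inve (h (Suc i))) \<cdot> (h (Suc i) \<cdot> ?p))"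
    by (rule comp_assoc[OF comp_in[OF p hi] ai hs, symmetric])
  also have "(as ! Suc i \<cdot> inve (h (Suc i))) \<cdot> (h (Suc i) \<cdot> ?p) = as ! Suc i \<cdot> ?p"
    using comp_assoc[OF p hi ai] cancel_right2[OF hi a] by simp
  also have "as ! Suc i \<cdot> ?p = path_comp C (take (Suc (Suc i)) as)"
    unfolding ta path_comp_append[OF ne(1) _ ma sa, simplified] by simp
  finally show ?case .
qed

text \<open>If \<open>b\<close> is an automorphism, then \<open>u\<close> differs from \<open>u'\<close> by one, as \<open>u\<close> is unfactorizable.  Otherwise
  decompositions of \<open>b\<close> and \<open>b'\<close>, prolonged by \<open>u\<close> and \<open>u'\<close>, decompose the same morphism, and the
  automorphism at the last intermediate object is the one wanted.\<close>

lemma unique_factorization_last: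
  assumes uf: "unique_factorization C"
    and u: "unfactorizable C u" "u \<in> hom y z" and u': "unfactorizable C u'" "u' \<in> hom y' z"
    and b: "b \<in> hom x y" and b': "b' \<in> hom x y'" and eq: "u \<cdot> b = u' \<cdot> b'"
  shows "y' = y \<and> (\<exists>h\<in>hom y y. b' = h \<cdot> b \<and> u = u' \<cdot> h)"
proof -
  have iso_case: "y' = y \<and> (\<exists>h\<in>hom y y. b' = h \<cdot> b \<and> u = u' \<cdot> h)" if "x = y"
  proof -
    have b: "b \<in> hom y y" and b': "b' \<in> hom y y'" using b b' that by auto
    let ?h = "b' \<cdot> inve b"
    have h: "?h \<in> hom y y'" using comp_in[OF inve_in[OF b] b'] .
    have uh: "u = u' \<cdot> ?h"
      using cancel_right1[OF b u(2)] eq comp_assoc[OF inve_in[OF b] b' u'(2)] by simp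
    then have "y' = y" using unfactorizableD(2)[OF u h u'(2)] unfactorizableD(1)[OF u'] by blast
    moreover have "b' = ?h \<cdot> b" using cancel_right2[OF b b'] by simp
    ultimately show ?thesis using h uh by blast
  qed
  consider "x = y" | "x = y'" "x \<noteq> y" | "x \<noteq> y" "x \<noteq> y'" by blast
  then show ?thesis
  proof cases
    case 2
    have b': "b' \<in> hom y' y'" using b' 2 by simp
    let ?h = "b \<cdot> inve b'"
    have h: "?h \<in> hom y' y" using comp_in[OF inve_in[OF b']] b 2 by blast
    have "u' = u \<cdot> ?h"
      using cancel_right1[OF b' u'(2)] eq comp_assoc[OF inve_in[OF b'] _ u(2), of b] b 2 by simp
    then have "y' = y" using unfactorizableD(2)[OF u' h u(2)] unfactorizableD(1)[OF u] by blast
    then show ?thesis using 2 by simp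
  next
    case 3
    obtain as bs where as: "decomposition C b as" and bs: "decomposition C b' bs"
      using decomposition_exists b b' 3 by blast
    let ?as = "as @ [u]" and ?bs = "bs @ [u']" and ?a = "u \<cdot> b"
    have a: "?a \<in> hom x z" using comp_in[OF b u(2)] .
    have xz: "x \<noteq> z" using hom_antisym[OF b] u unfactorizableD(1)[OF u] 3 by blast
    have da: "decomposition C ?a ?as"
      using decomposition_append[OF as, of u "[u]"] u HomD(3)[OF b] HomD(2)[OF u(2)] by (simp add: decomposition_def)
    have db: "decomposition C ?a ?bs"
      unfolding eq
      using decomposition_append[OF bs, of u' "[u']"] u' HomD(3)[OF b'] HomD(2)[OF u'(2)] by (simp add: decomposition_def)
    have niso: "\<not> iso_mor C ?a" using iso_endo[OF a] xz by blast
    obtain h where len: "length ?as = length ?bs"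
      and cod: "\<And>i. i < length ?as \<Longrightarrow> Cod C (?as ! i) = Cod C (?bs ! i)"
      and h0: "h 0 = Idt C (Dom C ?a)" and hn: "h (length ?as) = Idt C (Cod C ?a)"
      and h: "\<And>i. Suc i < length ?as \<Longrightarrow> h (Suc i) \<in> Aut C (Cod C (?as ! i))"
      and heq: "\<And>i. i < length ?as \<Longrightarrow> ?bs ! i = h (Suc i) \<cdot> (?as ! i \<cdot> inve (h i))"
      using uf[unfolded unique_factorization_def, rule_format, OF HomD(1)[OF a] niso da db] by blast
    have nea: "as \<noteq> []" "bs \<noteq> []" using as bs by (auto simp: decomposition_def)
    have ma: "set ?as \<subseteq> Mor C" and mb: "set ?bs \<subseteq> Mor C"
      using da db by (auto simp: decomposition_def unfactorizable_def)
    have sa: "successively (\<lambda>a b. Cod C a = Dom C b) ?as" and sb: "successively (\<lambda>a b. Cod C a = Dom C b) ?bs"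
      using da db by (simp_all only: decomposition_iff)
    have pa: "path_comp C as = b" and pb: "path_comp C bs = b'"
      using as bs by (simp_all add: decomposition_def)
    have "path_comp C as \<in> hom (Dom C (hd as)) (Cod C (last as))"
      using as ma by (intro path_comp_in) (auto simp: decomposition_iff)
    then have bd: "Dom C (hd as) = x" "Cod C (last as) = y" using b HomD(2,3) unfolding pa by metis+
    have "path_comp C bs \<in> hom (Dom C (hd bs)) (Cod C (last bs))"
      using bs mb by (intro path_comp_in) (auto simp: decomposition_iff)
    then have bd': "Cod C (last bs) = y'" using b' HomD(3) unfolding pb by metis
    define k where "k = length as - 1"
    have k: "Suc k = length as" "length bs = length as" "k < length as" using nea len by (simp_all add: k_def)
    have ak: "?as ! k = last as" "?bs ! k = last bs"
      using k nea by (simp_all add: nth_append last_conv_nth k_def)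
    have yy: "y' = y" using cod[of k] k ak bd bd' by simp
    have h': "h (Suc i) \<in> hom (Cod C (?as ! i)) (Cod C (?as ! i))" if "Suc i < length ?as" for i
      using h[OF that] by (simp add: Aut_def)
    have hk: "h (length as) \<in> hom y y" using h'[of k] k ak bd by simp
    have "path_comp C (take (Suc k) ?bs) = h (Suc k) \<cdot> path_comp C (take (Suc k) ?as)"
    proof (rule unique_factorization_prefix[OF _ ma sa mb sb len[symmetric] _ h' heq])
      show "h 0 = Idt C (Dom C (hd ?as))" using h0 HomD(2)[OF a] bd nea by simp
    qed (use k in auto)
    then have "b' = h (length as) \<cdot> b" using k pa pb by simp
    moreover have "u' = u \<cdot> inve (h (length as))"
    proof -
      have "u' = Idt C z \<cdot> (u \<cdot> inve (h (length as)))"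
        using heq[of "length as"] hn HomD(3)[OF a] k(2) by (simp add: nth_append)
      then show ?thesis using comp_id_left[OF comp_in[OF inve_in[OF hk] u(2)]] by simp
    qed
    then have "u = u' \<cdot> h (length as)" using cancel_right2[OF hk u(2)] by simp
    ultimately show ?thesis using hk yy by blast
  qed (rule iso_case)
qed

text \<open>Levi's lemma for words, up to automorphisms.  If neither \<open>b\<close> nor \<open>d\<close> is an automorphism, their last
  unfactorizable factors agree up to an automorphism \<open>h\<close>; absorbing \<open>h\<close> into what remains of \<open>b\<close>, the
  claim is reduced to an object of smaller rank.\<close>

lemma equidivisible:
  assumes uf: "unique_factorization C"
    and "a \<in> hom x y" "b \<in> hom y z" "c \<in> hom x w" "d \<in> hom w z" "b \<cdot> a = d \<cdot> c"
  shows "(\<exists>e\<in>hom w y. a = e \<cdot> c \<and> d = b \<cdot> e) \<or> (\<exists>e\<in>hom y w. c = e \<cdot> a \<and> b = d \<cdot> e)"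
  using assms(2-)
proof (induction "rank z" arbitrary: z a b c d y w rule: less_induct)
  case less
  note a = \<open>a \<in> hom x y\<close> and b = \<open>b \<in> hom y z\<close> and c = \<open>c \<in> hom x w\<close> and d = \<open>d \<in> hom w z\<close>
    and eq = \<open>b \<cdot> a = d \<cdot> c\<close>
  consider "y = z" | "w = z" | "y \<noteq> z" "w \<noteq> z" by blast
  then show ?case
  proof cases
    case 1
    then have b: "b \<in> hom z z" and a: "a \<in> hom x z" using a b by auto
    have "inve b \<cdot> d \<in> hom w z" "a = (inve b \<cdot> d) \<cdot> c" "d = b \<cdot> (inve b \<cdot> d)"
      using comp_in[OF d inve_in[OF b]] cancel_left2[OF b a] eq comp_assoc[OF c d inve_in[OF b]]
        cancel_left1[OF b d] by simp_all
    then show ?thesis using 1 by blast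
  next
    case 2
    then have d: "d \<in> hom z z" and c: "c \<in> hom x z" using c d by auto
    have "inve d \<cdot> b \<in> hom y z" "c = (inve d \<cdot> b) \<cdot> a" "b = d \<cdot> (inve d \<cdot> b)"
      using comp_in[OF b inve_in[OF d]] cancel_left2[OF d c] eq comp_assoc[OF a b inve_in[OF d]]
        cancel_left1[OF d b] by simp_all
    then show ?thesis using 2 by blast
  next
    case 3
    obtain v u b1 where u: "u \<in> hom v z" "unfactorizable C u" and b1: "b1 \<in> hom y v" "b = u \<cdot> b1"
      using last_unfactorizable[OF b 3(1)] by blast
    obtain v' u' d1 where u': "u' \<in> hom v' z" "unfactorizable C u'" and d1: "d1 \<in> hom w v'" "d = u' \<cdot> d1"
      using last_unfactorizable[OF d 3(2)] by blast
    have "u \<cdot> (b1 \<cdot> a) = u' \<cdot> (d1 \<cdot> c)"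
      using eq comp_assoc[OF a b1(1) u(1)] comp_assoc[OF c d1(1) u'(1)] b1 d1 by simp
    then obtain h where v: "v' = v" and h: "h \<in> hom v v" "d1 \<cdot> c = h \<cdot> (b1 \<cdot> a)" "u = u' \<cdot> h"
      using unique_factorization_last[OF uf u(2,1) u'(2,1) comp_in[OF a b1(1)] comp_in[OF c d1(1)]] by blast
    have d1': "d1 \<in> hom w v" and u'': "u' \<in> hom v z" using d1 u' v by auto
    have hb1: "h \<cdot> b1 \<in> hom y v" by (rule comp_in[OF b1(1) h(1)])
    have b_eq: "b = u' \<cdot> (h \<cdot> b1)" using b1 h(3) comp_assoc[OF b1(1) h(1) u''] by simp
    have "rank v < rank z" using rank_less[OF u(1)] unfactorizableD(1)[OF u(2,1)] by blast
    moreover have "(h \<cdot> b1) \<cdot> a = d1 \<cdot> c" using h(2) comp_assoc[OF a b1(1) h(1)] by simp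
    ultimately consider e where "e \<in> hom w y" "a = e \<cdot> c" "d1 = (h \<cdot> b1) \<cdot> e"
      | e where "e \<in> hom y w" "c = e \<cdot> a" "h \<cdot> b1 = d1 \<cdot> e"
      using less.hyps[OF _ a hb1 c d1'] by blast
    then show ?thesis
    proof cases
      case (1 e)
      then have "d = b \<cdot> e" using comp_assoc[OF 1(1) hb1 u''] d1(2) b_eq by simp
      then show ?thesis using 1 by blast
    next
      case (2 e)
      then have "b = d \<cdot> e" using comp_assoc[OF 2(1) d1' u''] d1(2) b_eq by simp
      then show ?thesis using 2 by blast
    qed
  qed
qed

end

text \<open>From here on freeness is used in this form only: it is self-dual and speaks about arbitrary
  factorizations.\<close>

locale levi_category = ei_category C for C :: "('o, 'm) precategory" +
  assumes levi: "\<lbrakk>a \<in> Hom C x y; b \<in> Hom C y z; c \<in> Hom C x w; d \<in> Hom C w z; Cmp C b a = Cmp C d c\<rbrakk>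
    \<Longrightarrow> (\<exists>e\<in>Hom C w y. a = Cmp C e c \<and> d = Cmp C b e) \<or> (\<exists>e\<in>Hom C y w. c = Cmp C e a \<and> b = Cmp C d e)"
begin

lemma factorization_same_object:
  assumes "a \<in> hom x y" "b \<in> hom y z" "c \<in> hom x y" "d \<in> hom y z" "b \<cdot> a = d \<cdot> c"
  shows "\<exists>h\<in>hom y y. c = h \<cdot> a \<and> b = d \<cdot> h"
  using levi[OF assms]
proof (elim disjE bexE conjE)
  fix e assume e: "e \<in> hom y y" "a = e \<cdot> c" "d = b \<cdot> e"
  then show ?thesis
    using cancel_left2[OF e(1) assms(3)] cancel_right1[OF e(1) assms(2)] inve_in[OF e(1)]
    by (intro bexI[of _ "inve e"]) simp_all
qed blast

lemma last_unfactorizable_unique: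
  assumes u: "unfactorizable C u" "u \<in> hom y z" and u': "unfactorizable C u'" "u' \<in> hom y' z"
    and b: "b \<in> hom x y" and b': "b' \<in> hom x y'" and eq: "u \<cdot> b = u' \<cdot> b'"
  shows "y' = y \<and> (\<exists>h\<in>hom y y. b' = h \<cdot> b \<and> u = u' \<cdot> h)"
proof -
  have "y' = y"
    using levi[OF b u(2) b' u'(2) eq] unfactorizableD(2)[OF u] unfactorizableD(2)[OF u']
      unfactorizableD(1)[OF u] unfactorizableD(1)[OF u'] u u' by metis
  then show ?thesis using factorization_same_object[OF b u(2), of b' u'] b' u'(2) eq by simp
qed

lemma first_unfactorizable_unique:
  assumes u: "unfactorizable C u" "u \<in> hom x y" and u': "unfactorizable C u'" "u' \<in> hom x y'"
    and b: "b \<in> hom y z" and b': "b' \<in> hom y' z" and eq: "b \<cdot> u = b' \<cdot> u'"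
  shows "y' = y \<and> (\<exists>h\<in>hom y y. u' = h \<cdot> u \<and> b = b' \<cdot> h)"
proof -
  have "y' = y"
    using levi[OF u(2) b u'(2) b' eq] unfactorizableD(2)[OF u] unfactorizableD(2)[OF u']
      unfactorizableD(1)[OF u] unfactorizableD(1)[OF u'] u u' by metis
  then show ?thesis using factorization_same_object[OF u(2) b, of u' b'] b' u'(2) eq by simp
qed

end

lemma levi_category_of_free:
  assumes "skeletal_finite_free_EI C" shows "levi_category C"
proof -
  interpret category C using assms by (simp add: skeletal_finite_free_EI_def finite_EI_category_def finite_category_def)
  interpret ei_category C
  proof
    show "finite (Mor C)"
      using assms by (simp add: skeletal_finite_free_EI_def finite_EI_category_def finite_category_def)
    show "iso_mor C f" if "x \<in> Obj C" "f \<in> Hom C x x" for x f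
      using assms that by (simp add: skeletal_finite_free_EI_def finite_EI_category_def)
    show "x = y" if "f \<in> Hom C x y" "iso_mor C f" for f x y
      using assms that dom_in cod_in unfolding skeletal_finite_free_EI_def skeletal_def Hom_def by blast
  qed
  show ?thesis
    using equidivisible assms by unfold_locales (auto simp: skeletal_finite_free_EI_def)
qed

definition op_cat :: "('o, 'm) precategory \<Rightarrow> ('o, 'm) precategory" where
  "op_cat C = C\<lparr>Dom := Cod C, Cod := Dom C, Cmp := \<lambda>g f. Cmp C f g\<rparr>"

lemma op_cat_simps [simp]:
  "Obj (op_cat C) = Obj C" "Mor (op_cat C) = Mor C" "Dom (op_cat C) = Cod C" "Cod (op_cat C) = Dom C"
  "Idt (op_cat C) = Idt C" "Cmp (op_cat C) g f = Cmp C f g"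
  by (simp_all add: op_cat_def)

lemma Hom_op_cat [simp]: "Hom (op_cat C) x y = Hom C y x"
  by (auto simp: Hom_def)

lemma inverse_mors_op_cat: "inverse_mors (op_cat C) f g \<longleftrightarrow> inverse_mors C f g"
  by (auto simp: inverse_mors_def Hom_def)

lemma iso_mor_op_cat [simp]: "iso_mor (op_cat C) f \<longleftrightarrow> iso_mor C f"
  by (simp add: iso_mor_def inverse_mors_op_cat)

lemma Aut_op_cat [simp]: "Aut (op_cat C) x = Aut C x"
  by (simp add: Aut_def)

lemma (in levi_category) levi_category_op_cat: "levi_category (op_cat C)"
proof unfold_locales
  show "\<And>f w x g y h z. \<lbrakk>f \<in> Hom (op_cat C) w x; g \<in> Hom (op_cat C) x y; h \<in> Hom (op_cat C) y z\<rbrakk>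
    \<Longrightarrow> Cmp (op_cat C) h (Cmp (op_cat C) g f) = Cmp (op_cat C) (Cmp (op_cat C) h g) f"
    using comp_assoc by auto
  show "(\<exists>e\<in>Hom (op_cat C) w y. a = Cmp (op_cat C) e c \<and> d = Cmp (op_cat C) b e)
      \<or> (\<exists>e\<in>Hom (op_cat C) y w. c = Cmp (op_cat C) e a \<and> b = Cmp (op_cat C) d e)"
    if "a \<in> Hom (op_cat C) x y" "b \<in> Hom (op_cat C) y z" "c \<in> Hom (op_cat C) x w"
      "d \<in> Hom (op_cat C) w z" "Cmp (op_cat C) b a = Cmp (op_cat C) d c" for a x y b z c w d
    using levi[of b z y a x d w c] that by auto
qed (auto simp: dom_in cod_in id_in comp_in comp_id_left comp_id_right finite_Mor endo_iso dest: iso_endo)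

section \<open>Trace weights\<close>

lemma lin_carrier_iff: "v \<in> lin_carrier B \<longleftrightarrow> (\<forall>b. b \<notin> B \<longrightarrow> v b = 0)"
  by (simp add: lin_carrier_def)

lemma bilin_ext_swap:
  assumes "\<And>s t. (t, s) \<in> D' \<longleftrightarrow> (s, t) \<in> D" "\<And>s t. p' t s = p s t"
  shows "bilin_ext D' p' b a = bilin_ext D p a b"
  unfolding bilin_ext_def
proof
  fix u
  show "(\<Sum>(s, t)\<in>{(s, t) \<in> D'. p' s t = u}. b s * a t) = (\<Sum>(s, t)\<in>{(s, t) \<in> D. p s t = u}. a s * b t)"
    by (rule sum.reindex_bij_witness[where i = "\<lambda>(s, t). (t, s)" and j = "\<lambda>(s, t). (t, s)"])
      (auto simp: assms mult.commute)
qed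

context ei_category
begin

lemma sum_left_translate:
  assumes "a \<in> hom x x" shows "(\<Sum>g\<in>hom x x. F (a \<cdot> g)) = (\<Sum>g\<in>hom x x. F g)"
  by (rule sum.reindex_bij_witness[where i = "\<lambda>g. inve a \<cdot> g" and j = "\<lambda>g. a \<cdot> g"])
    (use assms in \<open>auto simp: cancel_left1 cancel_left2 inve_in intro: comp_in\<close>)

lemma sum_inve: "(\<Sum>g\<in>hom x x. F (inve g)) = (\<Sum>g\<in>hom x x. F g)"
  by (rule sum.reindex_bij_witness[where i = inve and j = inve]) (auto simp: inve_inve inve_in)

lemma inve_comp:
  assumes "a \<in> hom x x" "b \<in> hom x x" shows "inve (a \<cdot> b) = inve b \<cdot> inve a"
proof -
  have ab: "a \<cdot> b \<in> hom x x" using comp_in assms by blast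
  have "inve b \<cdot> inve a = (inve b \<cdot> inve a) \<cdot> ((a \<cdot> b) \<cdot> inve (a \<cdot> b))"
    using inve_right[OF ab] comp_id_right[OF comp_in] assms inve_in by metis
  also have "\<dots> = ((inve b \<cdot> inve a) \<cdot> (a \<cdot> b)) \<cdot> inve (a \<cdot> b)"
    using assms ab comp_assoc comp_in inve_in by metis
  also have "(inve b \<cdot> inve a) \<cdot> (a \<cdot> b) = inve b \<cdot> (inve a \<cdot> (a \<cdot> b))"
    using comp_assoc[OF ab inve_in[OF assms(1)] inve_in[OF assms(2)]] by simp
  also have "\<dots> = Idt C x" using cancel_left2 inve_left assms by simp
  also have "Idt C x \<cdot> inve (a \<cdot> b) = inve (a \<cdot> b)" using comp_id_left inve_in ab by blast
  finally show ?thesis by simp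
qed

lemma bilin_ext_group_left:
  fixes a v :: "'m \<Rightarrow> 'k::field"
  assumes "\<gamma> \<in> hom x y"
  shows "bilin_ext (hom y y \<times> hom x y) (Cmp C) a v \<gamma> = (\<Sum>b\<in>hom y y. a b * v (inve b \<cdot> \<gamma>))"
  unfolding bilin_ext_def
  by (rule sum.reindex_bij_witness[where i = "\<lambda>b. (b, inve b \<cdot> \<gamma>)" and j = fst])
    (use assms in \<open>auto simp: cancel_left1 cancel_left2 inve_in intro: comp_in\<close>)

end

lemma basis_vec_inj: "(basis_vec a :: 'b \<Rightarrow> 'k::field) = basis_vec b \<longleftrightarrow> a = b"
  by (metis basis_vec_def zero_neq_one)

text \<open>Higman's criterion.  Lift the identity of \<open>kHom(x, y)\<close> to the free module on the set
  \<open>Hom(x, y)\<close>, and let \<open>lam a\<close> be the coefficient of \<open>1 \<cdot> [a]\<close> in the lift of \<open>a\<close>.  By equivariance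
  \<open>lam (g a)\<close> is the coefficient of \<open>g\<^sup>-\<^sup>1 \<cdot> [g a]\<close> in the lift of \<open>a\<close>, and these are the terms that the
  projection sends to \<open>a\<close>.\<close>

lemma (in ei_category) left_weights_exist:
  assumes y: "y \<in> Obj C"
    and proj: "projective_module (group_algebra (aut_group C y) :: ('k::field, 'm \<Rightarrow> 'k) module) (hom_left_module C x y)"
  shows "\<exists>lam :: 'm \<Rightarrow> 'k. \<forall>a\<in>hom x y. (\<Sum>g\<in>hom y y. lam (g \<cdot> a)) = 1"
proof -
  let ?G = "hom y y" and ?H = "hom x y"
  define A where "A = (group_algebra (aut_group C y) :: ('k, 'm \<Rightarrow> 'k) module)"
  define P where "P = (hom_left_module C x y :: ('m \<Rightarrow> 'k, 'm \<Rightarrow> 'k) module)"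
  have A: "carrier A = lin_carrier ?G" "zero A = (\<lambda>_. 0)" "one A = basis_vec (Idt C y)"
    "add A = (\<lambda>a b f. a f + b f)"
    "\<And>a c s. s \<in> ?G \<Longrightarrow> (a \<otimes>\<^bsub>A\<^esub> c) s = (\<Sum>b\<in>?G. a b * c (inve b \<cdot> s))"
    using y by (simp_all add: A_def group_algebra_def aut_group_def Aut_eq bilin_ext_group_left)
  have P: "carrier P = lin_carrier ?H" "zero P = (\<lambda>_. 0)" "add P = (\<lambda>a b f. a f + b f)"
    "\<And>a v s. s \<in> ?H \<Longrightarrow> (a \<odot>\<^bsub>P\<^esub> v) s = (\<Sum>b\<in>?G. a b * v (inve b \<cdot> s))"
    using y by (simp_all add: P_def hom_left_module_def Aut_eq bilin_ext_group_left)
  have lmP: "left_module A P"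
    using proj by (simp add: projective_module_def A_def P_def)
  interpret P: left_module A P by (rule lmP)
  \<comment> \<open>the free module: families of group algebra elements, indexed by the basis vectors of \<open>P\<close>\<close>
  define M :: "('m \<Rightarrow> 'k, ('m \<Rightarrow> 'k) \<Rightarrow> 'm \<Rightarrow> 'k) module" where "M = \<lparr>carrier = {\<Phi> :: ('m \<Rightarrow> 'k) \<Rightarrow> 'm \<Rightarrow> 'k. (\<forall>p. \<Phi> p \<in> carrier A) \<and> (\<forall>p. p \<notin> basis_vec ` ?H \<longrightarrow> \<Phi> p = (\<lambda>_. 0))},
     monoid.mult = undefined, one = undefined, zero = (\<lambda>p f. 0),
     add = (\<lambda>\<Phi> \<Psi> p f. \<Phi> p f + \<Psi> p f), smult = (\<lambda>a \<Phi> p. a \<otimes>\<^bsub>A\<^esub> \<Phi> p)\<rparr> "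
  have M: "carrier M = {\<Phi> :: ('m \<Rightarrow> 'k) \<Rightarrow> 'm \<Rightarrow> 'k. (\<forall>p. \<Phi> p \<in> carrier A) \<and> (\<forall>p. p \<notin> basis_vec ` ?H \<longrightarrow> \<Phi> p = \<zero>\<^bsub>A\<^esub>)}"
    "zero M = (\<lambda>p. \<zero>\<^bsub>A\<^esub>)" "add M = (\<lambda>\<Phi> \<Psi> p. \<Phi> p \<oplus>\<^bsub>A\<^esub> \<Psi> p)" "smult M = (\<lambda>a \<Phi> p. a \<otimes>\<^bsub>A\<^esub> \<Phi> p)"
    by (simp_all add: M_def A)
  have lmM: "left_module A M"
  proof (intro left_module.intro left_module_axioms.intro)
    show "abelian_group M"
    proof (rule abelian_groupI)
      fix \<Phi> assume "\<Phi> \<in> carrier M"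
      then show "\<exists>\<Psi>\<in>carrier M. \<Psi> \<oplus>\<^bsub>M\<^esub> \<Phi> = \<zero>\<^bsub>M\<^esub>"
        by (intro bexI[of _ "\<lambda>p. \<ominus>\<^bsub>A\<^esub> \<Phi> p"]) (auto simp: M P.R.l_neg)
    qed (auto simp: M P.R.a_ac)
  qed (auto simp: M P.R.l_distr P.R.r_distr P.R.m_assoc P.R.ring_axioms)
  \<comment> \<open>the projection \<open>s [a] \<mapsto> s a\<close>; the coefficient at \<open>\<gamma>\<close> collects the pairs with \<open>a = s\<^sup>-\<^sup>1 \<gamma>\<close>\<close>
  define g where "g = (\<lambda>\<Phi>\<in>carrier M. \<lambda>\<gamma>. if \<gamma> \<in> ?H then \<Sum>s\<in>?G. \<Phi> (basis_vec (inve s \<cdot> \<gamma>)) s else 0)"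
  have gH: "g \<Phi> \<gamma> = (\<Sum>s\<in>?G. \<Phi> (basis_vec (inve s \<cdot> \<gamma>)) s)" if "\<Phi> \<in> carrier M" "\<gamma> \<in> ?H" for \<Phi> \<gamma>
    using that by (simp add: g_def)
  have gc: "g \<Phi> \<in> carrier P" if "\<Phi> \<in> carrier M" for \<Phi>
    using that by (simp add: g_def P lin_carrier_iff)
  have eqP: "v = w" if "v \<in> carrier P" "w \<in> carrier P" "\<And>\<gamma>. \<gamma> \<in> ?H \<Longrightarrow> v \<gamma> = w \<gamma>" for v w
    using that by (metis P(1) ext lin_carrier_iff)
  have ghom: "g \<in> module_hom A M P"
  proof (rule module_homI)
    fix \<Phi> \<Psi> assume \<Phi>: "\<Phi> \<in> carrier M" and \<Psi>: "\<Psi> \<in> carrier M"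
    interpret M: left_module A M by (rule lmM)
    show "g (\<Phi> \<oplus>\<^bsub>M\<^esub> \<Psi>) = g \<Phi> \<oplus>\<^bsub>P\<^esub> g \<Psi>"
    proof (rule eqP)
      fix \<gamma> assume \<gamma>: "\<gamma> \<in> ?H"
      show "g (\<Phi> \<oplus>\<^bsub>M\<^esub> \<Psi>) \<gamma> = (g \<Phi> \<oplus>\<^bsub>P\<^esub> g \<Psi>) \<gamma>"
        unfolding gH[OF M.M.a_closed[OF \<Phi> \<Psi>] \<gamma>]
        by (simp add: P gH[OF \<Phi> \<gamma>] gH[OF \<Psi> \<gamma>] M(3) A(4) sum.distrib)
    qed (use gc \<Phi> \<Psi> in auto)
  next
    fix a \<Phi> assume a: "a \<in> carrier A" and \<Phi>: "\<Phi> \<in> carrier M"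
    interpret M: left_module A M by (rule lmM)
    show "g (a \<odot>\<^bsub>M\<^esub> \<Phi>) = a \<odot>\<^bsub>P\<^esub> g \<Phi>"
    proof (rule eqP)
      fix \<gamma> assume \<gamma>: "\<gamma> \<in> ?H"
      have "g (a \<odot>\<^bsub>M\<^esub> \<Phi>) \<gamma> = (\<Sum>s\<in>?G. \<Sum>b\<in>?G. a b * \<Phi> (basis_vec (inve s \<cdot> \<gamma>)) (inve b \<cdot> s))"
        unfolding gH[OF M.smult_closed[OF a \<Phi>] \<gamma>] by (intro sum.cong) (simp_all add: M(4) A(5))
      also have "\<dots> = (\<Sum>b\<in>?G. \<Sum>s\<in>?G. a b * \<Phi> (basis_vec (inve s \<cdot> \<gamma>)) (inve b \<cdot> s))"
        by (rule sum.swap)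
      also have "\<dots> = (\<Sum>b\<in>?G. \<Sum>s\<in>?G. a b * \<Phi> (basis_vec (inve (b \<cdot> s) \<cdot> \<gamma>)) (inve b \<cdot> (b \<cdot> s)))"
        by (intro sum.cong refl sum_left_translate[symmetric])
      also have "\<dots> = (\<Sum>b\<in>?G. \<Sum>s\<in>?G. a b * \<Phi> (basis_vec (inve s \<cdot> (inve b \<cdot> \<gamma>))) s)"
      proof (intro sum.cong refl)
        fix b s assume bs: "b \<in> ?G" "s \<in> ?G"
        have "inve (b \<cdot> s) \<cdot> \<gamma> = inve s \<cdot> (inve b \<cdot> \<gamma>)"
          unfolding inve_comp[OF bs] using comp_assoc[OF \<gamma> inve_in[OF bs(1)] inve_in[OF bs(2)]] by simp
        then show "a b * \<Phi> (basis_vec (inve (b \<cdot> s) \<cdot> \<gamma>)) (inve b \<cdot> (b \<cdot> s))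
          = a b * \<Phi> (basis_vec (inve s \<cdot> (inve b \<cdot> \<gamma>))) s"
          using cancel_left2[OF bs] by simp
      qed
      also have "\<dots> = (a \<odot>\<^bsub>P\<^esub> g \<Phi>) \<gamma>"
        unfolding P(4)[OF \<gamma>] sum_distrib_left[symmetric]
        by (intro sum.cong refl) (simp add: gH[OF \<Phi>] comp_in[OF \<gamma>] inve_in)
      finally show "g (a \<odot>\<^bsub>M\<^esub> \<Phi>) \<gamma> = (a \<odot>\<^bsub>P\<^esub> g \<Phi>) \<gamma>" .
    qed (use gc a \<Phi> M.smult_closed P.smult_closed in auto)
  qed (use gc in \<open>auto simp: g_def\<close>)
  have gsurj: "g ` carrier M = carrier P"
  proof
    show "carrier P \<subseteq> g ` carrier M"
    proof
      fix v assume v: "v \<in> carrier P"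
      define \<Phi> where "\<Phi> p = (if p \<in> basis_vec ` ?H then (\<lambda>s. if s = Idt C y then v (inv_into ?H basis_vec p) else 0) else \<zero>\<^bsub>A\<^esub>)" for p :: "'m \<Rightarrow> 'k"
      have \<Phi>: "\<Phi> \<in> carrier M"
        using id_in[OF y] by (auto simp: M \<Phi>_def A lin_carrier_iff)
      have inj: "inj_on (basis_vec :: _ \<Rightarrow> 'm \<Rightarrow> 'k) ?H" by (simp add: inj_on_def basis_vec_inj)
      have "g \<Phi> = v"
      proof (rule eqP[OF gc[OF \<Phi>] v])
        fix \<gamma> assume \<gamma>: "\<gamma> \<in> ?H"
        have "g \<Phi> \<gamma> = (\<Sum>s\<in>?G. if s = Idt C y then v (inve s \<cdot> \<gamma>) else 0)"
          unfolding gH[OF \<Phi> \<gamma>]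
        proof (intro sum.cong refl)
          fix s assume s: "s \<in> ?G"
          have "inve s \<cdot> \<gamma> \<in> ?H" using comp_in[OF \<gamma> inve_in[OF s]] .
          then show "\<Phi> (basis_vec (inve s \<cdot> \<gamma>)) s = (if s = Idt C y then v (inve s \<cdot> \<gamma>) else 0)"
            using inv_into_f_f[OF inj, of "inve s \<cdot> \<gamma>"] by (auto simp: \<Phi>_def)
        qed
        also have "\<dots> = v \<gamma>" using id_in[OF y] inve_Idt[OF y] comp_id_left[OF \<gamma>] by (simp add: sum.delta)
        finally show "g \<Phi> \<gamma> = v \<gamma>" .
      qed
      then show "v \<in> g ` carrier M" using \<Phi> by blast
    qed
  qed (use gc in blast)
  have idP: "(\<lambda>p\<in>carrier P. p) \<in> module_hom A P P"
    by (rule module_homI) (auto simp: P.M.a_closed P.smult_closed)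
  obtain h where h: "h \<in> module_hom A P M" and gh: "\<And>p. p \<in> carrier P \<Longrightarrow> g (h p) = p"
    using proj[unfolded projective_module_def, THEN conjunct2, rule_format, folded A_def P_def, of M P g "\<lambda>p\<in>carrier P. p"]
      lmM lmP ghom gsurj idP by auto
  define lam where "lam \<alpha> = h (basis_vec \<alpha>) (basis_vec \<alpha>) (Idt C y)" for \<alpha>
  have bP: "basis_vec \<alpha> \<in> carrier P" if "\<alpha> \<in> ?H" for \<alpha> using that by (auto simp: P lin_carrier_iff basis_vec_def)
  have bA: "basis_vec b \<in> carrier A" if "b \<in> ?G" for b using that by (auto simp: A lin_carrier_iff basis_vec_def)
  have "(\<Sum>b\<in>?G. lam (b \<cdot> \<alpha>)) = 1" if \<alpha>: "\<alpha> \<in> ?H" for \<alpha>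
  proof -
    have lam: "lam (b \<cdot> \<alpha>) = h (basis_vec \<alpha>) (basis_vec (b \<cdot> \<alpha>)) (inve b)" if b: "b \<in> ?G" for b
    proof -
      have "basis_vec (b \<cdot> \<alpha>) = basis_vec b \<odot>\<^bsub>P\<^esub> basis_vec \<alpha>"
      proof (rule eqP[OF bP[OF comp_in[OF \<alpha> b]] P.smult_closed[OF bA[OF b] bP[OF \<alpha>]]])
        fix \<gamma> assume \<gamma>: "\<gamma> \<in> ?H"
        have "(basis_vec b \<odot>\<^bsub>P\<^esub> basis_vec \<alpha>) \<gamma> = (\<Sum>b'\<in>?G. if b' = b then basis_vec \<alpha> (inve b' \<cdot> \<gamma>) else 0)"
          unfolding P(4)[OF \<gamma>] by (intro sum.cong) (auto simp: basis_vec_def)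
        also have "\<dots> = basis_vec \<alpha> (inve b \<cdot> \<gamma>)" using b by (simp add: sum.delta)
        also have "\<dots> = basis_vec (b \<cdot> \<alpha>) \<gamma>"
          using cancel_left1[OF b \<gamma>] cancel_left2[OF b \<alpha>] by (auto simp: basis_vec_def)
        finally show "basis_vec (b \<cdot> \<alpha>) \<gamma> = (basis_vec b \<odot>\<^bsub>P\<^esub> basis_vec \<alpha>) \<gamma>" by simp
      qed
      then have "h (basis_vec (b \<cdot> \<alpha>)) = basis_vec b \<odot>\<^bsub>M\<^esub> h (basis_vec \<alpha>)"
        using module_homD(4)[OF h bA[OF b] bP[OF \<alpha>]] by simp
      then have "lam (b \<cdot> \<alpha>) = (basis_vec b \<otimes>\<^bsub>A\<^esub> h (basis_vec \<alpha>) (basis_vec (b \<cdot> \<alpha>))) (Idt C y)"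
        by (simp add: lam_def M(4))
      also have "\<dots> = (\<Sum>b'\<in>?G. if b' = b then h (basis_vec \<alpha>) (basis_vec (b \<cdot> \<alpha>)) (inve b' \<cdot> Idt C y) else 0)"
        unfolding A(5)[OF id_in[OF y]] by (intro sum.cong) (auto simp: basis_vec_def)
      also have "\<dots> = h (basis_vec \<alpha>) (basis_vec (b \<cdot> \<alpha>)) (inve b)"
        using b comp_id_right[OF inve_in[OF b]] by (simp add: sum.delta)
      finally show ?thesis .
    qed
    have "(\<Sum>b\<in>?G. lam (b \<cdot> \<alpha>)) = (\<Sum>b\<in>?G. h (basis_vec \<alpha>) (basis_vec (inve (inve b) \<cdot> \<alpha>)) (inve b))"
      by (intro sum.cong refl) (simp add: lam inve_inve)
    also have "\<dots> = (\<Sum>b\<in>?G. h (basis_vec \<alpha>) (basis_vec (inve b \<cdot> \<alpha>)) b)"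
      by (rule sum_inve[of "\<lambda>b. h (basis_vec \<alpha>) (basis_vec (inve b \<cdot> \<alpha>)) b"])
    also have "\<dots> = g (h (basis_vec \<alpha>)) \<alpha>"
      using gH[OF module_homD(1)[OF h bP[OF \<alpha>]] \<alpha>] by simp
    also have "\<dots> = 1" using gh[OF bP[OF \<alpha>]] by (simp add: basis_vec_def)
    finally show ?thesis .
  qed
  then show ?thesis by blast
qed

lemma aut_group_op_cat:
  "group_algebra (aut_group (op_cat C) x) = op_ring (group_algebra (aut_group C x) :: ('k::field, 'm \<Rightarrow> 'k) module)"
proof -
  have "bilin_ext (Aut C x \<times> Aut C x) (Cmp (op_cat C)) a b = bilin_ext (Aut C x \<times> Aut C x) (Cmp C) b a"
    for a b :: "'m \<Rightarrow> 'k"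
    by (rule bilin_ext_swap) auto
  then show ?thesis
    by (simp add: group_algebra_def aut_group_def op_ring_def fun_eq_iff)
qed

lemma hom_module_op_cat:
  "hom_left_module (op_cat C) y x = (hom_right_module C x y :: ('m \<Rightarrow> 'k::field, 'm \<Rightarrow> 'k) module)"
proof -
  have "bilin_ext (Aut C x \<times> Hom C x y) (Cmp (op_cat C)) a v = bilin_ext (Hom C x y \<times> Aut C x) (Cmp C) v a"
    for a v :: "'m \<Rightarrow> 'k"
    by (rule bilin_ext_swap) auto
  then show ?thesis
    by (simp add: hom_left_module_def hom_right_module_def fun_eq_iff)
qed

text \<open>If \<open>|G\<^sub>y|\<close> is invertible, the constant \<open>1 / |G\<^sub>y|\<close> is a left weight; in general a weight can be
  concentrated on orbit representatives, with the inverse order of the stabilizer as its value.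
  Passing to the opposite category exchanges the two weights.\<close>

locale weighted_category = levi_category C for C :: "('o, 'm) precategory" +
  fixes lam rho :: "'m \<Rightarrow> 'k::field"
  assumes left_weight: "a \<in> Hom C x y \<Longrightarrow> (\<Sum>g\<in>Hom C y y. lam (Cmp C g a)) = 1"
    and right_weight: "a \<in> Hom C x y \<Longrightarrow> (\<Sum>g\<in>Hom C x x. rho (Cmp C a g)) = 1"

lemma (in weighted_category) weighted_category_op_cat: "weighted_category (op_cat C) rho lam"
proof -
  interpret op: levi_category "op_cat C" by (rule levi_category_op_cat)
  show ?thesis by unfold_locales (auto simp: left_weight right_weight)
qed

lemma weighted_category_of_projective:
  assumes "skeletal_finite_free_EI C" "projective_over TYPE('k::field) C"
  shows "\<exists>lam rho :: 'm \<Rightarrow> 'k. weighted_category (C :: ('o, 'm) precategory) lam rho"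
proof -
  interpret levi_category C by (rule levi_category_of_free[OF assms(1)])
  interpret op: levi_category "op_cat C" by (rule levi_category_op_cat)
  have "\<forall>x y. \<exists>lam :: 'm \<Rightarrow> 'k. \<forall>a\<in>Hom C x y. (\<Sum>g\<in>Hom C y y. lam (Cmp C g a)) = 1"
  proof (intro allI)
    fix x y
    show "\<exists>lam :: 'm \<Rightarrow> 'k. \<forall>a\<in>Hom C x y. (\<Sum>g\<in>Hom C y y. lam (Cmp C g a)) = 1"
    proof (cases "x \<in> Obj C \<and> y \<in> Obj C")
      case True then show ?thesis using left_weights_exist[where 'k = 'k] assms(2) by (simp add: projective_over_def)
    qed (use HomD in blast)
  qed
  then obtain l :: "'o \<Rightarrow> 'o \<Rightarrow> 'm \<Rightarrow> 'k"
    where l: "\<And>x y a. a \<in> Hom C x y \<Longrightarrow> (\<Sum>g\<in>Hom C y y. l x y (Cmp C g a)) = 1" by metis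
  have "\<forall>x y. \<exists>rho :: 'm \<Rightarrow> 'k. \<forall>a\<in>Hom C x y. (\<Sum>g\<in>Hom C x x. rho (Cmp C a g)) = 1"
  proof (intro allI)
    fix x y
    show "\<exists>rho :: 'm \<Rightarrow> 'k. \<forall>a\<in>Hom C x y. (\<Sum>g\<in>Hom C x x. rho (Cmp C a g)) = 1"
    proof (cases "x \<in> Obj C \<and> y \<in> Obj C")
      case True then show ?thesis
        using op.left_weights_exist[where 'k = 'k, of x y] assms(2)
        by (simp add: projective_over_def aut_group_op_cat hom_module_op_cat)
    qed (use HomD in blast)
  qed
  then obtain r :: "'o \<Rightarrow> 'o \<Rightarrow> 'm \<Rightarrow> 'k"
    where r: "\<And>x y a. a \<in> Hom C x y \<Longrightarrow> (\<Sum>g\<in>Hom C x x. r x y (Cmp C a g)) = 1" by metis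
  have "weighted_category C (\<lambda>a. l (Dom C a) (Cod C a) a) (\<lambda>a. r (Dom C a) (Cod C a) a)"
  proof unfold_locales
    fix a x y assume a: "a \<in> Hom C x y"
    have "(\<Sum>g\<in>Hom C y y. l (Dom C (Cmp C g a)) (Cod C (Cmp C g a)) (Cmp C g a))
        = (\<Sum>g\<in>Hom C y y. l x y (Cmp C g a))"
      by (intro sum.cong refl) (simp only: HomD(2,3)[OF comp_in[OF a]])
    then show "(\<Sum>g\<in>Hom C y y. l (Dom C (Cmp C g a)) (Cod C (Cmp C g a)) (Cmp C g a)) = 1" using l[OF a] by simp
    have "(\<Sum>g\<in>Hom C x x. r (Dom C (Cmp C a g)) (Cod C (Cmp C a g)) (Cmp C a g))
        = (\<Sum>g\<in>Hom C x x. r x y (Cmp C a g))"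
      by (intro sum.cong refl) (simp only: HomD(2,3)[OF comp_in[OF _ a]])
    then show "(\<Sum>g\<in>Hom C x x. r (Dom C (Cmp C a g)) (Cod C (Cmp C a g)) (Cmp C a g)) = 1" using r[OF a] by simp
  qed
  then show ?thesis by blast
qed

section \<open>Extension of homomorphisms\<close>

text \<open>A linear relation in which \<open>0\<close> is related to \<open>0\<close> only is the graph of a linear map on a subspace;
  precomposing with a projection onto that subspace defines it everywhere.\<close>

lemma (in vector_space_pair) linear_extension_of_relation:
  assumes add: "\<And>v w v' w'. R v w \<Longrightarrow> R v' w' \<Longrightarrow> R (v + v') (w + w')"
    and scale: "\<And>c v w. R v w \<Longrightarrow> R (s1 c v) (s2 c w)"
    and zero: "R 0 0" and uniq: "\<And>w. R 0 w \<Longrightarrow> w = 0"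
  shows "\<exists>g. Vector_Spaces.linear s1 s2 g \<and> (\<forall>v w. R v w \<longrightarrow> g v = w)"
proof -
  interpret p11: vector_space_pair s1 s1 by unfold_locales
  let ?V = "{v. \<exists>w. R v w}"
  have V: "vs1.subspace ?V"
    using add scale zero unfolding vs1.subspace_def by blast
  have "Vector_Spaces.linear s1 s1 (\<lambda>x. x)" by unfold_locales simp_all
  from p11.linear_exists_left_inverse_on[OF this V]
  obtain \<pi> where \<pi>: "\<pi> ` UNIV \<subseteq> ?V" "Vector_Spaces.linear s1 s1 \<pi>" "\<And>v. v \<in> ?V \<Longrightarrow> \<pi> v = v" by auto
  interpret \<pi>: linear s1 s1 \<pi> by (rule \<pi>(2))
  have unique: "w = w'" if "R v w" "R v w'" for v w w'
  proof -
    have "R (v + s1 (-1) v) (w + s2 (-1) w')" using add scale that by blast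
    then show ?thesis using uniq[of "w - w'"] by simp
  qed
  define g where "g v = (THE w. R (\<pi> v) w)" for v
  have g: "R (\<pi> v) (g v)" for v
  proof -
    obtain w where "R (\<pi> v) w" using \<pi>(1) by auto
    then show ?thesis unfolding g_def using unique by (blast intro: theI)
  qed
  have "Vector_Spaces.linear s1 s2 g"
  proof
    show "g (x + y) = g x + g y" for x y
      using unique[OF g[of "x + y"]] add[OF g[of x] g[of y]] by (simp add: \<pi>.add)
    show "g (s1 c x) = s2 c (g x)" for c x
      using unique[OF g[of "s1 c x"]] scale[OF g[of x]] by (simp add: \<pi>.scale)
  qed
  moreover have "g v = w" if "R v w" for v w
  proof -
    have "\<pi> v = v" using \<pi>(3)[of v] that by blast
    then show ?thesis using unique[OF g[of v], of w] that by simp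
  qed
  ultimately show ?thesis by blast
qed

text \<open>The identities are not required to add up to the identity map.  The category may thus act by zero on
  a part of the space, such as the functions supported outside the set of morphisms.\<close>

locale category_rep = ei_category C + vector_space scale
  for C :: "('o, 'm) precategory" and scale :: "'k::field \<Rightarrow> 'v::ab_group_add \<Rightarrow> 'v" +
  fixes act :: "'m \<Rightarrow> 'v \<Rightarrow> 'v"
  assumes act_add: "a \<in> Mor C \<Longrightarrow> act a (v + w) = act a v + act a w"
    and act_scale: "a \<in> Mor C \<Longrightarrow> act a (scale c v) = scale c (act a v)"
    and act_comp: "\<lbrakk>a \<in> Hom C x y; b \<in> Hom C y z\<rbrakk> \<Longrightarrow> act (Cmp C b a) v = act b (act a v)"
    and act_noncomp: "\<lbrakk>a \<in> Mor C; b \<in> Mor C; Cod C a \<noteq> Dom C b\<rbrakk> \<Longrightarrow> act b (act a v) = 0"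
begin

lemma act_0: "a \<in> Mor C \<Longrightarrow> act a 0 = 0"
  using act_scale[of a 0 0] by simp

lemma act_sum: "a \<in> Mor C \<Longrightarrow> act a (\<Sum>i\<in>I. v i) = (\<Sum>i\<in>I. act a (v i))"
  by (induction I rule: infinite_finite_induct) (simp_all add: act_0 act_add)

lemma act_Idt_left: "a \<in> Hom C x y \<Longrightarrow> act (Idt C y) (act a v) = act a v"
  using act_comp[of a x y "Idt C y" y v] id_in HomD(5) comp_id_left by metis

lemma act_Idt_right: "a \<in> Hom C x y \<Longrightarrow> act a (act (Idt C x) v) = act a v"
  using act_comp[of "Idt C x" x x a y v] id_in HomD(4) comp_id_right by metis

end

definition unfactorizable_into :: "('o, 'm) precategory \<Rightarrow> 'o \<Rightarrow> 'm set" where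
  "unfactorizable_into C y = {u. unfactorizable C u \<and> Cod C u = y}"

text \<open>An element \<open>\<Sum>\<^sub>u u \<otimes> m u\<close> of \<open>U \<otimes>\<^sub>S M\<close>, with \<open>U\<close> spanned by the unfactorizable morphisms, vanishes if
  and only if its orbit sums \<open>\<Sum>\<^sub>g g \<cdot> m (u g)\<close> do, provided that the orders of the stabilizers are
  invertible.  So the condition expresses the injectivity of \<open>U \<otimes>\<^sub>S M \<rightarrow> M\<close>.  In this form it is
  inherited by submodules for trivial reasons.\<close>

definition (in category_rep) rad_free :: bool where
  "rad_free \<longleftrightarrow> (\<forall>y\<in>Obj C. \<forall>m. (\<Sum>u\<in>unfactorizable_into C y. act u (m u)) = 0
     \<longrightarrow> (\<forall>u\<in>unfactorizable_into C y. (\<Sum>g\<in>Hom C (Dom C u) (Dom C u). act g (m (Cmp C u g))) = 0))"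

context weighted_category
begin

lemma unfactorizable_intoD:
  assumes "u \<in> unfactorizable_into C y"
  shows "unfactorizable C u" "u \<in> Mor C" "u \<in> hom (Dom C u) y" "Dom C u \<noteq> y"
  using assms Mor_hom by (auto simp: unfactorizable_into_def unfactorizable_def iso_iff)

lemma finite_unfactorizable_into [simp]: "finite (unfactorizable_into C y)"
  by (rule finite_subset[OF _ finite_Mor]) (auto simp: unfactorizable_into_def unfactorizable_def)

text \<open>The coefficient of \<open>u \<cdot> l u\<close> on the right is the sum of \<open>rho\<close> over the orbit of \<open>u\<close>, which is \<open>1\<close>.
  Consequently the sum depends only on the orbit sums of \<open>l\<close>.\<close>

lemma sum_unfactorizable_weighted:
  assumes rep: "category_rep C scale act"
  shows "(\<Sum>u\<in>unfactorizable_into C y. act u (l u))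
    = (\<Sum>u\<in>unfactorizable_into C y. scale (rho u) (act u (\<Sum>g\<in>hom (Dom C u) (Dom C u). act g (l (u \<cdot> g)))))"
proof -
  interpret category_rep C scale act by (rule rep)
  let ?U = "unfactorizable_into C y"
  have "(\<Sum>u\<in>?U. scale (rho u) (act u (\<Sum>g\<in>hom (Dom C u) (Dom C u). act g (l (u \<cdot> g)))))
      = (\<Sum>u\<in>?U. \<Sum>g\<in>hom (Dom C u) (Dom C u). scale (rho u) (act (u \<cdot> g) (l (u \<cdot> g))))"
  proof (rule sum.cong[OF refl])
    fix u assume u: "u \<in> ?U"
    show "scale (rho u) (act u (\<Sum>g\<in>hom (Dom C u) (Dom C u). act g (l (u \<cdot> g))))
      = (\<Sum>g\<in>hom (Dom C u) (Dom C u). scale (rho u) (act (u \<cdot> g) (l (u \<cdot> g))))"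
      using unfactorizable_intoD[OF u]
      by (simp add: act_sum scale_sum_right act_comp)
  qed
  also have "\<dots> = (\<Sum>(u, g)\<in>Sigma ?U (\<lambda>u. hom (Dom C u) (Dom C u)). scale (rho u) (act (u \<cdot> g) (l (u \<cdot> g))))"
    by (rule sum.Sigma) simp_all
  also have "\<dots> = (\<Sum>(u, g)\<in>Sigma ?U (\<lambda>u. hom (Dom C u) (Dom C u)). scale (rho (u \<cdot> g)) (act u (l u)))"
  proof -
    let ?S = "Sigma ?U (\<lambda>u. hom (Dom C u) (Dom C u))" and ?j = "\<lambda>(u, g). (u \<cdot> g, inve g)"
    have j: "?j ug \<in> ?S \<and> ?j (?j ug) = ug" if ug': "ug \<in> ?S" for ug
    proof -
      obtain u g where ug: "ug = (u, g)" "u \<in> ?U" "g \<in> hom (Dom C u) (Dom C u)" using ug' by auto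
      note u = unfactorizable_intoD[OF ug(2)]
      have h: "u \<cdot> g \<in> hom (Dom C u) y" using comp_in[OF ug(3) u(3)] .
      have "u \<cdot> g \<in> ?U"
        using unfactorizable_comp_iso[OF u(1,3) ug(3)] HomD(3)[OF h] by (simp add: unfactorizable_into_def)
      then show ?thesis
        using ug inve_in[OF ug(3)] HomD(2)[OF h] cancel_right1[OF ug(3) u(3)] inve_inve[OF ug(3)] by simp
    qed
    \<comment> \<open>\<open>(u, g) \<mapsto> (u g, g\<^sup>-\<^sup>1)\<close> is an involution\<close>
    show ?thesis
    proof (rule sum.reindex_bij_witness[where i = ?j and j = ?j])
      fix ug assume "ug \<in> ?S"
      then obtain u g where ug: "ug = (u, g)" "u \<in> ?U" "g \<in> hom (Dom C u) (Dom C u)" by auto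
      show "(case ?j ug of (u, g) \<Rightarrow> scale (rho (u \<cdot> g)) (act u (l u)))
        = (case ug of (u, g) \<Rightarrow> scale (rho u) (act (u \<cdot> g) (l (u \<cdot> g))))"
        using ug cancel_right1[OF ug(3) unfactorizable_intoD(3)[OF ug(2)]] by simp
    qed (use j in blast)+
  qed
  also have "\<dots> = (\<Sum>u\<in>?U. \<Sum>g\<in>hom (Dom C u) (Dom C u). scale (rho (u \<cdot> g)) (act u (l u)))"
    by (rule sum.Sigma[symmetric]) simp_all
  also have "\<dots> = (\<Sum>u\<in>?U. act u (l u))"
    using right_weight[OF unfactorizable_intoD(3)] by (intro sum.cong refl) (simp flip: scale_sum_left)
  finally show ?thesis by simp
qed

text \<open>The map \<open>g\<close> is the component at \<open>y\<close> of an equivariant extension of \<open>f\<close> from \<open>K\<close>, relative to given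
  components \<open>F x\<close> at the objects \<open>x\<close> below \<open>y\<close>.\<close>

definition extends_at ::
  "'o \<Rightarrow> ('k \<Rightarrow> 'v::ab_group_add \<Rightarrow> 'v) \<Rightarrow> ('m \<Rightarrow> 'v \<Rightarrow> 'v) \<Rightarrow> ('k \<Rightarrow> 'w::ab_group_add \<Rightarrow> 'w) \<Rightarrow> ('m \<Rightarrow> 'w \<Rightarrow> 'w)
    \<Rightarrow> 'v set \<Rightarrow> ('v \<Rightarrow> 'w) \<Rightarrow> ('o \<Rightarrow> 'v \<Rightarrow> 'w) \<Rightarrow> ('v \<Rightarrow> 'w) \<Rightarrow> bool" where
  "extends_at y sV aV sW aW K f F g \<longleftrightarrow> Vector_Spaces.linear sV sW g
     \<and> (\<forall>v. g (aV (Idt C y) v) = g v) \<and> (\<forall>v. aW (Idt C y) (g v) = g v)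
     \<and> (\<forall>v\<in>K. g v = aW (Idt C y) (f v))
     \<and> (\<forall>b\<in>hom y y. \<forall>v. g (aV b v) = aW b (g v))
     \<and> (\<forall>x. \<forall>a\<in>hom x y. x \<noteq> y \<longrightarrow> (\<forall>v. g (aV a v) = aW a (F x v)))"

text \<open>The values at \<open>y\<close> are forced on \<open>id\<^sub>y K\<close> and on the elements \<open>u \<cdot> l\<close>, where \<open>u\<close> is unfactorizable with
  codomain \<open>y\<close>.  Suppose that \<open>id\<^sub>y k + \<Sum>\<^sub>u u \<cdot> l u = 0\<close>.  Applying \<open>p\<close> gives a relation in \<open>Q\<close>, so by
  \<open>rad_free\<close> the orbit sums of \<open>l\<close> lie in \<open>K\<close>, where the components at the lower objects agree with \<open>f\<close>.
  As the sum depends on the orbit sums only, the forced value is \<open>f\<close> applied to the left-hand side,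
  hence zero.  A linear extension \<open>\<psi>\<close> of the forced values becomes equivariant when it is replaced by
  \<open>v \<mapsto> \<Sum>\<^sub>b b \<cdot> om (\<psi> (b\<^sup>-\<^sup>1 \<cdot> v))\<close>, and the condition on \<open>om\<close> says that the forced values are not changed.\<close>

lemma extension_step:
  fixes sV :: "'k \<Rightarrow> 'v::ab_group_add \<Rightarrow> 'v" and sQ :: "'k \<Rightarrow> 'q::ab_group_add \<Rightarrow> 'q"
    and sW :: "'k \<Rightarrow> 'w::ab_group_add \<Rightarrow> 'w"
  assumes V: "category_rep C sV aV" and Q: "category_rep C sQ aQ" and W: "category_rep C sW aW"
    and p: "Vector_Spaces.linear sV sQ p" and pa: "\<And>a v. a \<in> Mor C \<Longrightarrow> p (aV a v) = aQ a (p v)"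
    and X: "category_rep.rad_free C aQ"
    and om: "Vector_Spaces.linear sW sW om"
      "\<And>w. (\<Sum>g\<in>hom y y. aW g (om (aW (inve g) w))) = aW (Idt C y) w"
    and f: "\<And>v w. p v = 0 \<Longrightarrow> p w = 0 \<Longrightarrow> f (v + w) = f v + f w"
      "\<And>c v. p v = 0 \<Longrightarrow> f (sV c v) = sW c (f v)"
      "\<And>a v. a \<in> Mor C \<Longrightarrow> p v = 0 \<Longrightarrow> f (aV a v) = aW a (f v)"
    and y: "y \<in> Obj C"
    and F: "\<And>x. x \<in> Obj C \<Longrightarrow> rank x < rank y \<Longrightarrow> extends_at x sV aV sW aW {v. p v = 0} f F (F x)"
  shows "\<exists>g. extends_at y sV aV sW aW {v. p v = 0} f F g"
proof -
  interpret V: category_rep C sV aV by (rule V)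
  interpret Q: category_rep C sQ aQ by (rule Q)
  interpret W: category_rep C sW aW by (rule W)
  interpret VW: vector_space_pair sV sW by unfold_locales
  interpret p: linear sV sQ p by (rule p)
  interpret om: linear sW sW om by (rule om(1))
  let ?U = "unfactorizable_into C y" and ?K = "{v. p v = 0}" and ?e = "Idt C y"
  have eM: "?e \<in> Mor C" using id_in[OF y] HomD(1) by blast
  have Fx: "extends_at x sV aV sW aW ?K f F (F x)" if "u \<in> ?U" "x = Dom C u" for u x
    using F[of x] unfactorizable_intoD[OF that(1)] HomD(4) rank_less that(2) by metis
  have f0: "f 0 = 0" using f(2)[of 0 0] by simp
  have Ka: "aV a v \<in> ?K" if "a \<in> Mor C" "v \<in> ?K" for a v
    using that pa Q.act_0 by simp
  have K0: "0 \<in> ?K" by (simp add: p.zero)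
  have Kadd: "v + w \<in> ?K" if "v \<in> ?K" "w \<in> ?K" for v w using that by (simp add: p.add)
  have Kscale: "sV c v \<in> ?K" if "v \<in> ?K" for c v using that by (simp add: p.scale)
  have Ksum: "(\<Sum>i\<in>I. v i) \<in> ?K \<and> f (\<Sum>i\<in>I. v i) = (\<Sum>i\<in>I. f (v i))" if "\<And>i. i \<in> I \<Longrightarrow> v i \<in> ?K" for I :: "'m set" and v
    using that
  proof (induction I rule: infinite_finite_induct)
    case (insert i I)
    then show ?case using f(1)[of "v i" "\<Sum>i\<in>I. v i"] Kadd[of "v i" "\<Sum>i\<in>I. v i"] by simp
  qed (use f0 K0 in auto)
  \<comment> \<open>the forced values\<close>
  define R where "R v w \<longleftrightarrow> (\<exists>k l. k \<in> ?K \<and> v = aV ?e k + (\<Sum>u\<in>?U. aV u (l u))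
      \<and> w = aW ?e (f k) + (\<Sum>u\<in>?U. aW u (F (Dom C u) (l u))))" for v w
  have Flin: "Vector_Spaces.linear sV sW (F (Dom C u))" if "u \<in> ?U" for u using Fx[OF that refl] by (simp add: extends_at_def)
  have Fadd: "F (Dom C u) (v + w) = F (Dom C u) v + F (Dom C u) w"
    and Fscale: "F (Dom C u) (sV c v) = sW c (F (Dom C u) v)" if "u \<in> ?U" for u v w c
  proof -
    interpret Fu: linear sV sW "F (Dom C u)" by (rule Flin[OF that])
    show "F (Dom C u) (v + w) = F (Dom C u) v + F (Dom C u) w" by (rule Fu.add)
    show "F (Dom C u) (sV c v) = sW c (F (Dom C u) v)" by (rule Fu.scale)
  qed
  have F0: "F (Dom C u) 0 = 0" if "u \<in> ?U" for u using Fscale[OF that, of 0 0] by simp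
  have Fsum: "F (Dom C u) (\<Sum>i\<in>I. v i) = (\<Sum>i\<in>I. F (Dom C u) (v i))" if "u \<in> ?U" for u v and I :: "'m set"
    by (induction I rule: infinite_finite_induct) (simp_all add: F0[OF that] Fadd[OF that])
  have uM: "u \<in> Mor C" if "u \<in> ?U" for u using unfactorizable_intoD(2)[OF that] .
  have ex: "\<exists>\<psi>. Vector_Spaces.linear sV sW \<psi> \<and> (\<forall>v w. R v w \<longrightarrow> \<psi> v = w)"
  proof (rule VW.linear_extension_of_relation)
    fix v w v' w' assume "R v w" "R v' w'"
    then obtain k l k' l' where k: "k \<in> ?K" "v = aV ?e k + (\<Sum>u\<in>?U. aV u (l u))"
        "w = aW ?e (f k) + (\<Sum>u\<in>?U. aW u (F (Dom C u) (l u)))"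
      and k': "k' \<in> ?K" "v' = aV ?e k' + (\<Sum>u\<in>?U. aV u (l' u))"
        "w' = aW ?e (f k') + (\<Sum>u\<in>?U. aW u (F (Dom C u) (l' u)))"
      unfolding R_def by blast
    have "v + v' = aV ?e (k + k') + (\<Sum>u\<in>?U. aV u (l u + l' u))"
      unfolding k k' using uM by (simp add: V.act_add eM sum.distrib)
    moreover have "w + w' = aW ?e (f (k + k')) + (\<Sum>u\<in>?U. aW u (F (Dom C u) (l u + l' u)))"
      unfolding k k' using uM k(1) k'(1) by (simp add: W.act_add eM sum.distrib f(1) Fadd)
    ultimately show "R (v + v') (w + w')" unfolding R_def using Kadd[OF k(1) k'(1)]
      by (intro exI[of _ "k + k'"] exI[of _ "\<lambda>u. l u + l' u"]) blast
  next
    fix c v w assume "R v w"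
    then obtain k l where k: "k \<in> ?K" "v = aV ?e k + (\<Sum>u\<in>?U. aV u (l u))"
        "w = aW ?e (f k) + (\<Sum>u\<in>?U. aW u (F (Dom C u) (l u)))"
      unfolding R_def by blast
    have "sV c v = aV ?e (sV c k) + (\<Sum>u\<in>?U. aV u (sV c (l u)))"
      unfolding k using uM by (simp add: V.act_scale eM V.scale_sum_right V.scale_right_distrib)
    moreover have "sW c w = aW ?e (f (sV c k)) + (\<Sum>u\<in>?U. aW u (F (Dom C u) (sV c (l u))))"
      unfolding k using uM k(1) by (simp add: W.act_scale eM W.scale_sum_right W.scale_right_distrib f(2) Fscale)
    ultimately show "R (sV c v) (sW c w)" unfolding R_def using Kscale[OF k(1)]
      by (intro exI[of _ "sV c k"] exI[of _ "\<lambda>u. sV c (l u)"]) blast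
  next
    show "R 0 0" unfolding R_def using K0 uM
      by (intro exI[of _ 0] exI[of _ "\<lambda>u. 0"]) (simp add: V.act_0 W.act_0 eM f0 F0)
  next
    fix w assume "R 0 w"
    then obtain k l where k: "k \<in> ?K" "0 = aV ?e k + (\<Sum>u\<in>?U. aV u (l u))"
        "w = aW ?e (f k) + (\<Sum>u\<in>?U. aW u (F (Dom C u) (l u)))"
      unfolding R_def by blast
    define \<kappa> where "\<kappa> u = (\<Sum>g\<in>hom (Dom C u) (Dom C u). aV g (l (u \<cdot> g)))" for u
    have "p 0 = p (aV ?e k) + (\<Sum>u\<in>?U. p (aV u (l u)))"
      unfolding k(2) p.add p.sum ..
    then have "(\<Sum>u\<in>?U. aQ u (p (l u))) = 0"
      using k(1) uM by (simp add: pa eM p.zero Q.act_0)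
    then have "(\<Sum>g\<in>hom (Dom C u) (Dom C u). aQ g (p (l (u \<cdot> g)))) = 0" if "u \<in> ?U" for u
      using X[unfolded Q.rad_free_def, rule_format, of y "\<lambda>u. p (l u)" u] y that by simp
    then have \<kappa>: "\<kappa> u \<in> ?K" if "u \<in> ?U" for u
      using that HomD(1) by (simp add: \<kappa>_def p.sum pa)
    have lk: "(\<Sum>u\<in>?U. aV u (l u)) = (\<Sum>u\<in>?U. sV (rho u) (aV u (\<kappa> u)))"
      unfolding \<kappa>_def by (rule sum_unfactorizable_weighted[OF V])
    have F\<kappa>: "aW u (\<Sum>g\<in>hom (Dom C u) (Dom C u). aW g (F (Dom C (u \<cdot> g)) (l (u \<cdot> g)))) = aW u (f (\<kappa> u))"
      if u: "u \<in> ?U" for u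
    proof -
      note uD = unfactorizable_intoD[OF u]
      let ?x = "Dom C u"
      have x: "extends_at ?x sV aV sW aW ?K f F (F ?x)" by (rule Fx[OF u refl])
      have "(\<Sum>g\<in>hom ?x ?x. aW g (F (Dom C (u \<cdot> g)) (l (u \<cdot> g)))) = (\<Sum>g\<in>hom ?x ?x. F ?x (aV g (l (u \<cdot> g))))"
      proof (rule sum.cong[OF refl])
        fix g assume g: "g \<in> hom ?x ?x"
        have "Dom C (u \<cdot> g) = ?x" using HomD(2)[OF comp_in[OF g uD(3)]] .
        then show "aW g (F (Dom C (u \<cdot> g)) (l (u \<cdot> g))) = F ?x (aV g (l (u \<cdot> g)))"
          using x g by (simp add: extends_at_def)
      qed
      also have "\<dots> = F ?x (\<kappa> u)" unfolding \<kappa>_def Fsum[OF u] ..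
      also have "\<dots> = aW (Idt C ?x) (f (\<kappa> u))" using x \<kappa>[OF u] by (simp add: extends_at_def)
      finally show ?thesis using W.act_Idt_right[OF uD(3)] by simp
    qed
    have "(\<Sum>u\<in>?U. aW u (F (Dom C u) (l u))) = (\<Sum>u\<in>?U. sW (rho u) (aW u (f (\<kappa> u))))"
      unfolding sum_unfactorizable_weighted[OF W, of "\<lambda>u. F (Dom C u) (l u)"]
      by (intro sum.cong refl) (simp add: F\<kappa>)
    also have "\<dots> = (\<Sum>u\<in>?U. f (sV (rho u) (aV u (\<kappa> u))))"
      using \<kappa> Ka uM f(2,3) by (intro sum.cong refl) simp
    also have "\<dots> = f (\<Sum>u\<in>?U. sV (rho u) (aV u (\<kappa> u)))"
      using Ksum[of ?U "\<lambda>u. sV (rho u) (aV u (\<kappa> u))"] \<kappa> Ka uM Kscale by simp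
    finally have "w = f (aV ?e k) + f (\<Sum>u\<in>?U. aV u (l u))"
      unfolding k(3) lk using f(3)[OF eM, of k] k(1) by simp
    also have "\<dots> = f (aV ?e k + (\<Sum>u\<in>?U. aV u (l u)))"
      using f(1)[of "aV ?e k" "\<Sum>u\<in>?U. aV u (l u)"] Ka[OF eM k(1)]
        Ksum[of ?U "\<lambda>u. sV (rho u) (aV u (\<kappa> u))"] \<kappa> Ka uM Kscale unfolding lk by simp
    also have "\<dots> = 0" unfolding k(2)[symmetric] by (rule f0)
    finally show "w = 0" .
  qed
  then obtain \<psi> where \<psi>: "Vector_Spaces.linear sV sW \<psi>" "\<And>v w. R v w \<Longrightarrow> \<psi> v = w" by blast
  interpret \<psi>: linear sV sW \<psi> by (rule \<psi>(1))
  have gM: "g \<in> Mor C" "inve g \<in> Mor C" if "g \<in> hom y y" for g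
    using that inve_in HomD(1) by blast+
  define g where "g v = (\<Sum>b\<in>hom y y. aW b (om (\<psi> (aV (inve b) v))))" for v
  have Ract: "R (aV b v) (aW b w)" if b: "b \<in> hom y y" and r: "R v w" for b v w
  proof -
    have bM: "b \<in> Mor C" using b HomD(1) by blast
    obtain k l where k: "k \<in> ?K" "v = aV ?e k + (\<Sum>u\<in>?U. aV u (l u))"
        "w = aW ?e (f k) + (\<Sum>u\<in>?U. aW u (F (Dom C u) (l u)))"
      using r unfolding R_def by blast
    have re: "(\<Sum>u\<in>?U. G (b \<cdot> u) u) = (\<Sum>u\<in>?U. G u (inve b \<cdot> u))" for G :: "'m \<Rightarrow> 'm \<Rightarrow> 'z::comm_monoid_add"
    proof (rule sum.reindex_bij_witness[where i = "\<lambda>u. inve b \<cdot> u" and j = "\<lambda>u. b \<cdot> u"])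
      fix u assume u: "u \<in> ?U"
      note uD = unfactorizable_intoD[OF u]
      show "inve b \<cdot> (b \<cdot> u) = u" "b \<cdot> (inve b \<cdot> u) = u"
        using cancel_left1[OF b uD(3)] cancel_left2[OF b uD(3)] by auto
      show "b \<cdot> u \<in> ?U" "inve b \<cdot> u \<in> ?U"
        using unfactorizable_iso_comp[OF uD(1,3) b] unfactorizable_iso_comp[OF uD(1,3) inve_in[OF b]]
          HomD(3)[OF comp_in[OF uD(3) b]] HomD(3)[OF comp_in[OF uD(3) inve_in[OF b]]]
        by (auto simp: unfactorizable_into_def)
      show "G (b \<cdot> u) (inve b \<cdot> (b \<cdot> u)) = G (b \<cdot> u) u" using cancel_left2[OF b uD(3)] by simp
    qed
    have D: "Dom C (inve b \<cdot> u) = Dom C u" if "u \<in> ?U" for u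
      using HomD(2)[OF comp_in[OF unfactorizable_intoD(3)[OF that] inve_in[OF b]]] .
    have "aV b v = aV ?e (aV b k) + (\<Sum>u\<in>?U. aV (b \<cdot> u) (l u))"
      unfolding k using V.act_Idt_left[OF b] V.act_Idt_right[OF b]
      by (simp add: V.act_add V.act_sum bM V.act_comp[OF unfactorizable_intoD(3) b] cong: sum.cong)
    then have v: "aV b v = aV ?e (aV b k) + (\<Sum>u\<in>?U. aV u (l (inve b \<cdot> u)))"
      using re[of "\<lambda>u u'. aV u (l u')"] by simp
    have "aW b w = aW ?e (f (aV b k)) + (\<Sum>u\<in>?U. aW (b \<cdot> u) (F (Dom C u) (l u)))"
      unfolding k using W.act_Idt_left[OF b] W.act_Idt_right[OF b] k(1)
      by (simp add: W.act_add W.act_sum bM W.act_comp[OF unfactorizable_intoD(3) b] f(3) cong: sum.cong)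
    then have w: "aW b w = aW ?e (f (aV b k)) + (\<Sum>u\<in>?U. aW u (F (Dom C u) (l (inve b \<cdot> u))))"
      using re[of "\<lambda>u u'. aW u (F (Dom C u') (l u'))"] D by simp
    show ?thesis unfolding R_def using v w Ka[OF bM k(1)]
      by (intro exI[of _ "aV b k"] exI[of _ "\<lambda>u. l (inve b \<cdot> u)"]) blast
  qed
  have gR: "g v = w" if r: "R v w" for v w
  proof -
    have "g v = (\<Sum>b\<in>hom y y. aW b (om (aW (inve b) w)))"
      unfolding g_def using \<psi>(2)[OF Ract[OF inve_in r]] by (intro sum.cong) simp_all
    also have "\<dots> = aW ?e w" by (rule om(2))
    also have "\<dots> = w"
    proof -
      obtain k l where w: "w = aW ?e (f k) + (\<Sum>u\<in>?U. aW u (F (Dom C u) (l u)))"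
        using r unfolding R_def by blast
      show ?thesis unfolding w
        using W.act_Idt_left[OF id_in[OF y]] W.act_Idt_left[OF unfactorizable_intoD(3)]
        by (simp add: W.act_add W.act_sum eM)
    qed
    finally show ?thesis .
  qed
  have Ru: "R (aV u l) (aW u (F (Dom C u) l))" if u: "u \<in> ?U" for u l
  proof -
    have "(\<Sum>u'\<in>?U. aV u' (if u' = u then l else 0)) = aV u l"
      using u uM by (subst sum.mono_neutral_right[of _ "{u}"]) (auto simp: V.act_0)
    moreover have "(\<Sum>u'\<in>?U. aW u' (F (Dom C u') (if u' = u then l else 0))) = aW u (F (Dom C u) l)"
      using u uM by (subst sum.mono_neutral_right[of _ "{u}"]) (auto simp: W.act_0 F0)
    ultimately show ?thesis unfolding R_def using K0
      by (intro exI[of _ 0] exI[of _ "\<lambda>u'. if u' = u then l else 0"]) (simp add: V.act_0 W.act_0 eM f0)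
  qed
  have "extends_at y sV aV sW aW ?K f F g"
    unfolding extends_at_def
  proof (intro conjI allI ballI impI)
    show "Vector_Spaces.linear sV sW g"
    proof
      show "g (v + w) = g v + g w" for v w
        by (simp add: g_def gM V.act_add W.act_add \<psi>.add om.add sum.distrib cong: sum.cong)
      show "g (sV c v) = sW c (g v)" for c v
        by (simp add: g_def gM V.act_scale W.act_scale \<psi>.scale om.scale W.scale_sum_right cong: sum.cong)
    qed
    show "g (aV ?e v) = g v" for v
      unfolding g_def using V.act_Idt_right[OF inve_in] by (intro sum.cong refl) simp
    show "aW ?e (g v) = g v" for v
      unfolding g_def W.act_sum[OF eM] using W.act_Idt_left by (intro sum.cong refl) simp
    show "g v = aW ?e (f v)" if "v \<in> ?K" for v
    proof -
      have "R (aV ?e v) (aW ?e (f v))"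
        unfolding R_def using that uM
        by (intro exI[of _ v] exI[of _ "\<lambda>u. 0"]) (simp add: V.act_0 W.act_0 F0)
      then have "g (aV ?e v) = aW ?e (f v)" by (rule gR)
      moreover have "g (aV ?e v) = g v"
        unfolding g_def using V.act_Idt_right[OF inve_in] by (intro sum.cong refl) simp
      ultimately show ?thesis by simp
    qed
    show "g (aV b v) = aW b (g v)" if b: "b \<in> hom y y" for b v
    proof -
      have "g (aV b v) = (\<Sum>a\<in>hom y y. aW a (om (\<psi> (aV (inve a \<cdot> b) v))))"
        unfolding g_def by (intro sum.cong refl) (simp add: V.act_comp[OF b inve_in])
      also have "\<dots> = (\<Sum>a\<in>hom y y. aW (b \<cdot> a) (om (\<psi> (aV (inve (b \<cdot> a) \<cdot> b) v))))"
        by (rule sum_left_translate[OF b, symmetric])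
      also have "\<dots> = (\<Sum>a\<in>hom y y. aW b (aW a (om (\<psi> (aV (inve a) v)))))"
        using b by (intro sum.cong refl) (simp add: inve_comp cancel_right2[OF b inve_in] W.act_comp[OF _ b])
      also have "\<dots> = aW b (g v)" unfolding g_def using b HomD(1) by (simp add: W.act_sum)
      finally show ?thesis .
    qed
    show "g (aV a v) = aW a (F x v)" if a: "a \<in> hom x y" and xy: "x \<noteq> y" for x a v
    proof -
      obtain z u b where u: "u \<in> hom z y" "unfactorizable C u" and b: "b \<in> hom x z" "a = u \<cdot> b"
        using last_unfactorizable[OF a xy] by blast
      have uU: "u \<in> ?U" and z: "Dom C u = z" using u HomD(2,3) by (auto simp: unfactorizable_into_def)
      have "g (aV a v) = aW u (F z (aV b v))"
        using gR[OF Ru[OF uU, of "aV b v"]] V.act_comp[OF b(1) u(1)] b(2) z by simp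
      also have "F z (aV b v) = aW b (F x v)"
        using Fx[OF uU z[symmetric]] b(1) unfolding extends_at_def by (cases "x = z") auto
      finally show ?thesis using W.act_comp[OF b(1) u(1)] b(2) by simp
    qed
  qed
  then show ?thesis by blast
qed

text \<open>The components are constructed by well-founded recursion on the rank and added up.\<close>

theorem extension_of_homs:
  fixes sV :: "'k \<Rightarrow> 'v::ab_group_add \<Rightarrow> 'v" and sQ :: "'k \<Rightarrow> 'q::ab_group_add \<Rightarrow> 'q"
    and sW :: "'k \<Rightarrow> 'w::ab_group_add \<Rightarrow> 'w"
  assumes V: "category_rep C sV aV" and Q: "category_rep C sQ aQ" and W: "category_rep C sW aW"
    and p: "Vector_Spaces.linear sV sQ p" and pa: "\<And>a v. a \<in> Mor C \<Longrightarrow> p (aV a v) = aQ a (p v)"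
    and X: "category_rep.rad_free C aQ"
    and om: "Vector_Spaces.linear sW sW om"
      "\<And>y w. y \<in> Obj C \<Longrightarrow> (\<Sum>g\<in>hom y y. aW g (om (aW (inve g) w))) = aW (Idt C y) w"
    and f: "\<And>v w. p v = 0 \<Longrightarrow> p w = 0 \<Longrightarrow> f (v + w) = f v + f w"
      "\<And>c v. p v = 0 \<Longrightarrow> f (sV c v) = sW c (f v)"
      "\<And>a v. a \<in> Mor C \<Longrightarrow> p v = 0 \<Longrightarrow> f (aV a v) = aW a (f v)"
  shows "\<exists>F. Vector_Spaces.linear sV sW F \<and> (\<forall>a\<in>Mor C. \<forall>v. F (aV a v) = aW a (F v))
    \<and> (\<forall>v. p v = 0 \<longrightarrow> F v = (\<Sum>y\<in>Obj C. aW (Idt C y) (f v)))"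
proof -
  interpret V: category_rep C sV aV by (rule V)
  interpret W: category_rep C sW aW by (rule W)
  interpret VW: vector_space_pair sV sW by unfold_locales
  let ?K = "{v. p v = 0}"
  have "\<exists>F. \<forall>y. y \<in> Obj C \<longrightarrow> extends_at y sV aV sW aW ?K f F (F y)"
  proof (rule dependent_wf_choice[where R = "measure rank"])
    fix F G :: "'o \<Rightarrow> 'v \<Rightarrow> 'w" and y g assume FG: "\<And>z. (z, y) \<in> measure rank \<Longrightarrow> F z = G z"
    have "F x = G x" if "a \<in> hom x y" "x \<noteq> y" for a x using FG rank_less[OF that] by simp
    then show "(y \<in> Obj C \<longrightarrow> extends_at y sV aV sW aW ?K f F g) = (y \<in> Obj C \<longrightarrow> extends_at y sV aV sW aW ?K f G g)"
      unfolding extends_at_def by (auto 4 3)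
  next
    fix y and F :: "'o \<Rightarrow> 'v \<Rightarrow> 'w"
    assume IH: "\<And>x. (x, y) \<in> measure rank \<Longrightarrow> x \<in> Obj C \<longrightarrow> extends_at x sV aV sW aW ?K f F (F x)"
    show "\<exists>g. y \<in> Obj C \<longrightarrow> extends_at y sV aV sW aW ?K f F g"
    proof (cases "y \<in> Obj C")
      case True
      have "\<exists>g. extends_at y sV aV sW aW ?K f F g"
      proof (rule extension_step[OF V Q W p _ X om(1)])
        show "extends_at x sV aV sW aW ?K f F (F x)" if "x \<in> Obj C" "rank x < rank y" for x
          using IH that by simp
      qed (use True in \<open>simp_all add: pa f om(2)\<close>)
      then show ?thesis by blast
    qed blast
  qed simp
  then obtain F where F: "\<And>y. y \<in> Obj C \<Longrightarrow> extends_at y sV aV sW aW ?K f F (F y)" by blast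
  have Flin: "Vector_Spaces.linear sV sW (F y)" if "y \<in> Obj C" for y using F[OF that] by (simp add: extends_at_def)
  have Fe: "F y (aV (Idt C y) v) = F y v" "aW (Idt C y) (F y v) = F y v" if "y \<in> Obj C" for y v
    using F[OF that] by (simp_all add: extends_at_def)
  have F0: "F y 0 = 0" if "y \<in> Obj C" for y
  proof -
    interpret Fy: linear sV sW "F y" by (rule Flin[OF that])
    show ?thesis by (rule Fy.zero)
  qed
  have IM: "Idt C y \<in> Mor C" if "y \<in> Obj C" for y using id_in[OF that] HomD(1) by blast
  define G where "G v = (\<Sum>y\<in>Obj C. F y v)" for v
  have "Vector_Spaces.linear sV sW G"
    unfolding G_def by (intro VW.linear_compose_sum ballI Flin)
  moreover have "G (aV a v) = aW a (G v)" if a: "a \<in> Mor C" for a v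
  proof -
    let ?x = "Dom C a" and ?y = "Cod C a"
    have ah: "a \<in> hom ?x ?y" using Mor_hom a .
    have xy: "?x \<in> Obj C" "?y \<in> Obj C" using dom_in cod_in a by auto
    have "F z (aV a v) = (if z = ?y then aW a (F ?x v) else 0)" if z: "z \<in> Obj C" for z
    proof (cases "z = ?y")
      case True
      then show ?thesis using F[OF xy(2)] ah unfolding extends_at_def by (cases "?x = ?y") auto
    next
      case False
      have "aV (Idt C z) (aV a v) = 0"
        using False a IM[OF z] Dom_Idt[OF z] by (intro V.act_noncomp) auto
      then show ?thesis using False Fe(1)[OF z, of "aV a v"] F0[OF z] by simp
    qed
    then have "G (aV a v) = (\<Sum>z\<in>Obj C. if z = ?y then aW a (F ?x v) else 0)"
      unfolding G_def by (rule sum.cong[OF refl])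
    then have "G (aV a v) = aW a (F ?x v)" using xy finite_Obj by simp
    moreover have "aW a (F z v) = (if z = ?x then aW a (F ?x v) else 0)" if z: "z \<in> Obj C" for z
    proof (cases "z = ?x")
      case False
      have "aW a (aW (Idt C z) (F z v)) = 0"
        using False a IM[OF z] Cod_Idt[OF z] by (intro W.act_noncomp) auto
      then show ?thesis using False Fe(2)[OF z, of v] by simp
    qed simp
    then have "aW a (G v) = (\<Sum>z\<in>Obj C. if z = ?x then aW a (F ?x v) else 0)"
      unfolding G_def W.act_sum[OF a] by (rule sum.cong[OF refl])
    then have "aW a (G v) = aW a (F ?x v)" using xy finite_Obj by simp
    ultimately show ?thesis by simp
  qed
  moreover have "G v = (\<Sum>y\<in>Obj C. aW (Idt C y) (f v))" if "p v = 0" for v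
    unfolding G_def using F that by (intro sum.cong refl) (simp add: extends_at_def)
  ultimately show ?thesis by blast
qed

end

section \<open>The category algebra\<close>

lemma finsum_pointwise:
  fixes M :: "('r, 'b \<Rightarrow> 'k::comm_monoid_add, 's) module_scheme"
  assumes "abelian_monoid M" "add M = (\<lambda>a b u. a u + b u)" "zero M = (\<lambda>_. 0)"
    "finite I" "f \<in> I \<rightarrow> carrier M"
  shows "finsum M f I = (\<lambda>u. \<Sum>i\<in>I. f i u)"
  using assms(4,5)
proof (induction I rule: finite_induct)
  case empty
  interpret abelian_monoid M by fact
  show ?case by (simp add: assms(3))
next
  case (insert i I)
  interpret abelian_monoid M by fact
  show ?case using insert by (simp add: assms(2))
qed

lemma basis_vec_apply: "basis_vec a b = (if b = a then 1 else 0)"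
  by (simp add: basis_vec_def)

text \<open>Left multiplication by a morphism, defined on all functions and not only on those supported on
  morphisms, so that it acts on a whole type.\<close>

definition lact :: "('o, 'm) precategory \<Rightarrow> 'm \<Rightarrow> ('m \<Rightarrow> 'k::field) \<Rightarrow> 'm \<Rightarrow> 'k" where
  "lact C g v = (\<lambda>c. \<Sum>f\<in>Mor C. if Cod C f = Dom C g \<and> Cmp C g f = c then v f else 0)"

context ei_category
begin

text \<open>The argument fixes the field, which the category does not determine.\<close>

abbreviation kC :: "'k::field itself \<Rightarrow> ('k, 'm \<Rightarrow> 'k) module" where "kC t \<equiv> category_algebra C"

lemma lact_0 [simp]: "lact C g 0 = 0"
  by (auto simp: lact_def fun_eq_iff intro!: sum.neutral)

lemma lact_add: "lact C g (v + w) = lact C g v + lact C g w"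
  by (auto simp: lact_def fun_eq_iff simp flip: sum.distrib intro!: sum.cong)

lemma lact_scale: "lact C g (\<lambda>u. c * v u) = (\<lambda>u. c * lact C g v u)"
  by (auto simp: lact_def fun_eq_iff sum_distrib_left intro!: sum.cong)

lemma lact_sum: "lact C g (\<lambda>u. \<Sum>i\<in>I. v i u) = (\<lambda>u. \<Sum>i\<in>I. lact C g (v i) u)"
proof
  fix u
  have "lact C g (\<lambda>u. \<Sum>i\<in>I. v i u) u
      = (\<Sum>f\<in>Mor C. \<Sum>i\<in>I. if Cod C f = Dom C g \<and> Cmp C g f = u then v i f else 0)"
    unfolding lact_def by (intro sum.cong refl) auto
  also have "\<dots> = (\<Sum>i\<in>I. lact C g (v i) u)" unfolding lact_def by (rule sum.swap)
  finally show "lact C g (\<lambda>u. \<Sum>i\<in>I. v i u) u = (\<Sum>i\<in>I. lact C g (v i) u)" .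
qed

lemma lact_cong: "(\<And>f. f \<in> Mor C \<Longrightarrow> v f = w f) \<Longrightarrow> lact C g v = lact C g w"
  unfolding lact_def by (intro ext sum.cong) auto

lemma lact_outside: "g \<in> Mor C \<Longrightarrow> u \<notin> Mor C \<or> Cod C u \<noteq> Cod C g \<Longrightarrow> lact C g v u = 0"
  unfolding lact_def
proof (intro sum.neutral ballI)
  fix f assume g: "g \<in> Mor C" and u: "u \<notin> Mor C \<or> Cod C u \<noteq> Cod C g" and f: "f \<in> Mor C"
  have "g \<cdot> f \<noteq> u" if "Cod C f = Dom C g"
  proof -
    have "f \<in> hom (Dom C f) (Dom C g)" using Mor_hom[OF f] that by simp
    from comp_in[OF this Mor_hom[OF g]] show ?thesis using u HomD(1,3) by metis
  qed
  then show "(if Cod C f = Dom C g \<and> g \<cdot> f = u then v f else 0) = 0" by auto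
qed

lemma lact_basis_vec:
  assumes "f \<in> Mor C"
  shows "lact C g (basis_vec f) = (if Cod C f = Dom C g then basis_vec (g \<cdot> f) else 0)"
proof
  fix u
  have "lact C g (basis_vec f) u = (\<Sum>f'\<in>Mor C. if f' = f then if Cod C f = Dom C g \<and> g \<cdot> f = u then 1 else 0 else 0)"
    unfolding lact_def basis_vec_apply by (intro sum.cong) auto
  then show "lact C g (basis_vec f) u = (if Cod C f = Dom C g then basis_vec (g \<cdot> f) else 0) u"
    using assms finite_Mor by (auto simp: basis_vec_apply)
qed

lemma lact_eq_sum_basis:
  "lact C g v = (\<lambda>u. \<Sum>f\<in>Mor C. v f * lact C g (basis_vec f) u)"
  by (rule ext, subst lact_def, intro sum.cong refl) (auto simp: lact_basis_vec basis_vec_apply)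

lemma lact_comp:
  assumes "a \<in> hom x y" "b \<in> hom y z"
  shows "lact C (b \<cdot> a) v = lact C b (lact C a v)"
proof -
  have basis: "lact C (b \<cdot> a) (basis_vec f) = lact C b (lact C a (basis_vec f))" if f: "f \<in> Mor C" for f
  proof (cases "Cod C f = x")
    case True
    then have fh: "f \<in> hom (Dom C f) x" using Mor_hom[OF f] by simp
    show ?thesis
      using True f HomD(1-3)[OF assms(1)] HomD(2)[OF assms(2)] HomD(2)[OF comp_in[OF assms]]
        HomD(1,3)[OF comp_in[OF fh assms(1)]] comp_assoc[OF fh assms]
      by (simp add: lact_basis_vec)
  next
    case False
    then show ?thesis
      using f HomD(2)[OF assms(1)] HomD(2)[OF comp_in[OF assms]] by (simp add: lact_basis_vec)
  qed
  have "lact C (b \<cdot> a) v = (\<lambda>u. \<Sum>f\<in>Mor C. v f * lact C b (lact C a (basis_vec f)) u)"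
    unfolding lact_eq_sum_basis[of "b \<cdot> a" v] by (intro ext sum.cong refl) (simp only: basis)
  also have "\<dots> = lact C b (\<lambda>u. \<Sum>f\<in>Mor C. v f * lact C a (basis_vec f) u)"
    unfolding lact_sum lact_scale ..
  also have "\<dots> = lact C b (lact C a v)" unfolding lact_eq_sum_basis[of a v, symmetric] ..
  finally show ?thesis .
qed

lemma lact_noncomp:
  assumes "a \<in> Mor C" "Cod C a \<noteq> Dom C b"
  shows "lact C b (lact C a v) = 0"
proof -
  have "(if Cod C f = Dom C b \<and> b \<cdot> f = u then lact C a v f else 0) = 0" if "f \<in> Mor C" for f u
    using lact_outside[OF assms(1), of f v] assms(2) by auto
  then show ?thesis by (auto simp: lact_def[of C b] fun_eq_iff intro!: sum.neutral)
qed

lemma lact_Idt: "x \<in> Obj C \<Longrightarrow> lact C (Idt C x) v u = (if u \<in> Mor C \<and> Cod C u = x then v u else 0)"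
proof (cases "u \<in> Mor C \<and> Cod C u = x")
  case True
  have "lact C (Idt C x) v u = (\<Sum>f\<in>Mor C. if f = u then v u else 0)"
    unfolding lact_def
  proof (intro sum.cong refl)
    fix f assume f: "f \<in> Mor C"
    have "x \<in> Obj C" using True cod_in by blast
    then show "(if Cod C f = Dom C (Idt C x) \<and> Idt C x \<cdot> f = u then v f else 0) = (if f = u then v u else 0)"
      using True Dom_Idt[of x] comp_id_left[OF Mor_hom[OF f]] comp_id_left[OF Mor_hom, of u] by auto
  qed
  then show ?thesis using True finite_Mor by simp
qed (use lact_outside[of "Idt C x" u v] Cod_Idt[of x] id_in[of x] HomD(1) in auto)

lemma lact_group:
  assumes "g \<in> hom x x" "u \<in> hom w x" shows "lact C g v u = v (inve g \<cdot> u)"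
proof -
  have i: "inve g \<cdot> u \<in> hom w x" using comp_in[OF assms(2) inve_in[OF assms(1)]] .
  have "lact C g v u = (\<Sum>f\<in>Mor C. if f = inve g \<cdot> u then v f else 0)"
    unfolding lact_def
  proof (intro sum.cong refl)
    fix f assume f: "f \<in> Mor C"
    have "(Cod C f = Dom C g \<and> g \<cdot> f = u) = (f = inve g \<cdot> u)"
      using cancel_left1[OF assms] cancel_left2[OF assms(1), of f "Dom C f"] Mor_hom[OF f] HomD(2)[OF assms(1)] HomD(3)[OF i]
      by auto
    then show "(if Cod C f = Dom C g \<and> g \<cdot> f = u then v f else 0) = (if f = inve g \<cdot> u then v f else 0)" by simp
  qed
  then show ?thesis using HomD(1)[OF i] finite_Mor by simp
qed

lemma category_rep_functions:
  "category_rep C (\<lambda>c (v :: 'i \<Rightarrow> 'm \<Rightarrow> 'k::field) i u. c * v i u) (\<lambda>a v i. lact C a (v i))"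
  by unfold_locales
    (auto simp: fun_eq_iff lact_add lact_scale lact_comp lact_noncomp algebra_simps)

lemma category_rep_function:
  "category_rep C (\<lambda>c (v :: 'm \<Rightarrow> 'k::field) u. c * v u) (lact C)"
  by unfold_locales
    (auto simp: fun_eq_iff lact_add lact_scale lact_comp lact_noncomp algebra_simps)

lemma category_algebra_simps:
  "carrier (kC TYPE('k::field)) = lin_carrier (Mor C)"
  "zero (kC TYPE('k::field)) = 0"
  "add (kC TYPE('k::field)) = (+)"
  "smult (kC TYPE('k::field)) c a = (\<lambda>u. c * a u)"
  "one (kC TYPE('k::field)) = (\<lambda>f. if f \<in> Idt C ` Obj C then 1 else 0)"
  by (auto simp: category_algebra_def fun_eq_iff)

lemma category_algebra_mult:
  "a \<otimes>\<^bsub>kC TYPE('k::field)\<^esub> b = (\<lambda>u. \<Sum>g\<in>Mor C. a g * lact C g b u)"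
proof
  fix u
  let ?D = "{(g, f). g \<in> Mor C \<and> f \<in> Mor C \<and> Dom C g = Cod C f}"
  have "(a \<otimes>\<^bsub>kC TYPE('k)\<^esub> b) u
      = (\<Sum>(g, f)\<in>{(g, f) \<in> ?D. g \<cdot> f = u}. a g * b f)"
    by (simp add: category_algebra_def bilin_ext_def)
  also have "\<dots> = (\<Sum>(g, f)\<in>Mor C \<times> Mor C. if Cod C f = Dom C g \<and> g \<cdot> f = u then a g * b f else 0)"
    using finite_Mor by (intro sum.mono_neutral_cong_left) (auto split: if_splits)
  also have "\<dots> = (\<Sum>g\<in>Mor C. \<Sum>f\<in>Mor C. if Cod C f = Dom C g \<and> g \<cdot> f = u then a g * b f else 0)"
    by (rule sum.cartesian_product[symmetric])
  also have "\<dots> = (\<Sum>g\<in>Mor C. a g * lact C g b u)"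
    unfolding lact_def by (auto simp: sum_distrib_left intro!: sum.cong)
  finally show "(a \<otimes>\<^bsub>kC TYPE('k)\<^esub> b) u = (\<Sum>g\<in>Mor C. a g * lact C g b u)" .
qed

lemma category_algebra_mult_closed:
  "a \<otimes>\<^bsub>kC TYPE('k::field)\<^esub> b \<in> lin_carrier (Mor C)"
  by (simp add: category_algebra_mult lin_carrier_iff lact_outside)

lemma sum_lact_Idt: "(\<Sum>x\<in>Obj C. lact C (Idt C x) v u) = (if u \<in> Mor C then v u else 0)"
proof -
  have "(\<Sum>x\<in>Obj C. lact C (Idt C x) v u) = (\<Sum>x\<in>Obj C. if x = Cod C u then if u \<in> Mor C then v u else 0 else 0)"
    by (intro sum.cong) (auto simp: lact_Idt)
  then show ?thesis using finite_Obj cod_in by auto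
qed

lemma category_algebra_mult_scalar:
  assumes "b \<in> lin_carrier (Mor C)"
  shows "(\<lambda>u. c * \<one>\<^bsub>kC TYPE('k::field)\<^esub> u)
    \<otimes>\<^bsub>kC TYPE('k::field)\<^esub> b = (\<lambda>u. c * b u)"
proof
  fix u
  have "(\<Sum>g\<in>Mor C. (c * \<one>\<^bsub>kC TYPE('k)\<^esub> g) * lact C g b u)
      = (\<Sum>g\<in>Idt C ` Obj C. c * lact C g b u)"
    using finite_Mor id_in HomD(1) by (intro sum.mono_neutral_cong_right) (auto simp: category_algebra_simps)
  also have "\<dots> = (\<Sum>x\<in>Obj C. c * lact C (Idt C x) b u)"
    by (subst sum.reindex) (auto intro!: inj_onI dest: arg_cong[of _ _ "Dom C"] simp: Dom_Idt)
  also have "\<dots> = c * b u"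
    using assms by (simp add: sum_lact_Idt lin_carrier_iff flip: sum_distrib_left)
  finally show "((\<lambda>u. c * \<one>\<^bsub>kC TYPE('k::field)\<^esub> u)
    \<otimes>\<^bsub>kC TYPE('k::field)\<^esub> b) u = c * b u"
    by (simp add: category_algebra_mult)
qed

lemma lact_one:
  assumes "g \<in> Mor C"
  shows "lact C g (\<one>\<^bsub>kC TYPE('k::field)\<^esub>) = basis_vec g"
proof
  fix u
  have x: "Dom C g \<in> Obj C" "Idt C (Dom C g) \<in> Mor C" using assms dom_in id_in HomD(1) by blast+
  have "lact C g (\<one>\<^bsub>kC TYPE('k)\<^esub>) u
     = (\<Sum>f\<in>Mor C. if f = Idt C (Dom C g) then if u = g then 1 else 0 else 0)"
    unfolding lact_def
  proof (intro sum.cong refl)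
    fix f assume "f \<in> Mor C"
    show "(if Cod C f = Dom C g \<and> g \<cdot> f = u then \<one>\<^bsub>kC TYPE('k)\<^esub> f else 0)
       = (if f = Idt C (Dom C g) then if u = g then 1 else 0 else 0)"
      using x Cod_Idt comp_id_right[OF Mor_hom[OF assms]] by (auto simp: category_algebra_simps)
  qed
  then show "lact C g (\<one>\<^bsub>kC TYPE('k)\<^esub>) u = basis_vec g u"
    using x finite_Mor by (simp add: basis_vec_apply)
qed

lemma category_algebra_assoc:
  fixes a b c :: "'m \<Rightarrow> 'k::field"
  defines "A \<equiv> kC TYPE('k)"
  shows "(a \<otimes>\<^bsub>A\<^esub> b) \<otimes>\<^bsub>A\<^esub> c = a \<otimes>\<^bsub>A\<^esub> (b \<otimes>\<^bsub>A\<^esub> c)"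
proof
  fix u
  have "((a \<otimes>\<^bsub>A\<^esub> b) \<otimes>\<^bsub>A\<^esub> c) u = (\<Sum>h\<in>Mor C. \<Sum>g\<in>Mor C. a g * (lact C g b h * lact C h c u))"
    by (simp add: A_def category_algebra_mult sum_distrib_right mult.assoc)
  also have "\<dots> = (\<Sum>g\<in>Mor C. a g * (\<Sum>h\<in>Mor C. lact C g b h * lact C h c u))"
    unfolding sum_distrib_left by (rule sum.swap)
  also have "\<dots> = (\<Sum>g\<in>Mor C. a g * lact C g (\<lambda>u. \<Sum>h\<in>Mor C. b h * lact C h c u) u)"
  proof (rule sum.cong[OF refl])
    fix g assume g: "g \<in> Mor C"
    have "(\<Sum>h\<in>Mor C. lact C g b h * lact C h c u)
        = (\<Sum>h\<in>Mor C. \<Sum>f\<in>Mor C. b f * (lact C g (basis_vec f) h * lact C h c u))"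
      by (subst lact_eq_sum_basis) (simp add: sum_distrib_right mult.assoc)
    also have "\<dots> = (\<Sum>f\<in>Mor C. b f * (\<Sum>h\<in>Mor C. lact C g (basis_vec f) h * lact C h c u))"
      unfolding sum_distrib_left by (rule sum.swap)
    also have "\<dots> = (\<Sum>f\<in>Mor C. b f * lact C g (lact C f c) u)"
    proof (rule sum.cong[OF refl])
      fix f assume f: "f \<in> Mor C"
      have "(\<Sum>h\<in>Mor C. lact C g (basis_vec f) h * lact C h c u) = lact C g (lact C f c) u"
      proof (cases "Cod C f = Dom C g")
        case True
        then have gf: "f \<in> hom (Dom C f) (Dom C g)" "g \<in> hom (Dom C g) (Cod C g)" using Mor_hom f g by metis+
        have "(\<Sum>h\<in>Mor C. lact C g (basis_vec f) h * lact C h c u) = (\<Sum>h\<in>Mor C. if h = g \<cdot> f then lact C h c u else 0)"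
          using f True by (intro sum.cong) (auto simp: lact_basis_vec basis_vec_apply)
        also have "\<dots> = lact C (g \<cdot> f) c u" using HomD(1)[OF comp_in[OF gf]] finite_Mor by simp
        finally show ?thesis using lact_comp[OF gf, of c] by simp
      qed (simp add: f lact_basis_vec lact_noncomp)
      then show "b f * (\<Sum>h\<in>Mor C. lact C g (basis_vec f) h * lact C h c u) = b f * lact C g (lact C f c) u" by simp
    qed
    also have "\<dots> = lact C g (\<lambda>u. \<Sum>h\<in>Mor C. b h * lact C h c u) u"
      unfolding lact_sum lact_scale ..
    finally show "a g * (\<Sum>h\<in>Mor C. lact C g b h * lact C h c u)
        = a g * lact C g (\<lambda>u. \<Sum>h\<in>Mor C. b h * lact C h c u) u" by simp
  qed
  also have "\<dots> = (a \<otimes>\<^bsub>A\<^esub> (b \<otimes>\<^bsub>A\<^esub> c)) u" by (simp add: A_def category_algebra_mult)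
  finally show "((a \<otimes>\<^bsub>A\<^esub> b) \<otimes>\<^bsub>A\<^esub> c) u = (a \<otimes>\<^bsub>A\<^esub> (b \<otimes>\<^bsub>A\<^esub> c)) u" .
qed

lemma abelian_group_category_algebra: "abelian_group (kC TYPE('k::field))"
proof (rule abelian_groupI)
  fix a assume "a \<in> carrier (kC TYPE('k))"
  then show "\<exists>b\<in>carrier (kC TYPE('k)).
      b \<oplus>\<^bsub>kC TYPE('k)\<^esub> a = \<zero>\<^bsub>kC TYPE('k)\<^esub>"
    by (intro bexI[of _ "- a"]) (auto simp: category_algebra_simps lin_carrier_iff)
qed (auto simp: category_algebra_simps lin_carrier_iff add.assoc add.commute)

lemma one_in: "\<one>\<^bsub>kC TYPE('k::field)\<^esub> \<in> lin_carrier (Mor C)"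
  using id_in HomD(1) by (auto simp: category_algebra_simps lin_carrier_iff)

lemma ring_category_algebra: "ring (kC TYPE('k::field))"
proof (rule ringI)
  let ?A = "kC TYPE('k)"
  show "Group.monoid ?A"
  proof (rule monoidI)
    show "\<one>\<^bsub>?A\<^esub> \<otimes>\<^bsub>?A\<^esub> a = a" if "a \<in> carrier ?A" for a
      using category_algebra_mult_scalar[of a 1] that by (simp add: category_algebra_simps(1))
    show "a \<otimes>\<^bsub>?A\<^esub> \<one>\<^bsub>?A\<^esub> = a" if "a \<in> carrier ?A" for a
    proof
      fix u
      have "(a \<otimes>\<^bsub>?A\<^esub> \<one>\<^bsub>?A\<^esub>) u = (\<Sum>g\<in>Mor C. if g = u then a g else 0)"
        unfolding category_algebra_mult by (intro sum.cong) (auto simp: lact_one basis_vec_apply)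
      then show "(a \<otimes>\<^bsub>?A\<^esub> \<one>\<^bsub>?A\<^esub>) u = a u"
        using that finite_Mor by (simp add: category_algebra_simps(1) lin_carrier_iff)
    qed
  qed (auto simp: category_algebra_assoc category_algebra_simps(1) category_algebra_mult_closed one_in)
qed (auto simp: abelian_group_category_algebra category_algebra_mult category_algebra_simps(3) fun_eq_iff
      lact_add algebra_simps sum.distrib)

lemma fd_algebra_category_algebra: "fd_algebra (kC TYPE('k::field))"
  unfolding fd_algebra_def
proof (intro conjI allI ballI)
  let ?A = "kC TYPE('k)"
  interpret A: ring ?A by (rule ring_category_algebra)
  show "ring ?A" by (rule ring_category_algebra)
  have "cring (field_ring :: 'k ring)"
  proof (rule cringI)
    show "abelian_group (field_ring :: 'k ring)"
    proof (rule abelian_groupI)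
      show "\<exists>y\<in>carrier field_ring. y \<oplus>\<^bsub>field_ring\<^esub> x = \<zero>\<^bsub>field_ring\<^esub>" for x :: 'k
        by (intro bexI[of _ "- x"]) (auto simp: field_ring_def)
    qed (auto simp: field_ring_def)
    show "comm_monoid (field_ring :: 'k ring)" by unfold_locales (auto simp: field_ring_def)
  qed (auto simp: field_ring_def algebra_simps)
  then show "Module.module (field_ring :: 'k ring) ?A"
    using abelian_group_category_algebra
    by (intro Module.module.intro module_axioms.intro)
      (auto simp: category_algebra_simps(1,3,4) lin_carrier_iff field_ring_def fun_eq_iff algebra_simps)
  show "(c \<odot>\<^bsub>?A\<^esub> a) \<otimes>\<^bsub>?A\<^esub> b = c \<odot>\<^bsub>?A\<^esub> (a \<otimes>\<^bsub>?A\<^esub> b)" for c a b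
    by (simp add: category_algebra_mult category_algebra_simps(4) sum_distrib_left mult.assoc)
  show "a \<otimes>\<^bsub>?A\<^esub> (c \<odot>\<^bsub>?A\<^esub> b) = c \<odot>\<^bsub>?A\<^esub> (a \<otimes>\<^bsub>?A\<^esub> b)" for c a b
    by (simp add: category_algebra_mult category_algebra_simps(4) lact_scale sum_distrib_left mult.left_commute)
  have "\<exists>c. a = (\<Oplus>\<^bsub>?A\<^esub>b\<in>basis_vec ` Mor C. c b \<odot>\<^bsub>?A\<^esub> b)" if a: "a \<in> carrier ?A" for a
  proof -
    have inj: "inj_on (basis_vec :: 'm \<Rightarrow> 'm \<Rightarrow> 'k) (Mor C)" by (simp add: inj_on_def basis_vec_inj)
    let ?c = "\<lambda>b. a (inv_into (Mor C) basis_vec b)"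
    have "(\<Oplus>\<^bsub>?A\<^esub>b\<in>basis_vec ` Mor C. ?c b \<odot>\<^bsub>?A\<^esub> b)
        = (\<lambda>u. \<Sum>b\<in>basis_vec ` Mor C. (?c b \<odot>\<^bsub>?A\<^esub> b) u)"
      using finite_Mor by (intro finsum_pointwise A.abelian_monoid_axioms)
        (auto simp: category_algebra_simps fun_eq_iff lin_carrier_iff basis_vec_apply)
    also have "\<dots> = (\<lambda>u. \<Sum>g\<in>Mor C. a g * basis_vec g u)"
      by (subst sum.reindex[OF inj]) (simp add: category_algebra_simps(4) inv_into_f_f[OF inj] cong: sum.cong)
    also have "\<dots> = a"
    proof
      fix u
      have "(\<Sum>g\<in>Mor C. a g * basis_vec g u) = (\<Sum>g\<in>Mor C. if g = u then a g else 0)"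
        by (intro sum.cong) (auto simp: basis_vec_apply)
      then show "(\<Sum>g\<in>Mor C. a g * basis_vec g u) = a u"
        using a finite_Mor by (simp add: category_algebra_simps(1) lin_carrier_iff)
    qed
    finally show ?thesis by metis
  qed
  moreover have "basis_vec ` Mor C \<subseteq> carrier ?A"
    by (auto simp: category_algebra_simps(1) lin_carrier_iff basis_vec_apply)
  ultimately show "\<exists>B. finite B \<and> B \<subseteq> carrier ?A
      \<and> (\<forall>a\<in>carrier ?A. \<exists>c. a = (\<Oplus>\<^bsub>?A\<^esub>b\<in>B. c b \<odot>\<^bsub>?A\<^esub> b))"
    using finite_Mor by blast
qed

end

lemma category_algebra_op_cat:
  "category_algebra (op_cat C) = op_ring (category_algebra C :: ('k::field, 'm \<Rightarrow> 'k) module)"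
proof -
  have "bilin_ext {(g, f). g \<in> Mor C \<and> f \<in> Mor C \<and> Cod C g = Dom C f} (Cmp (op_cat C)) a b
    = bilin_ext {(g, f). g \<in> Mor C \<and> f \<in> Mor C \<and> Dom C g = Cod C f} (Cmp C) b a" for a b :: "'m \<Rightarrow> 'k"
    by (rule bilin_ext_swap) auto
  then show ?thesis by (simp add: category_algebra_def op_ring_def fun_eq_iff)
qed

section \<open>The category algebra has injective dimension at most one\<close>

lemma sum_fun_apply: "(\<Sum>i\<in>I. f i) u = (\<Sum>i\<in>I. f i u)"
  by (induction I rule: infinite_finite_induct) simp_all

text \<open>Compare the coefficient at \<open>b\<close> on the left-hand side of the conclusion with the coefficient at \<open>u b\<close>
  in the hypothesis.  By equidivisibility the factorizations of \<open>u b\<close> whose second factor is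
  unfactorizable form the single orbit of the pairs \<open>(u g, g\<^sup>-\<^sup>1 b)\<close>.  The fibres of this
  parametrization by \<open>g\<close> have a constant number \<open>N\<close> of elements, so the former coefficient is \<open>N\<close> times
  the latter.\<close>

lemma (in levi_category) lact_rad_free_at:
  fixes m :: "'m \<Rightarrow> 'm \<Rightarrow> 'k::field"
  assumes zero: "(\<Sum>u\<in>unfactorizable_into C y. lact C u (m u)) = 0" and u: "u \<in> unfactorizable_into C y"
  shows "(\<Sum>g\<in>hom (Dom C u) (Dom C u). lact C g (m (u \<cdot> g))) = 0"
proof
  fix b
  let ?x = "Dom C u" and ?U = "unfactorizable_into C y"
  have uD: "unfactorizable C u" "u \<in> hom ?x y" "u \<in> Mor C"
    using u Mor_hom[of u] by (auto simp: unfactorizable_into_def unfactorizable_def)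
  have finU: "finite ?U"
    by (rule finite_subset[OF _ finite_Mor]) (auto simp: unfactorizable_into_def unfactorizable_def)
  have xO: "?x \<in> Obj C" using HomD(4)[OF uD(2)] .
  show "(\<Sum>g\<in>hom ?x ?x. lact C g (m (u \<cdot> g))) b = 0 b"
  proof (cases "b \<in> Mor C \<and> Cod C b = ?x")
    case False
    then have "lact C g (m (u \<cdot> g)) b = 0" if "g \<in> hom ?x ?x" for g
      using lact_outside[of g b] HomD(1,3)[OF that] by auto
    then show ?thesis by (simp add: sum_fun_apply)
  next
    case True
    then have b: "b \<in> hom (Dom C b) ?x" using Mor_hom by metis
    define F where "F = (\<lambda>(v, f). m v f)"
    define T where "T = {(v, f). v \<in> ?U \<and> f \<in> Mor C \<and> Cod C f = Dom C v \<and> v \<cdot> f = u \<cdot> b}"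
    define \<phi> where "\<phi> g = (u \<cdot> g, inve g \<cdot> b)" for g
    have phi_comp: "\<phi> (g \<cdot> h) = ((u \<cdot> g) \<cdot> h, inve h \<cdot> (inve g \<cdot> b))" if "g \<in> hom ?x ?x" "h \<in> hom ?x ?x" for g h
      using comp_assoc[OF that(2,1) uD(2)] inve_comp[OF that] comp_assoc[OF b inve_in[OF that(1)] inve_in[OF that(2)]]
      by (simp add: \<phi>_def)
    have T_eq: "T = \<phi> ` hom ?x ?x"
    proof
      show "\<phi> ` hom ?x ?x \<subseteq> T"
      proof
        fix t assume "t \<in> \<phi> ` hom ?x ?x"
        then obtain g where g: "g \<in> hom ?x ?x" "t = \<phi> g" by blast
        have ug: "u \<cdot> g \<in> hom ?x y" "inve g \<cdot> b \<in> hom (Dom C b) ?x"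
          using comp_in[OF g(1) uD(2)] comp_in[OF b inve_in[OF g(1)]] by auto
        have "(u \<cdot> g) \<cdot> (inve g \<cdot> b) = u \<cdot> (g \<cdot> (inve g \<cdot> b))"
          using comp_assoc[OF ug(2) g(1) uD(2)] by simp
        then show "t \<in> T"
          using ug HomD(1-3)[OF ug(1)] HomD(1-3)[OF ug(2)] cancel_left1[OF g(1) b] unfactorizable_comp_iso[OF uD(1,2) g(1)]
          by (simp add: g T_def \<phi>_def unfactorizable_into_def)
      qed
      show "T \<subseteq> \<phi> ` hom ?x ?x"
      proof
        fix t assume "t \<in> T"
        then obtain v f where t: "t = (v, f)" "v \<in> ?U" "f \<in> Mor C" "Cod C f = Dom C v" "v \<cdot> f = u \<cdot> b"
          by (auto simp: T_def)
        have v: "unfactorizable C v" "v \<in> hom (Dom C v) y" "f \<in> hom (Dom C f) (Dom C v)"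
          using t Mor_hom by (auto simp: unfactorizable_into_def unfactorizable_def intro: HomI)
        have "Dom C (v \<cdot> f) = Dom C f" "Dom C (u \<cdot> b) = Dom C b"
          using HomD(2)[OF comp_in[OF v(3,2)]] HomD(2)[OF comp_in[OF b uD(2)]] by auto
        then have f: "f \<in> hom (Dom C b) (Dom C v)" using v(3) t(5) by simp
        obtain h where h: "Dom C v = ?x" "h \<in> hom ?x ?x" "f = h \<cdot> b" "u = v \<cdot> h"
          using last_unfactorizable_unique[OF uD(1,2) v(1,2) b f] t(5) by auto
        have "v = u \<cdot> inve h" using cancel_right1[OF h(2), of v y] v(2) h(1,4) by simp
        then have "t = \<phi> (inve h)" using t(1) h inve_inve[OF h(2)] by (simp add: \<phi>_def)
        then show "t \<in> \<phi> ` hom ?x ?x" using inve_in[OF h(2)] by blast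
      qed
    qed
    have I: "Idt C ?x \<in> hom ?x ?x" using id_in[OF xO] .
    define N where "N = card {g \<in> hom ?x ?x. \<phi> g = \<phi> (Idt C ?x)}"
    have fibre: "card {g \<in> hom ?x ?x. \<phi> g = \<phi> h} = N" if h: "h \<in> hom ?x ?x" for h
      unfolding N_def
    proof (rule bij_betw_same_card[symmetric])
      show "bij_betw (\<lambda>g. g \<cdot> h) {g \<in> hom ?x ?x. \<phi> g = \<phi> (Idt C ?x)} {g \<in> hom ?x ?x. \<phi> g = \<phi> h}"
      proof (rule bij_betwI[where g = "\<lambda>g. g \<cdot> inve h"])
        show "(\<lambda>g. g \<cdot> h) \<in> {g \<in> hom ?x ?x. \<phi> g = \<phi> (Idt C ?x)} \<rightarrow> {g \<in> hom ?x ?x. \<phi> g = \<phi> h}"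
        proof
          fix g assume g: "g \<in> {g \<in> hom ?x ?x. \<phi> g = \<phi> (Idt C ?x)}"
          then have "\<phi> (g \<cdot> h) = \<phi> (Idt C ?x \<cdot> h)"
            using phi_comp[of g h] phi_comp[of "Idt C ?x" h] I h by (simp add: \<phi>_def)
          then show "g \<cdot> h \<in> {g \<in> hom ?x ?x. \<phi> g = \<phi> h}"
            using comp_in[OF h, of g ?x] g comp_id_left[OF h] by simp
        qed
        show "(\<lambda>g. g \<cdot> inve h) \<in> {g \<in> hom ?x ?x. \<phi> g = \<phi> h} \<rightarrow> {g \<in> hom ?x ?x. \<phi> g = \<phi> (Idt C ?x)}"
        proof
          fix g assume g: "g \<in> {g \<in> hom ?x ?x. \<phi> g = \<phi> h}"
          then have "\<phi> (g \<cdot> inve h) = \<phi> (h \<cdot> inve h)"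
            using phi_comp[of g "inve h"] phi_comp[OF h inve_in[OF h]] inve_in[OF h] by (simp add: \<phi>_def)
          then show "g \<cdot> inve h \<in> {g \<in> hom ?x ?x. \<phi> g = \<phi> (Idt C ?x)}"
            using comp_in[OF inve_in[OF h], of g ?x] g inve_right[OF h] by simp
        qed
      qed (use h in \<open>auto simp: cancel_right1[OF h] cancel_right2[OF h]\<close>)
    qed
    have finT: "finite T" unfolding T_eq by simp
    have "(\<Sum>g\<in>hom ?x ?x. lact C g (m (u \<cdot> g))) b = (\<Sum>g\<in>hom ?x ?x. F (\<phi> g))"
      unfolding sum_fun_apply by (intro sum.cong refl) (simp add: lact_group[OF _ b] F_def \<phi>_def)
    also have "\<dots> = (\<Sum>t\<in>\<phi> ` hom ?x ?x. \<Sum>g\<in>{g \<in> hom ?x ?x. \<phi> g = t}. F (\<phi> g))"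
      by (rule sum.image_gen) simp
    also have "\<dots> = (\<Sum>t\<in>\<phi> ` hom ?x ?x. of_nat N * F t)"
      using fibre by (intro sum.cong refl) auto
    also have "\<dots> = of_nat N * (\<Sum>t\<in>T. F t)" unfolding T_eq sum_distrib_left ..
    also have "(\<Sum>t\<in>T. F t) = (\<Sum>(v, f)\<in>?U \<times> Mor C. if Cod C f = Dom C v \<and> v \<cdot> f = u \<cdot> b then m v f else 0)"
      using finU finite_Mor by (intro sum.mono_neutral_cong_left) (auto simp: T_def F_def split: if_splits)
    also have "\<dots> = (\<Sum>v\<in>?U. \<Sum>f\<in>Mor C. if Cod C f = Dom C v \<and> v \<cdot> f = u \<cdot> b then m v f else 0)"
      by (rule sum.cartesian_product[symmetric])
    also have "\<dots> = (\<Sum>v\<in>?U. lact C v (m v)) (u \<cdot> b)" by (simp add: sum_fun_apply lact_def)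
    also have "\<dots> = 0" using zero by simp
    finally show ?thesis by simp
  qed
qed

lemma (in levi_category) rad_free_functions:
  "category_rep.rad_free C (\<lambda>a (v :: 'i \<Rightarrow> 'm \<Rightarrow> 'k::field) i. lact C a (v i))"
proof -
  interpret category_rep C "\<lambda>c (v :: 'i \<Rightarrow> 'm \<Rightarrow> 'k) i u. c * v i u" "\<lambda>a (v :: 'i \<Rightarrow> 'm \<Rightarrow> 'k) i. lact C a (v i)"
    by (rule category_rep_functions)
  show ?thesis
    unfolding rad_free_def
  proof (intro ballI allI impI)
    fix y u and m :: "'m \<Rightarrow> 'i \<Rightarrow> 'm \<Rightarrow> 'k"
    assume z: "(\<Sum>u\<in>unfactorizable_into C y. (\<lambda>i. lact C u (m u i))) = 0" and u: "u \<in> unfactorizable_into C y"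
    show "(\<Sum>g\<in>hom (Dom C u) (Dom C u). (\<lambda>i. lact C g (m (u \<cdot> g) i))) = 0"
    proof
      fix i
      have "(\<Sum>u\<in>unfactorizable_into C y. lact C u (m u i)) = 0"
        using fun_cong[OF z, of i] by (simp add: sum_fun_apply)
      from lact_rad_free_at[OF this u]
      show "(\<Sum>g\<in>hom (Dom C u) (Dom C u). (\<lambda>i. lact C g (m (u \<cdot> g) i))) i = 0 i"
        by (simp add: sum_fun_apply)
    qed
  qed
qed

context ei_category
begin

text \<open>Free modules consist of families that are undefined from index \<open>n\<close> on, and of functions supported on
  morphisms.  Linear algebra takes place in the vector space of all functions \<open>nat \<Rightarrow> 'm \<Rightarrow> 'k\<close>; the two
  maps below pass from one to the other and back.\<close>

definition trunc :: "nat \<Rightarrow> (nat \<Rightarrow> 'm \<Rightarrow> 'k::field) \<Rightarrow> nat \<Rightarrow> 'm \<Rightarrow> 'k" where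
  "trunc n v = (\<lambda>i\<in>{..<n}. \<lambda>u. if u \<in> Mor C then v i u else 0)"

definition untrunc :: "nat \<Rightarrow> (nat \<Rightarrow> 'm \<Rightarrow> 'k::field) \<Rightarrow> nat \<Rightarrow> 'm \<Rightarrow> 'k" where
  "untrunc n v = (\<lambda>i. if i < n then v i else 0)"

abbreviation scalar :: "'k::field \<Rightarrow> 'm \<Rightarrow> 'k" where
  "scalar c \<equiv> (\<lambda>u. c * \<one>\<^bsub>kC TYPE('k)\<^esub> u)"

lemma scalar_in: "scalar (c :: 'k::field) \<in> lin_carrier (Mor C)"
  using one_in[where 'k = 'k] by (simp add: lin_carrier_iff)

lemma basis_vec_in: "g \<in> Mor C \<Longrightarrow> basis_vec g \<in> lin_carrier (Mor C)"
  by (auto simp: lin_carrier_iff basis_vec_apply)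

lemma basis_vec_mult: 
  assumes "g \<in> Mor C" shows "basis_vec g \<otimes>\<^bsub>kC TYPE('k::field)\<^esub> b = lact C g b"
proof
  fix u
  have "(basis_vec g \<otimes>\<^bsub>kC TYPE('k::field)\<^esub> b) u = (\<Sum>h\<in>Mor C. if h = g then lact C g b u else 0)"
    unfolding category_algebra_mult by (intro sum.cong) (auto simp: basis_vec_apply)
  then show "(basis_vec g \<otimes>\<^bsub>kC TYPE('k)\<^esub> b) u = lact C g b u" using assms finite_Mor by simp
qed

lemma free_carrier: "v \<in> carrier (free_module (kC TYPE('k::field)) n)
  \<longleftrightarrow> (\<forall>i<n. v i \<in> lin_carrier (Mor C)) \<and> (\<forall>i. \<not> i < n \<longrightarrow> v i = undefined)"
  by (auto simp: category_algebra_simps(1) PiE_iff extensional_def)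

lemma trunc_in: "trunc n v \<in> carrier (free_module (kC TYPE('k::field)) n)"
  unfolding free_carrier by (simp add: trunc_def lin_carrier_iff)

lemma trunc_untrunc:
  assumes "v \<in> carrier (free_module (kC TYPE('k::field)) n)" shows "trunc n (untrunc n v) = v"
  using assms unfolding free_carrier by (auto simp: trunc_def untrunc_def fun_eq_iff lin_carrier_iff)

lemma trunc_add: "trunc n (v + w) = trunc n v \<oplus>\<^bsub>free_module (kC TYPE('k::field)) n\<^esub> trunc n w"
  by (auto simp: trunc_def fun_eq_iff category_algebra_simps(3))

lemma trunc_scale:
  "trunc n (\<lambda>i u. c * v i u) = scalar c \<odot>\<^bsub>free_module (kC TYPE('k::field)) n\<^esub> trunc n v"
proof
  fix i
  show "trunc n (\<lambda>i u. c * v i u) i = (scalar c \<odot>\<^bsub>free_module (kC TYPE('k::field)) n\<^esub> trunc n v) i"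
  proof (cases "i < n")
    case True
    then have "trunc n v i \<in> lin_carrier (Mor C)" by (simp add: trunc_def lin_carrier_iff)
    from category_algebra_mult_scalar[OF this, of c] show ?thesis using True by (auto simp: trunc_def)
  qed (simp add: trunc_def)
qed

lemma trunc_act:
  assumes "a \<in> Mor C"
  shows "trunc n (\<lambda>i. lact C a (v i)) = basis_vec a \<odot>\<^bsub>free_module (kC TYPE('k::field)) n\<^esub> trunc n v"
proof
  fix i
  have "lact C a (trunc n v i) = lact C a (v i)" if "i < n"
    using that by (intro lact_cong) (simp add: trunc_def)
  then show "trunc n (\<lambda>i. lact C a (v i)) i = (basis_vec a \<odot>\<^bsub>free_module (kC TYPE('k)) n\<^esub> trunc n v) i"
    using assms lact_outside[OF assms] by (auto simp: trunc_def basis_vec_mult fun_eq_iff)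
qed

lemma untrunc_add: "untrunc n (v \<oplus>\<^bsub>free_module (kC TYPE('k::field)) n\<^esub> w) = untrunc n v + untrunc n w"
  by (auto simp: untrunc_def fun_eq_iff category_algebra_simps(3))

lemma untrunc_zero: "untrunc n \<zero>\<^bsub>free_module (kC TYPE('k::field)) n\<^esub> = 0"
  by (auto simp: untrunc_def fun_eq_iff category_algebra_simps(2))

lemma untrunc_smult:
  "untrunc n (a \<odot>\<^bsub>free_module (kC TYPE('k::field)) n\<^esub> v)
    = (\<Sum>g\<in>Mor C. (\<lambda>i u. a g * lact C g (untrunc n v i) u))"
  by (auto simp: untrunc_def fun_eq_iff sum_fun_apply category_algebra_mult)

lemma untrunc_scalar:
  assumes "v \<in> carrier (free_module (kC TYPE('k::field)) n)"
  shows "untrunc n (scalar c \<odot>\<^bsub>free_module (kC TYPE('k)) n\<^esub> v) = (\<lambda>i u. c * untrunc n v i u)"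
  using assms category_algebra_mult_scalar unfolding free_carrier by (auto simp: untrunc_def fun_eq_iff)

lemma untrunc_inj:
  assumes "v \<in> carrier (free_module (kC TYPE('k::field)) n)" "w \<in> carrier (free_module (kC TYPE('k::field)) n)"
    "untrunc n v = untrunc n w"
  shows "v = w"
  using trunc_untrunc[OF assms(1)] trunc_untrunc[OF assms(2)] assms(3) by metis

end

text \<open>The extension theorem is applied to the spaces of all functions, with \<open>om\<close> the multiplication by the
  left weight; the result is restricted to the free module again.\<close>

theorem (in weighted_category) kernel_extension_category_algebra:
  "kernel_extension (category_algebra C :: ('k, 'm \<Rightarrow> 'k) module)"
  unfolding kernel_extension_def
proof (intro allI impI)
  let ?A = "kC TYPE('k)"
  fix n m p f
  assume p: "p \<in> module_hom ?A (free_module ?A n) (free_module ?A m)"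
    and fc: "\<forall>v\<in>ker_on ?A n m p. f v \<in> carrier ?A"
    and fadd: "\<forall>v\<in>ker_on ?A n m p. \<forall>w\<in>ker_on ?A n m p. f (v \<oplus>\<^bsub>free_module ?A n\<^esub> w) = f v \<oplus>\<^bsub>?A\<^esub> f w"
    and fsm: "\<forall>a\<in>carrier ?A. \<forall>v\<in>ker_on ?A n m p. f (a \<odot>\<^bsub>free_module ?A n\<^esub> v) = a \<otimes>\<^bsub>?A\<^esub> f v"
  interpret A: ring ?A by (rule ring_category_algebra)
  interpret Fn: left_module ?A "free_module ?A n" by (rule A.left_module_free_module)
  let ?sV = "\<lambda>c (v :: nat \<Rightarrow> 'm \<Rightarrow> 'k) i u. c * v i u" and ?aV = "\<lambda>a (v :: nat \<Rightarrow> 'm \<Rightarrow> 'k) i. lact C a (v i)"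
  let ?sW = "\<lambda>c (v :: 'm \<Rightarrow> 'k) u. c * v u"
  interpret V: category_rep C ?sV ?aV by (rule category_rep_functions)
  interpret W: category_rep C ?sW "lact C" by (rule category_rep_function)
  interpret VV: vector_space_pair ?sV ?sV by unfold_locales
  define p' where "p' v = untrunc m (p (trunc n v))" for v
  have pt: "p (trunc n v) \<in> carrier (free_module ?A m)" for v using module_homD(1)[OF p trunc_in] .
  have sA: "scalar c \<in> carrier ?A" for c :: 'k using scalar_in by (simp add: category_algebra_simps(1))
  have bA: "basis_vec a \<in> carrier ?A" if "a \<in> Mor C" for a using basis_vec_in[OF that] by (simp add: category_algebra_simps(1))
  have p'_lin: "Vector_Spaces.linear ?sV ?sV p'"
  proof
    show "p' (v + w) = p' v + p' w" for v w
      unfolding p'_def trunc_add module_homD(3)[OF p trunc_in trunc_in] untrunc_add ..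
    show "p' (?sV c v) = ?sV c (p' v)" for c v
      unfolding p'_def trunc_scale module_homD(4)[OF p sA trunc_in] untrunc_scalar[OF pt] ..
  qed
  have p'_act: "p' (?aV a v) = ?aV a (p' v)" if a: "a \<in> Mor C" for a v
  proof -
    have "p' (?aV a v) = (\<Sum>g\<in>Mor C. (\<lambda>i u. basis_vec a g * lact C g (p' v i) u))"
      unfolding p'_def trunc_act[OF a] module_homD(4)[OF p bA[OF a] trunc_in] untrunc_smult ..
    also have "\<dots> = (\<Sum>g\<in>Mor C. if g = a then ?aV a (p' v) else 0)"
      by (intro sum.cong) (auto simp: basis_vec_apply fun_eq_iff)
    also have "\<dots> = ?aV a (p' v)" using a finite_Mor by simp
    finally show ?thesis .
  qed
  have ker_iff: "p' v = 0 \<longleftrightarrow> trunc n v \<in> ker_on ?A n m p" for v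
  proof -
    have z: "\<zero>\<^bsub>free_module ?A m\<^esub> \<in> carrier (free_module ?A m)"
      using left_module.axioms(2)[OF A.left_module_free_module] abelian_group.axioms(1) abelian_monoid.zero_closed by blast
    have "p' v = 0 \<longleftrightarrow> untrunc m (p (trunc n v)) = untrunc m \<zero>\<^bsub>free_module ?A m\<^esub>"
      unfolding p'_def untrunc_zero ..
    also have "\<dots> \<longleftrightarrow> p (trunc n v) = \<zero>\<^bsub>free_module ?A m\<^esub>"
    proof
      assume "untrunc m (p (trunc n v)) = untrunc m \<zero>\<^bsub>free_module ?A m\<^esub>"
      then show "p (trunc n v) = \<zero>\<^bsub>free_module ?A m\<^esub>" by (rule untrunc_inj[OF pt z])
    qed (simp only:)
    finally show ?thesis using trunc_in[of n v] by (simp only: ker_on_def mem_Collect_eq simp_thms)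
  qed
  define f' where "f' v = f (trunc n v)" for v
  \<comment> \<open>the coefficient at \<open>u\<close> is \<open>w u\<close> times the sum of \<open>lam\<close> over the orbit of \<open>u\<close>\<close>
  have om: "(\<Sum>g\<in>hom y y. lact C g ((\<lambda>w u. lam u * w u) (lact C (inve g) w))) = lact C (Idt C y) w"
    if y: "y \<in> Obj C" for y and w :: "'m \<Rightarrow> 'k"
  proof
    fix u
    show "(\<Sum>g\<in>hom y y. lact C g ((\<lambda>w u. lam u * w u) (lact C (inve g) w))) u = lact C (Idt C y) w u"
    proof (cases "u \<in> Mor C \<and> Cod C u = y")
      case True
      then have u: "u \<in> hom (Dom C u) y" using Mor_hom by metis
      have "lact C g ((\<lambda>w u. lam u * w u) (lact C (inve g) w)) u = lam (inve g \<cdot> u) * w u" if g: "g \<in> hom y y" for g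
        unfolding lact_group[OF g u] lact_group[OF inve_in[OF g] comp_in[OF u inve_in[OF g]]]
        using inve_inve[OF g] cancel_left1[OF g u] by simp
      then have "(\<Sum>g\<in>hom y y. lact C g ((\<lambda>w u. lam u * w u) (lact C (inve g) w))) u
          = (\<Sum>g\<in>hom y y. lam (inve g \<cdot> u)) * w u"
        by (simp add: sum_fun_apply sum_distrib_right)
      also have "(\<Sum>g\<in>hom y y. lam (inve g \<cdot> u)) = 1"
        using sum_inve[of "\<lambda>g. lam (g \<cdot> u)"] left_weight[OF u] by simp
      finally show ?thesis using True by (simp add: lact_Idt[OF y])
    next
      case False
      then have "lact C g v u = 0" if "g \<in> hom y y" for g and v :: "'m \<Rightarrow> 'k"
        using lact_outside[OF HomD(1)[OF that]] HomD(3)[OF that] by blast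
      then show ?thesis using id_in[OF y] by (simp add: sum_fun_apply)
    qed
  qed
  have "\<exists>F. Vector_Spaces.linear ?sV ?sW F \<and> (\<forall>a\<in>Mor C. \<forall>v. F (?aV a v) = lact C a (F v))
    \<and> (\<forall>v. p' v = 0 \<longrightarrow> F v = (\<Sum>y\<in>Obj C. lact C (Idt C y) (f' v)))"
  proof (rule extension_of_homs[OF V.category_rep_axioms V.category_rep_axioms W.category_rep_axioms p'_lin,
        where f = f' and om = "\<lambda>w u. lam u * w u"])
    show "Vector_Spaces.linear ?sW ?sW (\<lambda>w u. lam u * w u)"
      by unfold_locales (auto simp: fun_eq_iff algebra_simps)
    show "f' (v + w) = f' v + f' w" if "p' v = 0" "p' w = 0" for v w
      using fadd that unfolding ker_iff f'_def trunc_add by (simp only: category_algebra_simps(3))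
    show "f' (?sV c v) = ?sW c (f' v)" if "p' v = 0" for c v
    proof -
      have "f' (?sV c v) = scalar c \<otimes>\<^bsub>?A\<^esub> f' v"
        using fsm sA that unfolding ker_iff f'_def trunc_scale by blast
      moreover have "f' v \<in> lin_carrier (Mor C)"
        using fc that unfolding ker_iff f'_def by (simp add: category_algebra_simps(1))
      ultimately show ?thesis using category_algebra_mult_scalar[of "f' v" c] by (simp only:)
    qed
    show "f' (?aV a v) = lact C a (f' v)" if "a \<in> Mor C" "p' v = 0" for a v
    proof -
      have "f (basis_vec a \<odot>\<^bsub>free_module ?A n\<^esub> trunc n v) = basis_vec a \<otimes>\<^bsub>?A\<^esub> f (trunc n v)"
        using fsm bA[OF that(1)] that(2) unfolding ker_iff by blast
      then show ?thesis unfolding f'_def trunc_act[OF that(1)] by (simp only: basis_vec_mult[OF that(1)])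
    qed
    show "category_rep.rad_free C ?aV" by (rule rad_free_functions)
    show "p' (?aV a v) = ?aV a (p' v)" if "a \<in> Mor C" for a v by (rule p'_act[OF that])
    show "(\<Sum>g\<in>hom y y. lact C g ((\<lambda>u. lam u * lact C (inve g) w u))) = lact C (Idt C y) w"
      if "y \<in> Obj C" for y and w :: "'m \<Rightarrow> 'k" by (rule om[OF that])
  qed
  then obtain F where F: "Vector_Spaces.linear ?sV ?sW F" "\<And>a v. a \<in> Mor C \<Longrightarrow> F (?aV a v) = lact C a (F v)"
    "\<And>v. p' v = 0 \<Longrightarrow> F v = (\<Sum>y\<in>Obj C. lact C (Idt C y) (f' v))" by blast
  interpret F: linear ?sV ?sW F by (rule F(1))
  define g where "g = (\<lambda>v\<in>carrier (free_module ?A n). \<lambda>u. if u \<in> Mor C then F (untrunc n v) u else 0)"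
  have g: "g v = (\<lambda>u. if u \<in> Mor C then F (untrunc n v) u else 0)" if "v \<in> carrier (free_module ?A n)" for v
    using that by (simp add: g_def)
  have "g \<in> module_hom ?A (free_module ?A n) (regular_module ?A)"
  proof (rule module_homI)
    show "g v \<in> carrier (regular_module ?A)" if "v \<in> carrier (free_module ?A n)" for v
      using that by (simp add: g category_algebra_simps(1) lin_carrier_iff)
    show "g v = undefined" if "v \<notin> carrier (free_module ?A n)" for v
      using that by (simp only: g_def restrict_apply if_False)
    show "g (v \<oplus>\<^bsub>free_module ?A n\<^esub> w) = g v \<oplus>\<^bsub>regular_module ?A\<^esub> g w"
      if "v \<in> carrier (free_module ?A n)" "w \<in> carrier (free_module ?A n)" for v w
      unfolding g[OF that(1)] g[OF that(2)] g[OF Fn.M.a_closed[OF that]] untrunc_add F.add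
      by (auto simp: category_algebra_simps(3) fun_eq_iff)
    show "g (a \<odot>\<^bsub>free_module ?A n\<^esub> v) = a \<odot>\<^bsub>regular_module ?A\<^esub> g v"
      if a: "a \<in> carrier ?A" and v: "v \<in> carrier (free_module ?A n)" for a v
    proof
      fix u
      have "F (untrunc n (a \<odot>\<^bsub>free_module ?A n\<^esub> v)) = (\<Sum>h\<in>Mor C. F (?sV (a h) (?aV h (untrunc n v))))"
        unfolding untrunc_smult F.sum ..
      also have "\<dots> = (\<Sum>h\<in>Mor C. ?sW (a h) (lact C h (F (untrunc n v))))"
        by (intro sum.cong refl) (simp only: F.scale F(2))
      also have "\<dots> = (\<Sum>h\<in>Mor C. ?sW (a h) (lact C h (g v)))"
      proof (intro sum.cong refl)
        fix h
        have "lact C h (F (untrunc n v)) = lact C h (g v)" unfolding g[OF v] by (rule lact_cong) simp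
        then show "?sW (a h) (lact C h (F (untrunc n v))) = ?sW (a h) (lact C h (g v))" by simp
      qed
      finally have *: "F (untrunc n (a \<odot>\<^bsub>free_module ?A n\<^esub> v)) u = (a \<otimes>\<^bsub>?A\<^esub> g v) u"
        by (simp add: category_algebra_mult sum_fun_apply)
      show "g (a \<odot>\<^bsub>free_module ?A n\<^esub> v) u = (a \<odot>\<^bsub>regular_module ?A\<^esub> g v) u"
        using category_algebra_mult_closed[of a "g v"] *
        unfolding g[OF Fn.smult_closed[OF a v]] regular_module_simps by (simp add: lin_carrier_iff)
    qed
  qed
  moreover have "g v = f v" if v: "v \<in> ker_on ?A n m p" for v
  proof
    fix u
    have vc: "v \<in> carrier (free_module ?A n)" using v unfolding ker_on_def by blast
    have "p' (untrunc n v) = 0" unfolding ker_iff trunc_untrunc[OF vc] by (rule v)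
    then have "F (untrunc n v) = (\<Sum>y\<in>Obj C. lact C (Idt C y) (f v))"
      using F(3) by (simp only: f'_def trunc_untrunc[OF vc])
    then have "F (untrunc n v) u = (if u \<in> Mor C then f v u else 0)"
      by (simp add: sum_fun_apply sum_lact_Idt)
    moreover have "f v \<in> lin_carrier (Mor C)" using fc v by (simp add: category_algebra_simps(1))
    ultimately show "g v u = f v u" unfolding g[OF vc] by (simp add: lin_carrier_iff)
  qed
  ultimately show "\<exists>g\<in>module_hom ?A (free_module ?A n) (regular_module ?A). \<forall>v\<in>ker_on ?A n m p. g v = f v" by blast
qed

lemma (in ei_category) category_algebra_mult_sum_right:
  "a \<otimes>\<^bsub>kC TYPE('k::field)\<^esub> (\<Sum>j\<in>J. v j) = (\<Sum>j\<in>J. a \<otimes>\<^bsub>kC TYPE('k)\<^esub> v j)"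
proof
  fix u
  have e: "(\<Sum>j\<in>J. v j) = (\<lambda>u. \<Sum>j\<in>J. v j u)" by (simp add: sum_fun_apply fun_eq_iff)
  have "(a \<otimes>\<^bsub>kC TYPE('k)\<^esub> (\<Sum>j\<in>J. v j)) u = (\<Sum>g\<in>Mor C. \<Sum>j\<in>J. a g * lact C g (v j) u)"
    unfolding e category_algebra_mult lact_sum sum_distrib_left ..
  also have "\<dots> = (\<Sum>j\<in>J. \<Sum>g\<in>Mor C. a g * lact C g (v j) u)" by (rule sum.swap)
  finally show "(a \<otimes>\<^bsub>kC TYPE('k)\<^esub> (\<Sum>j\<in>J. v j)) u = (\<Sum>j\<in>J. a \<otimes>\<^bsub>kC TYPE('k)\<^esub> v j) u"
    by (simp add: sum_fun_apply category_algebra_mult)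
qed

text \<open>A submodule of a free module is a subspace of a finite dimensional vector space; a linear basis of it
  generates it as a module.\<close>

theorem (in ei_category) fg_submodules_category_algebra:
  "fg_submodules (category_algebra C :: ('k::field, 'm \<Rightarrow> 'k) module)"
  unfolding fg_submodules_def
proof (intro allI impI)
  let ?A = "kC TYPE('k)"
  fix n K assume K: "submod ?A (free_module ?A n) K"
  interpret A: ring ?A by (rule ring_category_algebra)
  let ?sV = "\<lambda>c (v :: nat \<Rightarrow> 'm \<Rightarrow> 'k) i u. c * v i u"
  interpret V: category_rep C ?sV "\<lambda>a v i. lact C a (v i)" by (rule category_rep_functions)
  let ?K = "untrunc n ` K"
  have Kc: "v \<in> carrier (free_module ?A n)" if "v \<in> K" for v using K that unfolding submod_def by blast
  have sA: "scalar c \<in> carrier ?A" for c :: 'k using scalar_in by (simp add: category_algebra_simps(1))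
  have sub: "V.subspace ?K"
  proof (rule V.subspaceI)
    have "\<zero>\<^bsub>free_module ?A n\<^esub> \<in> K" using K unfolding submod_def by blast
    from imageI[OF this, of "untrunc n"] show "0 \<in> ?K" unfolding untrunc_zero .
    show "x + y \<in> ?K" if xy: "x \<in> ?K" "y \<in> ?K" for x y
    proof -
      obtain v w where "v \<in> K" "x = untrunc n v" "w \<in> K" "y = untrunc n w" using xy by blast
      moreover from this have "v \<oplus>\<^bsub>free_module ?A n\<^esub> w \<in> K" using K unfolding submod_def by blast
      ultimately show ?thesis using untrunc_add[of n v w] by (metis imageI)
    qed
    show "?sV c x \<in> ?K" if x: "x \<in> ?K" for c x
    proof -
      obtain v where v: "v \<in> K" "x = untrunc n v" using x by blast
      have "scalar c \<odot>\<^bsub>free_module ?A n\<^esub> v \<in> K" using K v(1) sA unfolding submod_def by blast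
      from imageI[OF this, of "untrunc n"] show ?thesis unfolding untrunc_scalar[OF Kc[OF v(1)]] v(2) .
    qed
  qed
  define e :: "nat \<times> 'm \<Rightarrow> nat \<Rightarrow> 'm \<Rightarrow> 'k" where "e = (\<lambda>(i, u) j w. if j = i \<and> w = u then 1 else (0 :: 'k))"
  let ?T = "e ` ({..<n} \<times> Mor C)"
  have finT: "finite ?T" using finite_Mor by simp
  have "?K \<subseteq> V.span ?T"
  proof
    fix x assume "x \<in> ?K"
    then obtain v where v: "v \<in> K" "x = untrunc n v" by blast
    have "x = (\<Sum>iu\<in>{..<n} \<times> Mor C. ?sV (x (fst iu) (snd iu)) (e iu))"
    proof (intro ext)
      fix j w
      have "(\<Sum>iu\<in>{..<n} \<times> Mor C. ?sV (x (fst iu) (snd iu)) (e iu)) j w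
          = (\<Sum>iu\<in>{..<n} \<times> Mor C. if iu = (j, w) then x j w else 0)"
        unfolding sum_fun_apply by (intro sum.cong) (auto simp: e_def split: if_splits)
      also have "\<dots> = (if j < n \<and> w \<in> Mor C then x j w else 0)" using finite_Mor by simp
      also have "\<dots> = x j w"
        using Kc[OF v(1)] unfolding v(2) free_carrier by (auto simp: untrunc_def lin_carrier_iff)
      finally show "x j w = (\<Sum>iu\<in>{..<n} \<times> Mor C. ?sV (x (fst iu) (snd iu)) (e iu)) j w" by simp
    qed
    moreover have "(\<Sum>iu\<in>{..<n} \<times> Mor C. ?sV (x (fst iu) (snd iu)) (e iu)) \<in> V.span ?T"
      by (intro V.span_sum V.span_scale V.span_base) auto
    ultimately show "x \<in> V.span ?T" by simp
  qed
  moreover obtain B where B: "B \<subseteq> ?K" "V.independent B" "?K \<subseteq> V.span B" using V.basis_exists by metis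
  ultimately have finB: "finite B" using V.independent_span_bound[OF finT B(2)] by blast
  obtain h where h: "bij_betw h {..<card B} B"
    using ex_bij_betw_nat_finite[OF finB] by (auto simp: atLeast0LessThan)
  let ?m = "card B"
  define b where "b j = trunc n (h j)" for j
  have b: "b j \<in> K" "untrunc n (b j) = h j" if "j < ?m" for j
  proof -
    have "h j \<in> ?K" using h B(1) that by (auto simp: bij_betw_def)
    then obtain v where "v \<in> K" "h j = untrunc n v" by blast
    then show "b j \<in> K" "untrunc n (b j) = h j" using trunc_untrunc[OF Kc] by (simp_all add: b_def)
  qed
  define d where "d = (\<lambda>w\<in>carrier (free_module ?A ?m). \<lambda>i\<in>{..<n}. \<Sum>j<?m. w j \<otimes>\<^bsub>?A\<^esub> b j i)"
  have d: "d w = (\<lambda>i\<in>{..<n}. \<Sum>j<?m. w j \<otimes>\<^bsub>?A\<^esub> b j i)" if "w \<in> carrier (free_module ?A ?m)" for w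
    using that by (simp add: d_def)
  have dc: "d w \<in> carrier (free_module ?A n)" if "w \<in> carrier (free_module ?A ?m)" for w
    unfolding d[OF that] free_carrier using category_algebra_mult_closed
    by (auto simp: lin_carrier_iff sum_fun_apply intro!: sum.neutral)
  have ud: "untrunc n (d w) = (\<Sum>j<?m. untrunc n (w j \<odot>\<^bsub>free_module ?A n\<^esub> b j))"
    if "w \<in> carrier (free_module ?A ?m)" for w
    unfolding d[OF that] by (auto simp: untrunc_def fun_eq_iff sum_fun_apply)
  interpret Fm: left_module ?A "free_module ?A ?m" by (rule A.left_module_free_module)
  have "d \<in> module_hom ?A (free_module ?A ?m) (free_module ?A n)"
  proof (rule module_homI)
    show "d w = undefined" if "w \<notin> carrier (free_module ?A ?m)" for w
      using that by (simp only: d_def restrict_apply if_False)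
    show "d (v \<oplus>\<^bsub>free_module ?A ?m\<^esub> w) = d v \<oplus>\<^bsub>free_module ?A n\<^esub> d w"
      if v: "v \<in> carrier (free_module ?A ?m)" and w: "w \<in> carrier (free_module ?A ?m)" for v w
      unfolding d[OF v] d[OF w] d[OF Fm.M.a_closed[OF v w]]
      by (auto simp: category_algebra_mult category_algebra_simps(3) fun_eq_iff sum_fun_apply algebra_simps sum.distrib)
    show "d (a \<odot>\<^bsub>free_module ?A ?m\<^esub> w) = a \<odot>\<^bsub>free_module ?A n\<^esub> d w"
      if a: "a \<in> carrier ?A" and w: "w \<in> carrier (free_module ?A ?m)" for a w
      unfolding d[OF w] d[OF Fm.smult_closed[OF a w]]
      by (auto simp: category_algebra_mult_sum_right category_algebra_assoc intro!: restrict_ext sum.cong)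
  qed (rule dc)
  moreover have "d ` carrier (free_module ?A ?m) = K"
  proof
    show "d ` carrier (free_module ?A ?m) \<subseteq> K"
    proof
      fix v assume "v \<in> d ` carrier (free_module ?A ?m)"
      then obtain w where w: "w \<in> carrier (free_module ?A ?m)" "v = d w" by (metis imageE)
      have "untrunc n (w j \<odot>\<^bsub>free_module ?A n\<^esub> b j) \<in> ?K" if "j < ?m" for j
      proof (rule imageI)
        have "w j \<in> carrier ?A" using w(1) that unfolding free_carrier by (simp add: category_algebra_simps(1))
        then show "w j \<odot>\<^bsub>free_module ?A n\<^esub> b j \<in> K" using K b(1)[OF that] unfolding submod_def by blast
      qed
      then have "untrunc n v \<in> ?K"
        unfolding w(2) ud[OF w(1)] by (intro V.subspace_sum[OF sub]) blast
      then obtain k where "k \<in> K" "untrunc n v = untrunc n k" by blast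
      then show "v \<in> K" using untrunc_inj[OF dc[OF w(1)] Kc, of k] w(2) by simp
    qed
    show "K \<subseteq> d ` carrier (free_module ?A ?m)"
    proof
      fix v assume v: "v \<in> K"
      then have "untrunc n v \<in> V.span B" using B(3) by blast
      then obtain c where c: "untrunc n v = (\<Sum>x\<in>B. ?sV (c x) x)"
        unfolding V.span_finite[OF finB] by auto
      define w where "w = (\<lambda>j\<in>{..<?m}. scalar (c (h j)))"
      have w: "w \<in> carrier (free_module ?A ?m)"
        unfolding free_carrier using scalar_in by (auto simp: w_def)
      have "untrunc n (d w) = (\<Sum>j<?m. ?sV (c (h j)) (h j))"
        unfolding ud[OF w]
      proof (rule sum.cong[OF refl])
        fix j assume "j \<in> {..<?m}"
        then have j: "j < ?m" by simp
        have "w j = scalar (c (h j))" using j by (simp add: w_def)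
        then show "untrunc n (w j \<odot>\<^bsub>free_module ?A n\<^esub> b j) = ?sV (c (h j)) (h j)"
          using untrunc_scalar[OF Kc[OF b(1)[OF j]], of "c (h j)"] b(2)[OF j] by (simp only:)
      qed
      also have "\<dots> = untrunc n v"
        unfolding c by (rule sum.reindex_bij_betw[OF h])
      finally have "d w = v" using untrunc_inj[OF dc[OF w] Kc[OF v]] by blast
      then show "v \<in> d ` carrier (free_module ?A ?m)" using w by blast
    qed
  qed
  ultimately show "\<exists>m. \<exists>d\<in>module_hom ?A (free_module ?A m) (free_module ?A n). d ` carrier (free_module ?A m) = K"
    by blast
qed

section \<open>The functor E and its embedding into the category algebra\<close>

lemma unfactorizable_op_cat [simp]: "unfactorizable (op_cat C) u \<longleftrightarrow> unfactorizable C u"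
  unfolding unfactorizable_def by auto

lemma (in ei_category) lact_fsum: "lact C a (\<Sum>i\<in>I. v i) = (\<Sum>i\<in>I. lact C a (v i))"
  by (induction I rule: infinite_finite_induct)
    (simp_all only: sum.infinite sum.empty sum.insert not_False_eq_True lact_0 lact_add)

lemma (in levi_category) first_unfactorizable:
  assumes "f \<in> hom x y" "x \<noteq> y"
  obtains z u b where "u \<in> hom x z" "unfactorizable C u" "b \<in> hom z y" "f = b \<cdot> u"
proof -
  interpret op: levi_category "op_cat C" by (rule levi_category_op_cat)
  show ?thesis using op.last_unfactorizable[of f y x] assms that by auto
qed

context weighted_category
begin

definition smul :: "'k \<Rightarrow> ('m \<Rightarrow> 'k) \<Rightarrow> 'm \<Rightarrow> 'k" where "smul c v = (\<lambda>u. c * v u)"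

lemma lact_smul: "lact C a (smul c v) = smul c (lact C a v)"
  by (simp add: smul_def lact_scale)

definition group_sum :: "'o \<Rightarrow> 'm \<Rightarrow> 'k" where
  "group_sum x = (\<Sum>g\<in>hom x x. basis_vec g)"

text \<open>For \<open>c = b \<circ> u\<close> with \<open>u : x \<rightarrow> z\<close> unfactorizable, \<open>tau c\<close> replaces \<open>u\<close> by the element
  \<open>\<Sum>\<^sub>g rho (g\<^sup>-\<^sup>1 u) g\<close> of the group algebra at \<open>z\<close>.  The coefficients are chosen such that summing over
  \<open>u G\<^sub>x\<close> yields the plain sum of the elements of \<open>G\<^sub>z\<close> (\<open>sum_tau\<close>), which is what the definition of \<open>E\<close>
  on the formal elements calls for.  The factorization is unique up to an automorphism of \<open>z\<close>, which
  only permutes the summands (\<open>tau_eq\<close>).\<close>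

definition tau_factored :: "'m \<Rightarrow> 'm \<Rightarrow> 'm \<Rightarrow> 'k" where
  "tau_factored b u = (\<Sum>g\<in>hom (Cod C u) (Cod C u). smul (rho (inve g \<cdot> u)) (basis_vec (b \<cdot> g)))"

definition tau :: "'m \<Rightarrow> 'm \<Rightarrow> 'k" where
  "tau c = (SOME t. \<exists>b u. unfactorizable C u \<and> b \<in> Mor C \<and> Dom C b = Cod C u \<and> c = b \<cdot> u \<and> t = tau_factored b u)"

lemma tau_eq:
  assumes u: "unfactorizable C u" "u \<in> hom x z" and b: "b \<in> hom z y"
  shows "tau (b \<cdot> u) = tau_factored b u"
proof -
  have uniq: "t = tau_factored b u"
    if t: "\<exists>b' u'. unfactorizable C u' \<and> b' \<in> Mor C \<and> Dom C b' = Cod C u' \<and> b \<cdot> u = b' \<cdot> u' \<and> t = tau_factored b' u'" for t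
  proof -
    obtain b' u' where t: "unfactorizable C u'" "b' \<in> Mor C" "Dom C b' = Cod C u'" "b \<cdot> u = b' \<cdot> u'" "t = tau_factored b' u'"
      using t by blast
    let ?z = "Cod C u'"
    have u'M: "u' \<in> Mor C" using t(1) by (simp add: unfactorizable_def)
    have h': "u' \<in> hom (Dom C u') ?z" "b' \<in> hom ?z (Cod C b')" using t u'M Mor_hom by (auto intro: HomI)
    have "Dom C (b' \<cdot> u') = Dom C u'" "Cod C (b' \<cdot> u') = Cod C b'" "Dom C (b \<cdot> u) = x" "Cod C (b \<cdot> u) = y"
      using HomD(2,3)[OF comp_in[OF h']] HomD(2,3)[OF comp_in[OF u(2) b]] by simp_all
    then have h: "u' \<in> hom x ?z" "b' \<in> hom ?z y" using h' t(4) by simp_all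
    obtain k where k: "?z = z" "k \<in> hom z z" "u' = k \<cdot> u" "b = b' \<cdot> k"
      using first_unfactorizable_unique[OF u t(1) h(1) b h(2) t(4)] by blast
    have b': "b' \<in> hom z y" using h k by simp
    have "tau_factored b u = (\<Sum>g\<in>hom z z. smul (rho (inve g \<cdot> u)) (basis_vec (b' \<cdot> (k \<cdot> g))))"
      unfolding tau_factored_def HomD(3)[OF u(2)] k(4) using comp_assoc[OF _ k(2) b'] by (intro sum.cong refl) simp
    also have "\<dots> = (\<Sum>g\<in>hom z z. smul (rho (inve (k \<cdot> g) \<cdot> (k \<cdot> u))) (basis_vec (b' \<cdot> (k \<cdot> g))))"
    proof (intro sum.cong refl)
      fix g assume g: "g \<in> hom z z"
      have "inve (k \<cdot> g) \<cdot> (k \<cdot> u) = inve g \<cdot> (inve k \<cdot> (k \<cdot> u))"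
        unfolding inve_comp[OF k(2) g] using comp_assoc[OF comp_in[OF u(2) k(2)] inve_in[OF k(2)] inve_in[OF g]] by simp
      then show "smul (rho (inve g \<cdot> u)) (basis_vec (b' \<cdot> (k \<cdot> g))) = smul (rho (inve (k \<cdot> g) \<cdot> (k \<cdot> u))) (basis_vec (b' \<cdot> (k \<cdot> g)))"
        using cancel_left2[OF k(2) u(2)] by simp
    qed
    also have "\<dots> = (\<Sum>g\<in>hom z z. smul (rho (inve g \<cdot> (k \<cdot> u))) (basis_vec (b' \<cdot> g)))"
      by (rule sum_left_translate[OF k(2), of "\<lambda>g. smul (rho (inve g \<cdot> (k \<cdot> u))) (basis_vec (b' \<cdot> g))"])
    also have "\<dots> = t" unfolding t(5) tau_factored_def k(1) k(3)[symmetric] ..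
    finally show ?thesis by simp
  qed
  show ?thesis
    unfolding tau_def
  proof (rule someI2[where Q = "\<lambda>t. t = tau_factored b u"])
    show "\<exists>b' u'. unfactorizable C u' \<and> b' \<in> Mor C \<and> Dom C b' = Cod C u' \<and> b \<cdot> u = b' \<cdot> u' \<and> tau_factored b u = tau_factored b' u'"
      using u(1) HomD(1,2)[OF b] HomD(3)[OF u(2)] by (intro exI[of _ b] exI[of _ u]) simp
  qed (rule uniq)
qed

lemma lact_basis_vec_hom: "f \<in> hom x y \<Longrightarrow> a \<in> hom y z \<Longrightarrow> lact C a (basis_vec f :: 'm \<Rightarrow> 'k) = basis_vec (a \<cdot> f)"
  using HomD(1,3)[of f x y] HomD(2)[of a y z] by (simp add: lact_basis_vec)

lemma lact_group_sum: "a \<in> hom x y \<Longrightarrow> lact C a (group_sum x) = (\<Sum>g\<in>hom x x. basis_vec (a \<cdot> g))"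
  unfolding group_sum_def lact_fsum by (intro sum.cong refl) (rule lact_basis_vec_hom)

lemma tau_factored_hom:
  assumes "unfactorizable C u" "u \<in> hom x z"
  shows "tau_factored b u = (\<Sum>g\<in>hom z z. smul (rho (inve g \<cdot> u)) (basis_vec (b \<cdot> g)))"
  unfolding tau_factored_def HomD(3)[OF assms(2)] ..

lemma lact_tau:
  assumes c: "c \<in> hom x y" "x \<noteq> y" and a: "a \<in> hom y w"
  shows "lact C a (tau c) = tau (a \<cdot> c)"
proof -
  obtain z u b where u: "u \<in> hom x z" "unfactorizable C u" "b \<in> hom z y" "c = b \<cdot> u"
    using first_unfactorizable[OF c] .
  have "lact C a (tau c) = (\<Sum>g\<in>hom z z. smul (rho (inve g \<cdot> u)) (basis_vec (a \<cdot> (b \<cdot> g))))"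
    unfolding u(4) tau_eq[OF u(2,1,3)] tau_factored_hom[OF u(2,1)] lact_fsum lact_smul
    using lact_basis_vec_hom[OF comp_in[OF _ u(3)] a] by (intro sum.cong refl) simp
  also have "\<dots> = tau_factored (a \<cdot> b) u"
    unfolding tau_factored_hom[OF u(2,1)] using comp_assoc[OF _ u(3) a] by (intro sum.cong refl) simp
  also have "\<dots> = tau (a \<cdot> c)"
    unfolding u(4) comp_assoc[OF u(1,3) a] by (rule tau_eq[OF u(2,1) comp_in[OF u(3) a], symmetric])
  finally show ?thesis .
qed

lemma sum_tau:
  assumes u: "unfactorizable C u" "u \<in> hom x z" and b: "b \<in> hom z y"
  shows "(\<Sum>g\<in>hom x x. tau ((b \<cdot> u) \<cdot> g)) = lact C b (group_sum z)"
proof -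
  have "(\<Sum>g\<in>hom x x. tau ((b \<cdot> u) \<cdot> g))
      = (\<Sum>g\<in>hom x x. \<Sum>h\<in>hom z z. smul (rho ((inve h \<cdot> u) \<cdot> g)) (basis_vec (b \<cdot> h)))"
  proof (rule sum.cong[OF refl])
    fix g assume g: "g \<in> hom x x"
    have ug: "unfactorizable C (u \<cdot> g)" "u \<cdot> g \<in> hom x z"
      using unfactorizable_comp_iso[OF u g] comp_in[OF g u(2)] by auto
    have "tau ((b \<cdot> u) \<cdot> g) = tau_factored b (u \<cdot> g)"
      using tau_eq[OF ug b] comp_assoc[OF g u(2) b] by simp
    also have "\<dots> = (\<Sum>h\<in>hom z z. smul (rho ((inve h \<cdot> u) \<cdot> g)) (basis_vec (b \<cdot> h)))"
      unfolding tau_factored_hom[OF ug] using comp_assoc[OF g u(2) inve_in] by (intro sum.cong refl) simp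
    finally show "tau ((b \<cdot> u) \<cdot> g) = (\<Sum>h\<in>hom z z. smul (rho ((inve h \<cdot> u) \<cdot> g)) (basis_vec (b \<cdot> h)))" .
  qed
  also have "\<dots> = (\<Sum>h\<in>hom z z. \<Sum>g\<in>hom x x. smul (rho ((inve h \<cdot> u) \<cdot> g)) (basis_vec (b \<cdot> h)))"
    by (rule sum.swap)
  also have "\<dots> = (\<Sum>h\<in>hom z z. basis_vec (b \<cdot> h))"
  proof (rule sum.cong[OF refl])
    fix h assume h: "h \<in> hom z z"
    have "(\<Sum>g\<in>hom x x. rho ((inve h \<cdot> u) \<cdot> g)) = 1" using right_weight[OF comp_in[OF u(2) inve_in[OF h]]] .
    then show "(\<Sum>g\<in>hom x x. smul (rho ((inve h \<cdot> u) \<cdot> g)) (basis_vec (b \<cdot> h))) = basis_vec (b \<cdot> h)"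
      by (simp add: fun_eq_iff sum_fun_apply smul_def flip: sum_distrib_right)
  qed
  also have "\<dots> = lact C b (group_sum z)" using lact_group_sum[OF b] by simp
  finally show ?thesis .
qed

lemma tau_support:
  assumes c: "c \<in> hom x y" "x \<noteq> y" and "tau c d \<noteq> 0"
  shows "\<exists>z. d \<in> hom z y \<and> rank x < rank z"
proof -
  obtain z u b where u: "u \<in> hom x z" "unfactorizable C u" "b \<in> hom z y" "c = b \<cdot> u"
    using first_unfactorizable[OF c] .
  obtain g where "g \<in> hom z z" "smul (rho (inve g \<cdot> u)) (basis_vec (b \<cdot> g)) d \<noteq> 0"
    using assms(3) unfolding u(4) tau_eq[OF u(2,1,3)] tau_factored_hom[OF u(2,1)] sum_fun_apply
    by (meson sum.not_neutral_contains_not_neutral)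
  then have "d = b \<cdot> g" "g \<in> hom z z" by (auto simp: smul_def basis_vec_apply split: if_splits)
  then show ?thesis using comp_in[OF _ u(3)] rank_less[OF u(1)] unfactorizableD(1)[OF u(2,1)] by blast
qed

lemma second_factor_iff:
  assumes "a \<in> hom x y"
  shows "second_factor C a w c \<longleftrightarrow> c \<in> hom w y \<and> w \<noteq> y \<and> (\<exists>a'\<in>hom x w. a = c \<cdot> a')"
proof -
  have "(\<not> iso_mor C c) = (w \<noteq> y)" if "c \<in> hom w y"
    using iso_iff[OF HomD(1)[OF that]] HomD(2,3)[OF that] by simp
  then show ?thesis using HomD(2,3)[OF assms] by (auto simp: second_factor_def)
qed

lemma t_elem_eq:
  assumes a: "a \<in> hom x y" and c: "second_factor C a w c"
  shows "t_elem C a w = (\<Sum>g\<in>hom w w. basis_vec (c \<cdot> g))"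
proof -
  define d where "d = (SOME d. second_factor C a w d)"
  have d: "second_factor C a w d" unfolding d_def using c by (rule someI)
  obtain c' d' where cd: "c \<in> hom w y" "c' \<in> hom x w" "a = c \<cdot> c'" "d \<in> hom w y" "d' \<in> hom x w" "a = d \<cdot> d'"
    using c d unfolding second_factor_iff[OF a] by blast
  obtain h where h: "h \<in> hom w w" "d = c \<cdot> h"
    using factorization_same_object[OF cd(5,4,2,1)] cd(3,6) by auto
  have "Aut C w = hom w w" using Aut_eq HomD(4)[OF cd(1)] by simp
  then have "t_elem C a w = (\<Sum>g\<in>hom w w. basis_vec (d \<cdot> g))"
    by (simp add: t_elem_def d_def fun_eq_iff sum_fun_apply)
  also have "\<dots> = (\<Sum>g\<in>hom w w. basis_vec (c \<cdot> (h \<cdot> g)))"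
    unfolding h(2) using comp_assoc[OF _ h(1) cd(1)] by (intro sum.cong refl) simp
  also have "\<dots> = (\<Sum>g\<in>hom w w. basis_vec (c \<cdot> g))" by (rule sum_left_translate[OF h(1)])
  finally show ?thesis .
qed

lemma V_set_endo: "a \<in> hom x x \<Longrightarrow> V_set C a = {}"
  using hom_antisym by (auto simp: V_set_def second_factor_iff)

text \<open>The set \<open>V\<close> consists of the objects passed by a decomposition into unfactorizables, except the last one;
  precomposing with an unfactorizable morphism adds its domain.\<close>

lemma V_set_comp:
  assumes u: "unfactorizable C u" "u \<in> hom x z" and b: "b \<in> hom z y"
  shows "V_set C (b \<cdot> u) = insert x (V_set C b)" "x \<notin> V_set C b"
    "second_factor C (b \<cdot> u) x (b \<cdot> u)" "second_factor C b w c \<Longrightarrow> second_factor C (b \<cdot> u) w c"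
proof -
  have bu: "b \<cdot> u \<in> hom x y" by (rule comp_in[OF u(2) b])
  have xz: "x \<noteq> z" by (rule unfactorizableD(1)[OF u])
  have xy: "x \<noteq> y" using hom_antisym[OF u(2)] b xz by blast
  have I: "Idt C x \<in> hom x x" using id_in HomD(4)[OF u(2)] by blast
  show s1: "second_factor C (b \<cdot> u) x (b \<cdot> u)"
    unfolding second_factor_iff[OF bu] using bu xy I comp_id_right[OF bu] by metis
  show s2: "second_factor C (b \<cdot> u) w c" if sf: "second_factor C b w c" for w c
  proof -
    obtain b' where c: "c \<in> hom w y" "w \<noteq> y" "b' \<in> hom z w" "b = c \<cdot> b'"
      using sf unfolding second_factor_iff[OF b] by blast
    then show ?thesis unfolding second_factor_iff[OF bu]
      using comp_in[OF u(2) c(3)] comp_assoc[OF u(2) c(3,1)] by metis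
  qed
  show "x \<notin> V_set C b"
    using hom_antisym[OF u(2)] xz unfolding V_set_def second_factor_iff[OF b] by blast
  have "w \<in> insert x (V_set C b)" if w: "w \<in> V_set C (b \<cdot> u)" for w
  proof -
    obtain c a' where c: "w \<in> Obj C" "c \<in> hom w y" "w \<noteq> y" "a' \<in> hom x w" "b \<cdot> u = c \<cdot> a'"
      using w unfolding V_set_def second_factor_iff[OF bu] by blast
    have V: "w \<in> V_set C b" if "d \<in> hom w y" "b' \<in> hom z w" "b = d \<cdot> b'" for d b'
      unfolding V_set_def second_factor_iff[OF b] using c(1,3) that by blast
    from levi[OF u(2) b c(4,2,5)] consider e where "e \<in> hom w z" "u = e \<cdot> a'" "c = b \<cdot> e"
      | e where "e \<in> hom z w" "a' = e \<cdot> u" "b = c \<cdot> e" by blast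
    then show ?thesis
    proof cases
      case (1 e)
      from unfactorizableD(2)[OF u c(4) 1(1,2)] show ?thesis
      proof
        assume "w = z"
        then have e: "e \<in> hom w w" and b': "b \<in> hom w y" using 1 b by auto
        have "b = c \<cdot> inve e" using cancel_right1[OF e b'] 1(3) by simp
        then show ?thesis using V[OF c(2), of "inve e"] inve_in[OF e] \<open>w = z\<close> by simp
      qed simp
    next
      case (2 e)
      then show ?thesis using V[OF c(2)] by simp
    qed
  qed
  moreover have "insert x (V_set C b) \<subseteq> V_set C (b \<cdot> u)"
    using s1 s2 HomD(4)[OF u(2)] unfolding V_set_def by blast
  ultimately show "V_set C (b \<cdot> u) = insert x (V_set C b)" by blast
qed

text \<open>An unfactorizable \<open>a : x \<rightarrow> y\<close> satisfies \<open>E a e\<^sub>x = e\<^sub>y + \<Sum>\<^sub>g a g\<close>.  If \<open>e\<^sub>x\<close> is sent to the sum \<open>N\<^sub>x\<close> of the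
  automorphisms, then \<open>\<Sum>\<^sub>g a g\<close> has to be sent to \<open>a N\<^sub>x - N\<^sub>y\<close>; this explains the correction by \<open>tau\<close>.\<close>

definition emb_basis :: "('o, 'm) E_basis \<Rightarrow> 'm \<Rightarrow> 'k" where
  "emb_basis b = (case b of Formal x \<Rightarrow> group_sum x | Arrow c \<Rightarrow> basis_vec c - tau c)"

definition emb_at :: "'o \<Rightarrow> (('o, 'm) E_basis \<Rightarrow> 'k) \<Rightarrow> 'm \<Rightarrow> 'k" where
  "emb_at x v = (\<Sum>b\<in>E_basis_at C x. smul (v b) (emb_basis b))"

definition arrows_into :: "'o \<Rightarrow> 'm set" where
  "arrows_into x = {f \<in> Mor C. Cod C f = x \<and> Dom C f \<noteq> x}"

lemma arrows_into_iff: "f \<in> arrows_into x \<longleftrightarrow> f \<in> hom (Dom C f) x \<and> Dom C f \<noteq> x"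
  by (auto simp: arrows_into_def Hom_def)

lemma finite_arrows_into [simp]: "finite (arrows_into x)"
  using finite_Mor by (simp add: arrows_into_def)

lemma E_basis_at_eq: "E_basis_at C x = insert (Formal x) (Arrow ` arrows_into x)"
  by (simp add: E_basis_at_def arrows_into_def)

lemma finite_E_basis_at [simp]: "finite (E_basis_at C x)"
  by (simp add: E_basis_at_eq)

lemma sum_E_basis_at:
  "(\<Sum>b\<in>E_basis_at C x. F b) = F (Formal x) + (\<Sum>f\<in>arrows_into x. F (Arrow f))"
  unfolding E_basis_at_eq by (subst sum.insert) (auto simp: sum.reindex inj_on_def)

lemma smul_0 [simp]: "smul 0 v = 0" by (simp add: smul_def fun_eq_iff)
lemma smul_1 [simp]: "smul 1 v = v" by (simp add: smul_def)

lemma emb_at_basis_vec: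
  assumes "b \<in> E_basis_at C x" shows "emb_at x (basis_vec b) = emb_basis b"
proof -
  have "emb_at x (basis_vec b) = (\<Sum>b'\<in>E_basis_at C x. if b' = b then emb_basis b else 0)"
    unfolding emb_at_def by (intro sum.cong) (auto simp: basis_vec_apply)
  then show ?thesis using assms by simp
qed

lemma emb_at_add: "emb_at x (\<lambda>b. v b + w b) = emb_at x v + emb_at x w"
  by (simp add: emb_at_def smul_def fun_eq_iff sum_fun_apply algebra_simps sum.distrib)

lemma emb_at_scale: "emb_at x (\<lambda>b. c * v b) = smul c (emb_at x v)"
  by (simp add: emb_at_def smul_def fun_eq_iff sum_fun_apply sum_distrib_left mult.assoc)

lemma emb_at_0: "emb_at x (\<lambda>b. 0) = 0"
  by (simp add: emb_at_def)

lemma emb_at_sum: "emb_at x (\<lambda>b. \<Sum>i\<in>I. v i b) = (\<Sum>i\<in>I. emb_at x (v i))"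
  by (induction I rule: infinite_finite_induct) (simp_all add: emb_at_0 emb_at_add)

lemma emb_at_arrow_part_t_elem:
  assumes a: "a \<in> hom x y" and c: "second_factor C a w c"
  shows "emb_at y (arrow_part (t_elem C a w)) = (\<Sum>g\<in>hom w w. basis_vec (c \<cdot> g) - tau (c \<cdot> g))"
proof -
  have cw: "c \<in> hom w y" "w \<noteq> y" using c unfolding second_factor_iff[OF a] by blast+
  have "(arrow_part (t_elem C a w) :: ('o, 'm) E_basis \<Rightarrow> 'k)
      = (\<lambda>b. \<Sum>g\<in>hom w w. basis_vec (Arrow (c \<cdot> g)) b)"
    unfolding t_elem_eq[OF a c] by (auto simp: fun_eq_iff arrow_part_def sum_fun_apply basis_vec_apply split: E_basis.split)
  then have "emb_at y (arrow_part (t_elem C a w)) = (\<Sum>g\<in>hom w w. emb_at y (basis_vec (Arrow (c \<cdot> g))))"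
    by (simp only: emb_at_sum)
  also have "\<dots> = (\<Sum>g\<in>hom w w. basis_vec (c \<cdot> g) - tau (c \<cdot> g))"
  proof (rule sum.cong[OF refl])
    fix g assume "g \<in> hom w w"
    from comp_in[OF this cw(1)] have "Arrow (c \<cdot> g) \<in> E_basis_at C y"
      using HomD(1-3)[of "c \<cdot> g" w y] cw(2) by (simp add: E_basis_at_eq arrows_into_def)
    then show "emb_at y (basis_vec (Arrow (c \<cdot> g))) = basis_vec (c \<cdot> g) - tau (c \<cdot> g)"
      by (simp add: emb_at_basis_vec emb_basis_def)
  qed
  finally show ?thesis .
qed

text \<open>Write \<open>a = b \<circ> u\<close> with \<open>u : x \<rightarrow> z\<close> unfactorizable.  Compared with \<open>b\<close>, the only new summand of
  \<open>E a e\<^sub>x\<close> is the one for the object \<open>x\<close>, and it contributes \<open>a N\<^sub>x - b N\<^sub>z\<close>.  Induction on the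
  difference of the ranks makes the sum telescope.\<close>

lemma emb_at_E_on_basis_Formal:
  assumes "a \<in> hom x y"
  shows "emb_at y (E_on_basis C a (Formal x)) = lact C a (group_sum x)"
  using assms
proof (induction "rank y - rank x" arbitrary: x a rule: less_induct)
  case less
  have E: "emb_at y (E_on_basis C a (Formal x))
      = group_sum y + (\<Sum>w\<in>V_set C a. emb_at y (arrow_part (t_elem C a w)))" if a: "a \<in> hom x y" for a x
  proof -
    have "Formal y \<in> E_basis_at C y" by (simp add: E_basis_at_eq)
    then show ?thesis
      using HomD(3)[OF a] by (simp add: emb_at_add emb_at_sum emb_at_basis_vec emb_basis_def)
  qed
  show ?case
  proof (cases "x = y")
    case True
    then have a: "a \<in> hom x x" using less.prems by simp
    show ?thesis
      unfolding E[OF less.prems] V_set_endo[OF a] lact_group_sum[OF a]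
      using sum_left_translate[OF a, of "basis_vec :: 'm \<Rightarrow> 'm \<Rightarrow> 'k"] True by (simp add: group_sum_def)
  next
    case False
    obtain z u b where u: "u \<in> hom x z" "unfactorizable C u" "b \<in> hom z y" "a = b \<cdot> u"
      using first_unfactorizable[OF less.prems False] .
    note V = V_set_comp[OF u(2,1,3)]
    have bu: "b \<cdot> u \<in> hom x y" using comp_in[OF u(1,3)] .
    have finV: "finite (V_set C b)" using finite_Obj by (simp add: V_set_def)
    have "rank x < rank z" using rank_less[OF u(1) unfactorizableD(1)[OF u(2,1)]] .
    moreover have "rank z \<le> rank y" using rank_less[OF u(3)] by (cases "z = y") auto
    ultimately have IH: "emb_at y (E_on_basis C b (Formal z)) = lact C b (group_sum z)"
      by (intro less.hyps[OF _ u(3)]) simp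
    have t: "t_elem C (b \<cdot> u) w = (t_elem C b w :: 'm \<Rightarrow> 'k)" if "w \<in> V_set C b" for w
    proof -
      obtain c where c: "second_factor C b w c" using \<open>w \<in> V_set C b\<close> unfolding V_set_def by blast
      show ?thesis unfolding t_elem_eq[OF u(3) c] t_elem_eq[OF bu V(4)[OF c]] ..
    qed
    have "emb_at y (E_on_basis C a (Formal x))
        = group_sum y + (emb_at y (arrow_part (t_elem C (b \<cdot> u) x)) + (\<Sum>w\<in>V_set C b. emb_at y (arrow_part (t_elem C (b \<cdot> u) w))))"
      unfolding u(4) E[OF bu] V(1) using V(2) finV by simp
    also have "(\<Sum>w\<in>V_set C b. emb_at y (arrow_part (t_elem C (b \<cdot> u) w))) = (\<Sum>w\<in>V_set C b. emb_at y (arrow_part (t_elem C b w)))"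
      using t by (intro sum.cong) simp_all
    also have "emb_at y (arrow_part (t_elem C (b \<cdot> u) x)) = lact C (b \<cdot> u) (group_sum x) - lact C b (group_sum z)"
      unfolding emb_at_arrow_part_t_elem[OF bu V(3)] sum_subtractf sum_tau[OF u(2,1,3)] lact_group_sum[OF bu] ..
    finally show ?thesis using IH E[OF u(3)] u(4) by simp
  qed
qed

lemma emb_at_E_on_basis:
  assumes a: "a \<in> hom x y" and b: "b \<in> E_basis_at C x"
  shows "emb_at y (E_on_basis C a b) = lact C a (emb_basis b)"
proof -
  consider "b = Formal x" | f where "b = Arrow f" "f \<in> hom (Dom C f) x" "Dom C f \<noteq> x"
    using b by (auto simp: E_basis_at_eq arrows_into_iff)
  then show ?thesis
  proof cases
    case 1
    then show ?thesis using emb_at_E_on_basis_Formal[OF a] by (simp add: emb_basis_def)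
  next
    case (2 f)
    have af: "a \<cdot> f \<in> hom (Dom C f) y" using comp_in[OF 2(2) a] .
    have "Dom C f \<noteq> y" using hom_antisym[OF 2(2)] a 2(3) by blast
    then have "Arrow (a \<cdot> f) \<in> E_basis_at C y" using HomD(1-3)[OF af] by (simp add: E_basis_at_eq arrows_into_def)
    then have "emb_at y (E_on_basis C a b) = basis_vec (a \<cdot> f) - tau (a \<cdot> f)"
      using 2 by (simp add: emb_at_basis_vec emb_basis_def)
    also have "\<dots> = lact C a (basis_vec f) - lact C a (tau f)"
      using lact_basis_vec_hom[OF 2(2) a] lact_tau[OF 2(2,3) a] by simp
    also have "\<dots> = lact C a (basis_vec f - tau f)"
      using lact_add[of a "basis_vec f - tau f" "tau f"] by simp
    finally show ?thesis using 2 by (simp add: emb_basis_def)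
  qed
qed

lemma emb_at_E_mor:
  assumes a: "a \<in> hom x y"
  shows "emb_at y (E_mor C a v) = lact C a (emb_at x v)"
proof -
  have "emb_at y (E_mor C a v) = (\<Sum>b\<in>E_basis_at C x. smul (v b) (emb_at y (E_on_basis C a b)))"
    unfolding E_mor_def HomD(2)[OF a] emb_at_sum emb_at_scale ..
  also have "\<dots> = (\<Sum>b\<in>E_basis_at C x. lact C a (smul (v b) (emb_basis b)))"
    using emb_at_E_on_basis[OF a] by (intro sum.cong refl) (simp add: lact_smul)
  also have "\<dots> = lact C a (emb_at x v)" unfolding emb_at_def lact_fsum ..
  finally show ?thesis .
qed

lemma emb_at_support: "emb_at y v u \<noteq> 0 \<Longrightarrow> u \<in> Mor C \<and> Cod C u = y"
proof -
  assume "emb_at y v u \<noteq> 0"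
  then obtain b where b: "b \<in> E_basis_at C y" "emb_basis b u \<noteq> 0"
    unfolding emb_at_def sum_fun_apply
    by (metis (no_types, lifting) sum.not_neutral_contains_not_neutral smul_def mult_zero_right)
  then consider "b = Formal y" | f where "b = Arrow f" "f \<in> hom (Dom C f) y" "Dom C f \<noteq> y"
    by (auto simp: E_basis_at_eq arrows_into_iff)
  then show ?thesis
  proof cases
    case 1
    then have "(\<Sum>g\<in>hom y y. basis_vec g u) \<noteq> (0 :: 'k)" using b(2) by (simp add: emb_basis_def group_sum_def sum_fun_apply)
    then obtain g where "g \<in> hom y y" "(basis_vec g u :: 'k) \<noteq> 0" by (meson sum.not_neutral_contains_not_neutral)
    then show ?thesis using HomD by (auto simp: basis_vec_apply split: if_splits)
  next
    case (2 f)
    have "u = f \<or> tau f u \<noteq> 0" using b(2) 2(1) by (auto simp: emb_basis_def basis_vec_apply split: if_splits)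
    then show ?thesis using tau_support[OF 2(2,3), of u] 2(2) HomD(1,3) by blast
  qed
qed

text \<open>The correction \<open>tau c\<close> is supported on morphisms whose domain has a larger rank than that of \<open>c\<close>, so the
  coefficients of the arrows vanish by induction on the rank of their domain.  The coefficient of
  the formal element is then read off at the identity.\<close>

lemma emb_at_kernel:
  assumes y: "y \<in> Obj C" and v: "v \<in> lin_carrier (E_basis_at C y)" and z: "emb_at y v = 0"
  shows "v = (\<lambda>b. 0)"
proof -
  have val: "emb_at y v u = v (Formal y) * group_sum y u + (\<Sum>f\<in>arrows_into y. v (Arrow f) * (basis_vec f u - tau f u))" for u
    unfolding emb_at_def sum_E_basis_at by (simp add: sum_fun_apply smul_def emb_basis_def)
  have gs: "group_sum y u = (if u \<in> hom y y then 1 else 0)" for u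
  proof -
    have "group_sum y u = (\<Sum>g\<in>hom y y. if g = u then 1 else 0)"
      unfolding group_sum_def sum_fun_apply by (intro sum.cong) (auto simp: basis_vec_apply)
    then show ?thesis by simp
  qed
  have arrow: "c \<in> arrows_into y \<longrightarrow> v (Arrow c) = 0" for c
  proof (induction "rank (Dom C c)" arbitrary: c rule: less_induct)
    case less
    show ?case
    proof
      assume c: "c \<in> arrows_into y"
      have "v (Arrow f) * tau f c = 0" if f: "f \<in> arrows_into y" for f
      proof (cases "tau f c = 0")
        case False
        then obtain z where z: "c \<in> hom z y" "rank (Dom C f) < rank z"
          using tau_support[of f "Dom C f" y c] f[unfolded arrows_into_iff] by blast
        then have "v (Arrow f) = 0" using less.hyps[of f] f HomD(2)[OF z(1)] by simp
        then show ?thesis by simp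
      qed simp
      then have "(\<Sum>f\<in>arrows_into y. v (Arrow f) * (basis_vec f c - tau f c))
          = (\<Sum>f\<in>arrows_into y. if f = c then v (Arrow c) else 0)"
        by (intro sum.cong refl) (auto simp: basis_vec_apply right_diff_distrib)
      also have "\<dots> = v (Arrow c)" using c by simp
      finally have "(\<Sum>f\<in>arrows_into y. v (Arrow f) * (basis_vec f c - tau f c)) = v (Arrow c)" .
      moreover have "c \<notin> hom y y" using c HomD(2)[of c y y] by (auto simp: arrows_into_def)
      ultimately show "v (Arrow c) = 0" using val[of c] z gs[of c] by simp
    qed
  qed
  have formal: "v (Formal y) = 0"
    using val[of "Idt C y"] z gs[of "Idt C y"] id_in[OF y] arrow by simp
  show ?thesis
  proof
    fix b
    consider "b \<notin> E_basis_at C y" | "b = Formal y" | c where "b = Arrow c" "c \<in> arrows_into y"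
      unfolding E_basis_at_eq by blast
    then show "v b = 0"
    proof cases
      case 1
      then show ?thesis using v by (simp add: lin_carrier_iff)
    qed (use formal arrow in simp_all)
  qed
qed

lemma E_mor_in:
  assumes a: "a \<in> hom x y" shows "E_mor C a v \<in> (lin_carrier (E_basis_at C y) :: (_ \<Rightarrow> 'k) set)"
proof -
  have "E_on_basis C a b b' = (0 :: 'k)" if b: "b \<in> E_basis_at C x" and b': "b' \<notin> E_basis_at C y" for b b'
  proof -
    consider "b = Formal x" | f where "b = Arrow f" "f \<in> hom (Dom C f) x" "Dom C f \<noteq> x"
      using b by (auto simp: E_basis_at_eq arrows_into_iff)
    then show ?thesis
    proof cases
      case 1
      have "arrow_part (t_elem C a w) b' = (0 :: 'k)" if w: "w \<in> V_set C a" for w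
      proof -
        obtain c where c: "second_factor C a w c" using w unfolding V_set_def by blast
        have cw: "c \<in> hom w y" "w \<noteq> y" using c unfolding second_factor_iff[OF a] by blast+
        have "basis_vec (c \<cdot> g) f = (0 :: 'k)" if "b' = Arrow f" "g \<in> hom w w" for g f
          using b' that comp_in[OF that(2) cw(1)] HomD(1-3)[of "c \<cdot> g" w y] cw(2)
          by (auto simp: basis_vec_apply E_basis_at_eq arrows_into_def)
        then show ?thesis unfolding t_elem_eq[OF a c]
          by (auto simp: arrow_part_def sum_fun_apply split: E_basis.split intro!: sum.neutral)
      qed
      moreover have "basis_vec (Formal y) b' = (0 :: 'k)" using b' by (auto simp: basis_vec_apply E_basis_at_eq)
      ultimately show ?thesis using 1 HomD(3)[OF a] by simp
    next
      case (2 f)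
      have af: "a \<cdot> f \<in> hom (Dom C f) y" using comp_in[OF 2(2) a] .
      have "Dom C f \<noteq> y" using hom_antisym[OF 2(2)] a 2(3) by blast
      then have "Arrow (a \<cdot> f) \<in> E_basis_at C y" using HomD(1-3)[OF af] by (simp add: E_basis_at_eq arrows_into_def)
      then show ?thesis using 2 b' by (auto simp: basis_vec_apply)
    qed
  qed
  then show ?thesis by (simp add: lin_carrier_iff E_mor_def HomD(2)[OF a])
qed

end

context weighted_category
begin

abbreviation E :: "('m \<Rightarrow> 'k, 'o \<Rightarrow> ('o, 'm) E_basis \<Rightarrow> 'k) module" where "E \<equiv> E_module C"

definition emb :: "('o \<Rightarrow> ('o, 'm) E_basis \<Rightarrow> 'k) \<Rightarrow> 'm \<Rightarrow> 'k" where
  "emb v = (\<Sum>y\<in>Obj C. emb_at y (v y))"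

lemma E_obj_simps:
  "carrier (E_obj C x :: ('k, ('o, 'm) E_basis \<Rightarrow> 'k) module) = lin_carrier (E_basis_at C x)"
  "zero (E_obj C x :: ('k, ('o, 'm) E_basis \<Rightarrow> 'k) module) = (\<lambda>b. 0)"
  "add (E_obj C x :: ('k, ('o, 'm) E_basis \<Rightarrow> 'k) module) = (\<lambda>v w b. v b + w b)"
  "smult (E_obj C x :: ('k, ('o, 'm) E_basis \<Rightarrow> 'k) module) = (\<lambda>c v b. c * v b)"
  by (simp_all add: E_obj_def lin_space_def)

lemma abelian_group_E_obj: "abelian_group (E_obj C x :: ('k, ('o, 'm) E_basis \<Rightarrow> 'k) module)"
proof (rule abelian_groupI)
  fix v assume "v \<in> carrier (E_obj C x :: ('k, ('o, 'm) E_basis \<Rightarrow> 'k) module)"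
  then show "\<exists>w\<in>carrier (E_obj C x). w \<oplus>\<^bsub>E_obj C x\<^esub> v = \<zero>\<^bsub>E_obj C x :: ('k, ('o, 'm) E_basis \<Rightarrow> 'k) module\<^esub>"
    by (intro bexI[of _ "\<lambda>b. - v b"]) (auto simp: E_obj_simps lin_carrier_iff)
qed (auto simp: E_obj_simps lin_carrier_iff add.assoc add.commute)

lemma E_simps:
  "carrier E = (\<Pi>\<^sub>E x\<in>Obj C. lin_carrier (E_basis_at C x))"
  "zero E = (\<lambda>x\<in>Obj C. \<lambda>b. 0)" "add E = (\<lambda>v w. \<lambda>x\<in>Obj C. \<lambda>b. v x b + w x b)"
  by (simp_all add: E_module_def functor_module_def E_obj_simps)

lemma E_smult: "a \<odot>\<^bsub>E\<^esub> v = (\<lambda>y\<in>Obj C. \<lambda>b. \<Sum>f\<in>{f \<in> Mor C. Cod C f = y}. a f * E_mor C f (v (Dom C f)) b)"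
proof -
  have "(\<Oplus>\<^bsub>E_obj C y\<^esub>f\<in>{f \<in> Mor C. Cod C f = y}. a f \<odot>\<^bsub>E_obj C y\<^esub> E_mor C f (v (Dom C f)))
      = (\<lambda>b. \<Sum>f\<in>{f \<in> Mor C. Cod C f = y}. (a f \<odot>\<^bsub>E_obj C y\<^esub> E_mor C f (v (Dom C f))) b)"
    if "y \<in> Obj C" for y
  proof (rule finsum_pointwise)
    show "abelian_monoid (E_obj C y :: ('k, ('o, 'm) E_basis \<Rightarrow> 'k) module)"
      using abelian_group_E_obj by (rule abelian_group.axioms(1))
    have "E_mor C f (v (Dom C f)) \<in> lin_carrier (E_basis_at C y)" if "f \<in> {f \<in> Mor C. Cod C f = y}" for f
      using E_mor_in[of f "Dom C f" y] Mor_hom[of f] that by simp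
    then show "(\<lambda>f. a f \<odot>\<^bsub>E_obj C y\<^esub> E_mor C f (v (Dom C f))) \<in> {f \<in> Mor C. Cod C f = y} \<rightarrow> carrier (E_obj C y)"
      by (auto simp: E_obj_simps lin_carrier_iff)
  qed (use finite_Mor in \<open>simp_all add: E_obj_simps\<close>)
  then show ?thesis
    by (simp add: E_module_def functor_module_def E_obj_simps fun_eq_iff)
qed

lemma abelian_group_E: "abelian_group E"
proof (rule abelian_groupI)
  fix v assume "v \<in> carrier E"
  then show "\<exists>w\<in>carrier E. w \<oplus>\<^bsub>E\<^esub> v = \<zero>\<^bsub>E\<^esub>"
    by (intro bexI[of _ "\<lambda>x\<in>Obj C. \<lambda>b. - v x b"]) (auto simp: E_simps PiE_iff lin_carrier_iff fun_eq_iff)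
qed (auto simp: E_simps PiE_iff lin_carrier_iff fun_eq_iff extensional_def)

lemma E_smult_closed: "a \<odot>\<^bsub>E\<^esub> v \<in> carrier E"
proof -
  have "E_mor C f (v (Dom C f)) \<in> (lin_carrier (E_basis_at C (Cod C f)) :: (_ \<Rightarrow> 'k) set)" if "f \<in> Mor C" for f
    using E_mor_in[OF Mor_hom[OF that]] .
  then show ?thesis
    unfolding E_smult E_simps by (auto simp: lin_carrier_iff intro!: sum.neutral)
qed

lemma emb_apply:
  assumes "u \<in> Mor C" shows "emb v u = emb_at (Cod C u) (v (Cod C u)) u"
proof -
  have "emb v u = (\<Sum>y\<in>Obj C. if y = Cod C u then emb_at (Cod C u) (v (Cod C u)) u else 0)"
    unfolding emb_def sum_fun_apply using emb_at_support by (intro sum.cong refl) auto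
  then show ?thesis using finite_Obj cod_in[OF assms] by simp
qed

lemma emb_in: "emb v \<in> lin_carrier (Mor C)"
  unfolding emb_def lin_carrier_iff sum_fun_apply using emb_at_support by (auto intro!: sum.neutral)

lemma lact_emb:
  assumes a: "a \<in> hom x y" shows "lact C a (emb v) = lact C a (emb_at x (v x))"
  unfolding lact_def using HomD(2)[OF a] by (intro ext sum.cong refl) (auto simp: emb_apply)

lemma emb_smult: "emb (a \<odot>\<^bsub>E\<^esub> v) = a \<otimes>\<^bsub>kC TYPE('k)\<^esub> emb v"
proof -
  have "emb (a \<odot>\<^bsub>E\<^esub> v) = (\<Sum>y\<in>Obj C. \<Sum>f\<in>{f \<in> Mor C. Cod C f = y}. smul (a f) (emb_at y (E_mor C f (v (Dom C f)))))"
    unfolding emb_def E_smult by (intro sum.cong refl) (simp add: emb_at_sum emb_at_scale)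
  also have "\<dots> = (\<Sum>y\<in>Obj C. \<Sum>f\<in>{f \<in> Mor C. Cod C f = y}. smul (a f) (lact C f (emb v)))"
  proof (intro sum.cong refl)
    fix y f assume "f \<in> {f \<in> Mor C. Cod C f = y}"
    then have "f \<in> hom (Dom C f) y" using Mor_hom by auto
    then show "smul (a f) (emb_at y (E_mor C f (v (Dom C f)))) = smul (a f) (lact C f (emb v))"
      by (simp add: emb_at_E_mor lact_emb)
  qed
  also have "\<dots> = (\<Sum>f\<in>Mor C. smul (a f) (lact C f (emb v)))"
    using finite_Mor finite_Obj cod_in by (intro sum.group) auto
  also have "\<dots> = a \<otimes>\<^bsub>kC TYPE('k)\<^esub> emb v"
    by (simp add: category_algebra_mult fun_eq_iff sum_fun_apply smul_def)
  finally show ?thesis .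
qed

lemma emb_add: "emb (v \<oplus>\<^bsub>E\<^esub> w) = emb v + emb w"
  unfolding emb_def E_simps(3) by (simp add: emb_at_add sum.distrib)

lemma emb_inj: "inj_on emb (carrier E)"
proof (rule inj_onI)
  fix v w assume v: "v \<in> carrier E" and w: "w \<in> carrier E" and eq: "emb v = emb w"
  have "v y = w y" for y
  proof (cases "y \<in> Obj C")
    case True
    let ?d = "\<lambda>b. v y b + (- 1) * w y b"
    have vw: "v y \<in> lin_carrier (E_basis_at C y)" "w y \<in> lin_carrier (E_basis_at C y)"
      using v w True by (auto simp: E_simps)
    have "emb_at y ?d u = 0" for u
    proof (cases "u \<in> Mor C \<and> Cod C u = y")
      case True
      then show ?thesis using fun_cong[OF eq, of u] emb_apply[of u v] emb_apply[of u w]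
        unfolding emb_at_add emb_at_scale by (simp add: smul_def)
    qed (use emb_at_support in blast)
    then have "?d = (\<lambda>b. 0)"
      using vw by (intro emb_at_kernel[OF True]) (auto simp: lin_carrier_iff fun_eq_iff)
    then show ?thesis by (simp add: fun_eq_iff)
  qed (use v w in \<open>auto simp: E_simps PiE_iff extensional_def\<close>)
  then show "v = w" ..
qed

lemma emb_module_hom: "restrict emb (carrier E) \<in> module_hom (kC TYPE('k)) E (regular_module (kC TYPE('k)))"
proof -
  interpret E: abelian_group E by (rule abelian_group_E)
  show ?thesis
    by (rule module_homI)
      (simp_all add: E.a_closed E_smult_closed emb_add emb_smult emb_in category_algebra_simps(1,3))
qed

text \<open>The functoriality of \<open>E\<close> is inherited from the associativity of the category algebra.\<close>

lemma left_module_E: "left_module (kC TYPE('k)) E"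
proof -
  interpret A: ring "kC TYPE('k)" by (rule ring_category_algebra)
  show ?thesis
    using emb_inj
    by (intro left_module_of_embedding[OF abelian_group_E A.left_module_regular_module _ emb_module_hom] E_smult_closed)
      (simp add: inj_on_restrict_eq)
qed

lemma fd_left_module_E: "fd_left_module (kC TYPE('k)) E"
  unfolding fd_left_module_def
proof (intro conjI left_module_E)
  let ?A = "kC TYPE('k)"
  interpret E: left_module ?A E by (rule left_module_E)
  have scalar: "scalar c \<odot>\<^bsub>E\<^esub> v = (\<lambda>x\<in>Obj C. \<lambda>b. c * v x b)" if v: "v \<in> carrier E" for c v
  proof (rule inj_onD[OF emb_inj])
    show "emb (scalar c \<odot>\<^bsub>E\<^esub> v) = emb (\<lambda>x\<in>Obj C. \<lambda>b. c * v x b)"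
      unfolding emb_smult category_algebra_mult_scalar[OF emb_in]
      by (simp add: emb_def emb_at_scale fun_eq_iff sum_fun_apply smul_def sum_distrib_left)
    show "(\<lambda>x\<in>Obj C. \<lambda>b. c * v x b) \<in> carrier E" using v by (auto simp: E_simps PiE_iff lin_carrier_iff)
  qed (rule E_smult_closed)
  have finsum: "(\<Oplus>\<^bsub>E\<^esub>i\<in>I. f i) = (\<lambda>x\<in>Obj C. \<lambda>b. \<Sum>i\<in>I. f i x b)"
    if "finite I" "f \<in> I \<rightarrow> carrier E" for I and f :: "('o \<times> ('o, 'm) E_basis) \<Rightarrow> _"
    using that
  proof (induction I rule: finite_induct)
    case (insert i I)
    then have "(\<Oplus>\<^bsub>E\<^esub>i\<in>insert i I. f i) = f i \<oplus>\<^bsub>E\<^esub> (\<Oplus>\<^bsub>E\<^esub>i\<in>I. f i)" by (intro E.M.finsum_insert) auto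
    then show ?case using insert by (auto simp: E_simps(3) fun_eq_iff)
  qed (simp add: E_simps)
  define P where "P = Sigma (Obj C) (E_basis_at C)"
  have finP: "finite P" unfolding P_def using finite_Obj by (intro finite_SigmaI) simp_all
  define \<beta> :: "'o \<times> ('o, 'm) E_basis \<Rightarrow> 'o \<Rightarrow> ('o, 'm) E_basis \<Rightarrow> 'k"
    where "\<beta> = (\<lambda>(x, b). \<lambda>y\<in>Obj C. \<lambda>b'. if y = x \<and> b' = b then 1 else 0)"
  have \<beta>: "\<beta> p \<in> carrier E" if "p \<in> P" for p
    using that by (auto simp: \<beta>_def E_simps lin_carrier_iff P_def)
  have \<beta>_apply: "\<beta> p x b = (if p = (x, b) then 1 else 0)" if "x \<in> Obj C" for p x b
    using that by (cases p) (auto simp: \<beta>_def)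
  have inj: "inj_on \<beta> P"
  proof (rule inj_onI)
    fix p q assume p: "p \<in> P" and q: "q \<in> P" and eq: "\<beta> p = \<beta> q"
    have "fst p \<in> Obj C" using p by (auto simp: P_def)
    from \<beta>_apply[OF this, of p "snd p"] \<beta>_apply[OF this, of q "snd p"]
    have "(1 :: 'k) = (if q = p then 1 else 0)" unfolding eq by simp
    then show "p = q" by (cases "q = p") simp_all
  qed
  have "\<exists>c. v = (\<Oplus>\<^bsub>E\<^esub>b\<in>\<beta> ` P. (c b \<odot>\<^bsub>?A\<^esub> \<one>\<^bsub>?A\<^esub>) \<odot>\<^bsub>E\<^esub> b)" if v: "v \<in> carrier E" for v
  proof -
    define c where "c b = v (fst (inv_into P \<beta> b)) (snd (inv_into P \<beta> b))" for b
    have c: "c (\<beta> p) = v (fst p) (snd p)" if "p \<in> P" for p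
      using inv_into_f_f[OF inj that] by (simp add: c_def)
    have "(\<Oplus>\<^bsub>E\<^esub>b\<in>\<beta> ` P. (c b \<odot>\<^bsub>?A\<^esub> \<one>\<^bsub>?A\<^esub>) \<odot>\<^bsub>E\<^esub> b)
        = (\<Oplus>\<^bsub>E\<^esub>p\<in>P. (c (\<beta> p) \<odot>\<^bsub>?A\<^esub> \<one>\<^bsub>?A\<^esub>) \<odot>\<^bsub>E\<^esub> \<beta> p)"
      using E_smult_closed inj by (intro E.M.finsum_reindex) auto
    also have "\<dots> = (\<lambda>x\<in>Obj C. \<lambda>b. \<Sum>p\<in>P. ((c (\<beta> p) \<odot>\<^bsub>?A\<^esub> \<one>\<^bsub>?A\<^esub>) \<odot>\<^bsub>E\<^esub> \<beta> p) x b)"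
      using E_smult_closed finP by (intro finsum) auto
    also have "\<dots> = v"
    proof
      fix x
      show "(\<lambda>x\<in>Obj C. \<lambda>b. \<Sum>p\<in>P. ((c (\<beta> p) \<odot>\<^bsub>?A\<^esub> \<one>\<^bsub>?A\<^esub>) \<odot>\<^bsub>E\<^esub> \<beta> p) x b) x = v x"
      proof (cases "x \<in> Obj C")
        case True
        have "(\<Sum>p\<in>P. ((c (\<beta> p) \<odot>\<^bsub>?A\<^esub> \<one>\<^bsub>?A\<^esub>) \<odot>\<^bsub>E\<^esub> \<beta> p) x b) = v x b" for b
        proof -
          have "(\<Sum>p\<in>P. ((c (\<beta> p) \<odot>\<^bsub>?A\<^esub> \<one>\<^bsub>?A\<^esub>) \<odot>\<^bsub>E\<^esub> \<beta> p) x b) = (\<Sum>p\<in>P. if p = (x, b) then v x b else 0)"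
          proof (intro sum.cong refl)
            fix p assume p: "p \<in> P"
            have "((c (\<beta> p) \<odot>\<^bsub>?A\<^esub> \<one>\<^bsub>?A\<^esub>) \<odot>\<^bsub>E\<^esub> \<beta> p) x b = v (fst p) (snd p) * \<beta> p x b"
              using scalar[OF \<beta>[OF p]] True by (simp add: category_algebra_simps(4) c[OF p])
            then show "((c (\<beta> p) \<odot>\<^bsub>?A\<^esub> \<one>\<^bsub>?A\<^esub>) \<odot>\<^bsub>E\<^esub> \<beta> p) x b = (if p = (x, b) then v x b else 0)"
              using True by (simp add: \<beta>_apply)
          qed
          also have "\<dots> = (if (x, b) \<in> P then v x b else 0)" using finP by simp
          also have "\<dots> = v x b" using v True by (auto simp: P_def E_simps PiE_iff lin_carrier_iff)
          finally show ?thesis .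
        qed
        then show ?thesis using True by simp
      qed (use v in \<open>auto simp: E_simps PiE_iff extensional_def\<close>)
    qed
    finally have "(\<Oplus>\<^bsub>E\<^esub>b\<in>\<beta> ` P. (c b \<odot>\<^bsub>?A\<^esub> \<one>\<^bsub>?A\<^esub>) \<odot>\<^bsub>E\<^esub> b) = v" .
    then show ?thesis by (intro exI[of _ c]) (rule sym)
  qed
  moreover have "finite (\<beta> ` P)" "\<beta> ` P \<subseteq> carrier E" using finP \<beta> by auto
  ultimately show "\<exists>B. finite B \<and> B \<subseteq> carrier E
      \<and> (\<forall>v\<in>carrier E. \<exists>c. v = (\<Oplus>\<^bsub>E\<^esub>b\<in>B. (c b \<odot>\<^bsub>?A\<^esub> \<one>\<^bsub>?A\<^esub>) \<odot>\<^bsub>E\<^esub> b))"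
    by (intro exI[of _ "\<beta> ` P"] conjI ballI)
qed

theorem gorenstein_projective_E: "gorenstein_projective (kC TYPE('k)) E"
proof -
  let ?A = "kC TYPE('k)"
  interpret A: ring ?A by (rule ring_category_algebra)
  interpret E: left_module ?A E by (rule left_module_E)
  interpret op: weighted_category "op_cat C" rho lam by (rule weighted_category_op_cat)
  have fg: "fg_submodules ?A" by (rule fg_submodules_category_algebra)
  have fg_op: "fg_submodules (op_ring ?A)"
    using op.fg_submodules_category_algebra[where 'k = 'k] by (simp add: category_algebra_op_cat)
  have ext_op: "kernel_extension (op_ring ?A)"
    using op.kernel_extension_category_algebra by (simp add: category_algebra_op_cat)
  define j where "j = (\<lambda>v\<in>carrier E. \<lambda>i\<in>{..<1::nat}. emb v)"
  have j: "j \<in> module_hom ?A E (free_module ?A 1)"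
  proof (rule module_homI)
    show "j v \<in> carrier (free_module ?A 1)" if "v \<in> carrier E" for v
      using that emb_in by (simp add: j_def category_algebra_simps(1))
  qed (auto simp: j_def E.M.a_closed E_smult_closed emb_add emb_smult category_algebra_simps(3) fun_eq_iff)
  have j_inj: "inj_on j (carrier E)"
  proof (rule inj_onI)
    fix v w assume v: "v \<in> carrier E" and w: "w \<in> carrier E" and eq: "j v = j w"
    have "emb v = emb w" using fun_cong[OF eq, of 0] v w by (simp add: j_def)
    then show "v = w" using inj_onD[OF emb_inj] v w by blast
  qed
  obtain n e where e: "e \<in> module_hom ?A (free_module ?A n) E" "e ` carrier (free_module ?A n) = carrier E"
    using generated_of_embedding[OF left_module_E fg j j_inj] by blast
  interpret torsionless_module ?A E n 1 e j
    by unfold_locales (use fg fg_op kernel_extension_category_algebra ext_op e j j_inj in auto)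
  show ?thesis
    unfolding gorenstein_projective_def
    using fd_algebra_category_algebra fd_left_module_E Ext_module_trivial Ext_dual_trivial bidual_eval_bij by blast
qed

end

theorem proposition3p2:
  fixes C :: "('o, 'm) precategory"
  assumes "skeletal_finite_free_EI C"
    and "projective_over TYPE('k::field) C"
  shows "gorenstein_projective (category_algebra C :: ('k, 'm \<Rightarrow> 'k) module) (E_module C)"
proof -
  obtain lam rho :: "'m \<Rightarrow> 'k" where "weighted_category C lam rho"
    using weighted_category_of_projective[OF assms] by blast
  then interpret weighted_category C lam rho .
  show ?thesis by (rule gorenstein_projective_E)
qed

end
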